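(* The PDE system $u_{ijk}=0$, $1\le i,j,k\le n$, has contact symmetry algebra $\mathfrak{g}=C_{n+1}$ (i.e. $\mathfrak{sp}_{2n+2}(\mathbb{C})$) and isotropy $P_{1,n+1}$ on the second jet space $(x^i,u,u_i,u_{ij})$. The generating functions are spanned by the following, graded by $\mathfrak{g}=\mathfrak{g}_{-3}\oplus\dots\oplus\mathfrak{g}_3$ as indicated (indices $i,j$ range over $1,\dots,n$; in the expression $x^ju_j-2u$ the index $j$ is summed): - $\mathfrak{g}_{-3}$: $1$; - $\mathfrak{g}_{-2}$: $x^i$; - $\mathfrak{g}_{-1}$: $u_i$, $\;x^ix^j$; - $\mathfrak{g}_0$: $u$, $\;x^iu_j$; - $\mathfrak{g}_1$: $x^i(x^ju_j-2u)$, $\;u_iu_j$; - $\mathfrak{g}_2$: $u_i(x^ju_j-2u)$; - $\mathfrak{g}_3$: $(x^ju_j-2u)^2$.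
   Context: Complex setting; $n\geq 1$ independent variables $x^1,\dots,x^n$, one dependent variable $u$; $u_i,u_{ij},u_{ijk}$ are jet variables. On $J^1(\mathbb{C}^n,\mathbb{C})$ with contact distribution $\mathcal{C}=\ker(du-u_idx^i)$, contact vector fields correspond to generating functions $f(x^i,u,u_i)$ via $\mathbf{S}_f=-f_{u_i}\frac{d}{dx^i}+f\partial_u+\frac{df}{dx^i}\partial_{u_i}$, $\frac{d}{dx^i}=\partial_{x^i}+u_i\partial_u$; the Lie bracket corresponds to the Lagrange bracket $[f,g]=fg_u-gf_u+\frac{df}{dx^i}g_{u_i}-\frac{dg}{dx^i}f_{u_i}$. A contact symmetry is a contact vector field whose prolongation to $J^3(\mathbb{C}^n,\mathbb{C})$ is tangent to the submanifold defined by the system; this submanifold is identified with the second jet space with coordinates $(x^i,u,u_i,u_{ij})$. $P_{1,n+1}$ is the parabolic subgroup of the group of type $C_{n+1}$ with crosses at nodes $1$ and $n+1$ (Bourbaki ordering), i.e. the stabilizer of a flag consisting of a line in a Lagrangian subspace of $\mathbb{C}^{2n+2}$; the grading $\mathfrak{g}=\mathfrak{g}_{-3}\oplus\dots\oplus\mathfrak{g}_3$ is the one induced by it, with Lie algebra of $P_{1,n+1}$ equal to $\mathfrak{g}_{\ge0}$ (the isotropy at the origin). *)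

theory Defs
  imports "HOL-Analysis.Analysis"
begin

section \<open>Jet spaces of maps from n-space to the line, \<open>n = CARD('n)\<close>\<close>

text \<open>
  The tuples are \<open>(x, u, p)\<close>, \<open>(x, u, p, q)\<close>, \<open>(x, u, p, q, r)\<close>, standing for the jet coordinates
  \<open>x\<^sup>i\<close>, \<open>u\<close>, \<open>u\<^sub>i\<close>, \<open>u\<^sub>i\<^sub>j\<close>, \<open>u\<^sub>i\<^sub>j\<^sub>k\<close>.  The types carry arbitrary arrays \<open>q\<close> and \<open>r\<close>; the jet spaces
  themselves are the subsets \<open>J2\<close> and \<open>J3\<close>, where these arrays are symmetric.
\<close>

type_synonym 'n jet1 = "(complex^'n) \<times> complex \<times> (complex^'n)"
type_synonym 'n jet2 = "(complex^'n) \<times> complex \<times> (complex^'n) \<times> (complex^'n^'n)"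
type_synonym 'n jet3 =
  "(complex^'n) \<times> complex \<times> (complex^'n) \<times> (complex^'n^'n) \<times> (complex^'n^'n^'n)"

definition symmetric2 :: "complex^'n^'n \<Rightarrow> bool" where
  "symmetric2 q \<longleftrightarrow> (\<forall>i j. q $ i $ j = q $ j $ i)"

definition symmetric3 :: "complex^'n^'n^'n \<Rightarrow> bool" where
  "symmetric3 r \<longleftrightarrow> (\<forall>i j k. r $ i $ j $ k = r $ j $ i $ k \<and> r $ i $ j $ k = r $ i $ k $ j)"

definition J2 :: "'n::finite jet2 set" where
  "J2 = {(x, u, p, q). symmetric2 q}"

definition J3 :: "'n::finite jet3 set" where
  "J3 = {(x, u, p, q, r). symmetric2 q \<and> symmetric3 r}"

definition pde :: "'n::finite jet3 set" where
  "pde = {(x, u, p, q, r) \<in> J3. \<forall>i j k. r $ i $ j $ k = 0}"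

text \<open>Holomorphy in several variables: complex Frechet differentiability on an open set.\<close>

definition holomorphic_fun :: "'n::finite jet1 set \<Rightarrow> ('n jet1 \<Rightarrow> complex) \<Rightarrow> bool" where
  "holomorphic_fun U f \<longleftrightarrow> open U \<and>
     (\<forall>z\<in>U. \<exists>D. (f has_derivative D) (at z) \<and>
        (\<forall>c x u p. D (c *s x, c * u, c *s p) = c * D (x, u, p)))"


section \<open>Contact vector fields and the Lagrange bracket\<close>

definition d_x :: "'n::finite \<Rightarrow> ('n jet1 \<Rightarrow> complex) \<Rightarrow> 'n jet1 \<Rightarrow> complex" where
  "d_x i f = (\<lambda>(x, u, p). deriv (\<lambda>t. f (x + t *s axis i 1, u, p)) 0)"

definition d_u :: "('n::finite jet1 \<Rightarrow> complex) \<Rightarrow> 'n jet1 \<Rightarrow> complex" where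
  "d_u f = (\<lambda>(x, u, p). deriv (\<lambda>t. f (x, u + t, p)) 0)"

definition d_p :: "'n::finite \<Rightarrow> ('n jet1 \<Rightarrow> complex) \<Rightarrow> 'n jet1 \<Rightarrow> complex" where
  "d_p i f = (\<lambda>(x, u, p). deriv (\<lambda>t. f (x, u, p + t *s axis i 1)) 0)"

definition ddx :: "'n::finite \<Rightarrow> ('n jet1 \<Rightarrow> complex) \<Rightarrow> 'n jet1 \<Rightarrow> complex" where
  "ddx i f = (\<lambda>(x, u, p). d_x i f (x, u, p) + p $ i * d_u f (x, u, p))"

definition lagrange_bracket ::
    "('n::finite jet1 \<Rightarrow> complex) \<Rightarrow> ('n jet1 \<Rightarrow> complex) \<Rightarrow> 'n jet1 \<Rightarrow> complex" where
  "lagrange_bracket f g = (\<lambda>z. f z * d_u g z - g z * d_u f z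
     + (\<Sum>i\<in>UNIV. ddx i f z * d_p i g z - ddx i g z * d_p i f z))"

text \<open>
  Coefficients of \<open>S\<^sub>f\<close> at \<open>\<partial>\<^bsub>x\<^sup>i\<^esub>\<close>, \<open>\<partial>\<^sub>u\<close>, \<open>\<partial>\<^bsub>u\<^sub>i\<^esub>\<close>, obtained by expanding
  \<open>d/dx\<^sup>i = \<partial>\<^bsub>x\<^sup>i\<^esub> + u\<^sub>i \<partial>\<^sub>u\<close> in \<open>S\<^sub>f = - f\<^bsub>u\<^sub>i\<^esub> d/dx\<^sup>i + f \<partial>\<^sub>u + (df/dx\<^sup>i) \<partial>\<^bsub>u\<^sub>i\<^esub>\<close>.
\<close>

definition S_x :: "('n::finite jet1 \<Rightarrow> complex) \<Rightarrow> 'n \<Rightarrow> 'n jet1 \<Rightarrow> complex" where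
  "S_x f i = (\<lambda>z. - d_p i f z)"

definition S_u :: "('n::finite jet1 \<Rightarrow> complex) \<Rightarrow> 'n jet1 \<Rightarrow> complex" where
  "S_u f = (\<lambda>(x, u, p). f (x, u, p) - (\<Sum>i\<in>UNIV. p $ i * d_p i f (x, u, p)))"

definition S_p :: "('n::finite jet1 \<Rightarrow> complex) \<Rightarrow> 'n \<Rightarrow> 'n jet1 \<Rightarrow> complex" where
  "S_p f i = ddx i f"


section \<open>Prolongation\<close>

text \<open>
  Total derivatives \<open>D\<^sub>i\<close> of functions on the first and on the second jet space.  On the second one,
  \<open>D\<^sub>i = \<partial>\<^bsub>x\<^sup>i\<^esub> + u\<^sub>i \<partial>\<^sub>u + \<Sum>\<^sub>j u\<^sub>i\<^sub>j \<partial>\<^bsub>u\<^sub>j\<^esub> + \<Sum>\<^bsub>j\<le>k\<^esub> u\<^sub>i\<^sub>j\<^sub>k \<partial>\<^bsub>u\<^sub>j\<^sub>k\<^esub>\<close>; the last sum is written as the derivative in the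
  direction of the symmetric matrix \<open>(u\<^sub>i\<^sub>j\<^sub>k)\<^sub>j\<^sub>k\<close>, which avoids ordering the indices.
\<close>

definition D1 :: "'n::finite \<Rightarrow> ('n jet1 \<Rightarrow> complex) \<Rightarrow> 'n jet2 \<Rightarrow> complex" where
  "D1 i F = (\<lambda>(x, u, p, q). ddx i F (x, u, p) + (\<Sum>j\<in>UNIV. q $ i $ j * d_p j F (x, u, p)))"

definition D2 :: "'n::finite \<Rightarrow> ('n jet2 \<Rightarrow> complex) \<Rightarrow> 'n jet3 \<Rightarrow> complex" where
  "D2 i F = (\<lambda>(x, u, p, q, r).
     D1 i (\<lambda>(x', u', p'). F (x', u', p', q)) (x, u, p, q)
     + deriv (\<lambda>t. F (x, u, p, q + map_matrix ((*) t) (r $ i))) 0)"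

text \<open>
  The standard prolongation formula \<open>\<phi>\<^sub>J\<^sub>k = D\<^sub>k \<phi>\<^sub>J - \<Sum>\<^sub>l u\<^sub>J\<^sub>l D\<^sub>k \<xi>\<^sup>l\<close>, where \<open>\<xi>\<^sup>l\<close> and \<open>\<phi>\<^sub>J\<close> are the coefficients
  at \<open>\<partial>\<^bsub>x\<^sup>l\<^esub>\<close> and \<open>\<partial>\<^bsub>u\<^sub>J\<^esub>\<close>.
\<close>

definition S_q :: "('n::finite jet1 \<Rightarrow> complex) \<Rightarrow> 'n \<Rightarrow> 'n \<Rightarrow> 'n jet2 \<Rightarrow> complex" where
  "S_q f i j = (\<lambda>(x, u, p, q).
     D1 j (S_p f i) (x, u, p, q) - (\<Sum>l\<in>UNIV. q $ i $ l * D1 j (S_x f l) (x, u, p, q)))"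

definition S_r :: "('n::finite jet1 \<Rightarrow> complex) \<Rightarrow> 'n \<Rightarrow> 'n \<Rightarrow> 'n \<Rightarrow> 'n jet3 \<Rightarrow> complex" where
  "S_r f i j k = (\<lambda>(x, u, p, q, r).
     D2 k (S_q f i j) (x, u, p, q, r)
     - (\<Sum>l\<in>UNIV. r $ i $ j $ l * D1 k (S_x f l) (x, u, p, q)))"

definition prolong2 :: "('n::finite jet1 \<Rightarrow> complex) \<Rightarrow> 'n jet2 \<Rightarrow> 'n jet2" where
  "prolong2 f = (\<lambda>(x, u, p, q).
     (\<chi> i. S_x f i (x, u, p), S_u f (x, u, p), \<chi> i. S_p f i (x, u, p),
      \<chi> i j. S_q f i j (x, u, p, q)))"

definition prolong3 :: "('n::finite jet1 \<Rightarrow> complex) \<Rightarrow> 'n jet3 \<Rightarrow> 'n jet3" where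
  "prolong3 f = (\<lambda>(x, u, p, q, r).
     (\<chi> i. S_x f i (x, u, p), S_u f (x, u, p), \<chi> i. S_p f i (x, u, p),
      \<chi> i j. S_q f i j (x, u, p, q), \<chi> i j k. S_r f i j k (x, u, p, q, r)))"


section \<open>Contact symmetries over an open set of the first jet space\<close>

text \<open>
  Contact vector fields are represented by their generating functions.  A function on \<open>U\<close> is
  represented by its extension by zero, so that equality of functions on \<open>U\<close> is equality.
\<close>

definition restrict0 :: "'a set \<Rightarrow> ('a \<Rightarrow> complex) \<Rightarrow> 'a \<Rightarrow> complex" where
  "restrict0 U f = (\<lambda>z. if z \<in> U then f z else 0)"

text \<open>The linear submanifold \<open>pde\<close> is cut out by \<open>r = 0\<close>; a vector is tangent to it iff its
  \<open>r\<close>-component vanishes.\<close>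

definition contact_symmetries :: "'n::finite jet1 set \<Rightarrow> ('n jet1 \<Rightarrow> complex) set" where
  "contact_symmetries U = {f. holomorphic_fun U f \<and> (\<forall>z. z \<notin> U \<longrightarrow> f z = 0) \<and>
     (\<forall>x u p q r. (x, u, p) \<in> U \<and> (x, u, p, q, r) \<in> pde \<longrightarrow>
        (case prolong3 f (x, u, p, q, r) of (X, Y, P, Q, R) \<Rightarrow> R = 0))}"

text \<open>\<open>pde\<close> is identified with \<open>J2\<close>; the isotropy is that of the second prolongation.\<close>

definition isotropy :: "'n::finite jet1 set \<Rightarrow> 'n jet2 \<Rightarrow> ('n jet1 \<Rightarrow> complex) set" where
  "isotropy U a = {f \<in> contact_symmetries U. prolong2 f a = 0}"

definition gen_span ::
    "'n::finite jet1 set \<Rightarrow> ('n jet1 \<Rightarrow> complex) set \<Rightarrow> ('n jet1 \<Rightarrow> complex) set" where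
  "gen_span U G = {restrict0 U (\<lambda>z. \<Sum>g\<in>T. c g * g z) | T c. finite T \<and> T \<subseteq> G}"

definition wgen :: "'n::finite jet1 \<Rightarrow> complex" where
  "wgen = (\<lambda>(x, u, p). (\<Sum>j\<in>UNIV. x $ j * p $ j) - 2 * u)"

definition generators :: "int \<Rightarrow> ('n::finite jet1 \<Rightarrow> complex) set" where
  "generators k =
    (if k = -3 then {\<lambda>(x, u, p). 1}
     else if k = -2 then {\<lambda>(x, u, p). x $ i | i. True}
     else if k = -1 then {\<lambda>(x, u, p). p $ i | i. True} \<union> {\<lambda>(x, u, p). x $ i * x $ j | i j. True}
     else if k = 0 then {\<lambda>(x, u, p). u} \<union> {\<lambda>(x, u, p). x $ i * p $ j | i j. True}
     else if k = 1 then {\<lambda>(x, u, p). x $ i * wgen (x, u, p) | i. True}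
                      \<union> {\<lambda>(x, u, p). p $ i * p $ j | i j. True}
     else if k = 2 then {\<lambda>(x, u, p). p $ i * wgen (x, u, p) | i. True}
     else if k = 3 then {\<lambda>(x, u, p). (wgen (x, u, p))\<^sup>2}
     else {})"


section \<open>The symplectic Lie algebra of rank \<open>n + 1\<close>\<close>

text \<open>The symplectic space of dimension \<open>2n + 2\<close> has a Darboux basis indexed by \<open>Inl i\<close>, \<open>Inr i\<close>
  with \<open>i\<close> in the type \<open>'n option\<close> of cardinality \<open>n + 1\<close>.\<close>

type_synonym 'n spvec = "complex^('n option + 'n option)"
type_synonym 'n spmat = "complex^('n option + 'n option)^('n option + 'n option)"

definition symp_form :: "'n::finite spvec \<Rightarrow> 'n spvec \<Rightarrow> complex" where
  "symp_form v w = (\<Sum>i\<in>UNIV. v $ Inl i * w $ Inr i - v $ Inr i * w $ Inl i)"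

definition sp :: "'n::finite spmat set" where
  "sp = {A. \<forall>v w. symp_form (A *v v) w + symp_form v (A *v w) = 0}"

definition commutator :: "'n::finite spmat \<Rightarrow> 'n spmat \<Rightarrow> 'n spmat" where
  "commutator A B = A ** B - B ** A"

definition lagrangian :: "'n::finite spvec set \<Rightarrow> bool" where
  "lagrangian L \<longleftrightarrow> vec.subspace L \<and> vec.dim L = CARD('n) + 1 \<and>
     (\<forall>v\<in>L. \<forall>w\<in>L. symp_form v w = 0)"

definition line_lagrangian_flag :: "'n::finite spvec set \<Rightarrow> 'n spvec set \<Rightarrow> bool" where
  "line_lagrangian_flag l L \<longleftrightarrow>
     vec.subspace l \<and> vec.dim l = 1 \<and> lagrangian L \<and> l \<subseteq> L"

text \<open>The Lie algebra of the stabilizer of a flag in the symplectic group.\<close>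

definition flag_stabilizer :: "'n::finite spvec set \<Rightarrow> 'n spvec set \<Rightarrow> 'n spmat set" where
  "flag_stabilizer l L = {A \<in> sp. (\<forall>v\<in>l. A *v v \<in> l) \<and> (\<forall>v\<in>L. A *v v \<in> L)}"

text \<open>
  Elements of the diagonal Cartan subalgebra, and the values on them of the simple roots in Bourbaki
  numbering: \<open>\<alpha>\<^sub>k = \<epsilon>\<^sub>k - \<epsilon>\<^bsub>k+1\<^esub>\<close> for \<open>k \<le> n\<close> and \<open>\<alpha>\<^bsub>n+1\<^esub> = 2 \<epsilon>\<^bsub>n+1\<^esub>\<close>.  The bijection \<open>e\<close> from \<open>{1..n+1}\<close>
  to \<open>'n option\<close> orders the weights, \<open>\<epsilon>\<^sub>k\<close> being the weight of the basis vector \<open>Inl (e k)\<close>.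
\<close>

definition cartan :: "('n::finite option \<Rightarrow> complex) \<Rightarrow> 'n spmat" where
  "cartan h = (\<chi> a b. if a = b then (case a of Inl i \<Rightarrow> h i | Inr i \<Rightarrow> - h i) else 0)"

definition simple_root ::
    "(nat \<Rightarrow> 'n::finite option) \<Rightarrow> nat \<Rightarrow> ('n option \<Rightarrow> complex) \<Rightarrow> complex" where
  "simple_root e k h =
    (if k \<le> CARD('n) then h (e k) - h (e (k + 1)) else 2 * h (e (CARD('n) + 1)))"

text \<open>
  Degree \<open>d\<close> part of the grading given by a set \<open>C\<close> of crossed nodes: the \<open>d\<close>-eigenspace of the grading
  element, on which the simple roots take the value 1 at crossed and 0 at uncrossed nodes.
\<close>

definition sp_grading ::
    "(nat \<Rightarrow> 'n::finite option) \<Rightarrow> nat set \<Rightarrow> int \<Rightarrow> 'n spmat set" where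
  "sp_grading e C d = {A \<in> sp. \<exists>h.
     (\<forall>k\<in>{1..CARD('n) + 1}. simple_root e k h = (if k \<in> C then 1 else 0)) \<and>
     commutator (cartan h) A = map_matrix ((*) (of_int d)) A}"

text \<open>The flag stabilized by the standard parabolic subalgebra with crosses at 1 and \<open>n + 1\<close>.\<close>

definition std_line :: "(nat \<Rightarrow> 'n::finite option) \<Rightarrow> 'n spvec set" where
  "std_line e = vec.span {axis (Inl (e 1)) 1}"

definition std_lagrangian :: "'n::finite spvec set" where
  "std_lagrangian = vec.span (range (\<lambda>i. axis (Inl i) 1))"

definition lie_isomorphism ::
    "'n::finite jet1 set \<Rightarrow> (('n jet1 \<Rightarrow> complex) \<Rightarrow> 'n spmat) \<Rightarrow> bool" where
  "lie_isomorphism U \<phi> \<longleftrightarrow> bij_betw \<phi> (contact_symmetries U) sp \<and>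
     (\<forall>f\<in>contact_symmetries U. \<forall>g\<in>contact_symmetries U.
        (\<lambda>z. f z + g z) \<in> contact_symmetries U \<and>
        \<phi> (\<lambda>z. f z + g z) = \<phi> f + \<phi> g) \<and>
     (\<forall>c. \<forall>f\<in>contact_symmetries U.
        (\<lambda>z. c * f z) \<in> contact_symmetries U \<and>
        \<phi> (\<lambda>z. c * f z) = map_matrix ((*) c) (\<phi> f)) \<and>
     (\<forall>f\<in>contact_symmetries U. \<forall>g\<in>contact_symmetries U.
        restrict0 U (lagrange_bracket f g) \<in> contact_symmetries U \<and>
        \<phi> (restrict0 U (lagrange_bracket f g)) = commutator (\<phi> f) (\<phi> g))"

end

theory Submission
  imports Defs "HOL-Complex_Analysis.Cauchy_Integral_Formula"
begin

text \<open>
  The first jet space is an affine chart of the projective space of the symplectic space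
  \<open>\<complex>\<^bsup>2n+2\<^esup>\<close>: the jet \<open>(x, u, p)\<close> has homogeneous coordinates \<open>y = (1, x, p, s)\<close> with \<open>s = 2 u - x \<cdot> p\<close>,
  and the contact hyperplane at \<open>y\<close> is the symplectic complement of \<open>y\<close>.  The listed generating
  functions are, up to sign, the quadratic monomials in \<open>1, x, p, s\<close>, with \<open>u = (s + x \<cdot> p) / 2\<close>
  in place of \<open>1 \<cdot> s\<close>.  A quadratic form in \<open>y\<close> is \<open>\<omega>(A y, y) / 2\<close> for a unique \<open>A\<close> in the
  symplectic Lie algebra; this is the function \<open>ham c A\<close>, and the Lagrange bracket of two of these is
  the one of the commutator (\<open>lagrange_bracket_ham\<close>).

  Quadratic functions are symmetries.  Freeze the second derivatives to a symmetric matrix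
  \<open>q\<close>.  The total derivative \<open>D\<^sub>i\<close> then acts on functions of first jets as a vector
  field, and the components of the prolongation of \<open>S\<^sub>f\<close> along \<open>u\<^sub>i\<^sub>j\<close> and (at
  \<open>u\<^sub>i\<^sub>j\<^sub>k = 0\<close>) along \<open>u\<^sub>i\<^sub>j\<^sub>k\<close> are \<open>D\<^sub>j D\<^sub>i f\<close> and \<open>D\<^sub>k D\<^sub>j D\<^sub>i f\<close>.
  The vectors \<open>E\<^sub>i = D\<^sub>i y\<close> satisfy \<open>D\<^sub>j E\<^sub>i = 0\<close>, so that three total derivatives
  kill every quadratic form in \<open>y\<close>, and two turn it into \<open>\<omega>(A E\<^sub>j, E\<^sub>i)\<close>.

  Symmetries are quadratic.  The condition \<open>D\<^sub>k D\<^sub>j D\<^sub>i f = 0\<close> for all \<open>q\<close> says that \<open>f\<close> is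
  a polynomial of degree at most 2 along contact lines, which in the coordinates \<open>(x, s, p)\<close> are
  straight lines.  The contact lines through a point \<open>y\<close> fill a hyperplane, and near \<open>y\<close> the function
  \<open>f\<close> agrees on it with its second Taylor polynomial at \<open>y\<close>.  Hence \<open>f\<close> is quadratic also along
  those lines in the hyperplane that are not contact lines.  Moving \<open>y\<close>, one reaches through a given
  point all directions \<open>v\<^sub>1 + \<tau> v\<close> with \<open>v\<^sub>1\<close> a fixed contact direction, \<open>v\<close> arbitrary and \<open>\<tau> \<noteq> 0\<close>
  small.  The third derivative in direction \<open>v\<^sub>1 + \<tau> v\<close> is a cubic polynomial in \<open>\<tau>\<close> whose leading
  coefficient is the third derivative in direction \<open>v\<close>; so all third derivatives vanish
  (\<open>dir_deriv_cubed_heis_eq_0\<close>).  Thus \<open>f\<close> is locally of the form \<open>ham c A\<close>, and globally so because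
  \<open>A\<close> is determined by the germ and the domain is connected (\<open>contact_symmetries_eq\<close>).

  Isotropy and grading.  The second prolongation of \<open>ham c A\<close> vanishes at \<open>(x, u, p, q)\<close> iff \<open>A\<close>
  preserves the line spanned by \<open>y\<close> and the Lagrangian subspace spanned by \<open>y\<close> and the \<open>E\<^sub>i\<close>.  The
  coordinates \<open>1, x, p, s\<close> are weight vectors of the grading element, so the degree of a monomial can
  be read off from the weights of its two factors.
\<close>

section \<open>Directional derivatives of holomorphic functions\<close>

text \<open>
  The complex structure of the jet space, whose product type carries the real one.
\<close>

definition cscale :: "complex \<Rightarrow> 'n::finite jet1 \<Rightarrow> 'n jet1" where
  "cscale c = (\<lambda>(x, u, p). (c *s x, c * u, c *s p))"

definition dir_deriv :: "'n::finite jet1 \<Rightarrow> ('n jet1 \<Rightarrow> complex) \<Rightarrow> 'n jet1 \<Rightarrow> complex" where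
  "dir_deriv w f z = deriv (\<lambda>t. f (z + cscale t w)) 0"

lemma cscale_Pair [simp]: "cscale c (x, u, p) = (c *s x, c * u, c *s p)"
  by (simp add: cscale_def)

lemma cscale_simps [simp]: "cscale 0 w = 0" "cscale 1 w = w" "cscale (a + b) w = cscale a w
    + cscale b w"
  "cscale c (v + w) = cscale c v + cscale c w" "cscale a (cscale b w) = cscale (a * b) w"
  by (cases w; cases v; auto simp: vec_eq_iff algebra_simps zero_prod_def)+

lemma bounded_linear_cscale: "bounded_linear (\<lambda>c. cscale c w)"
proof -
  have "linear (\<lambda>c. cscale c w)"
    by (cases w, intro linearI) (auto simp: vec_eq_iff algebra_simps)
  then show ?thesis by (simp add: linear_conv_bounded_linear)
qed

lemma continuous_on_cscale [continuous_intros]: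
  "continuous_on S g \<Longrightarrow> continuous_on S (\<lambda>t. cscale (g t) w)"
  using bounded_linear.continuous_on[OF bounded_linear_cscale] .

lemma has_derivative_line:
  "((\<lambda>t. z + cscale t w) has_derivative (\<lambda>h. cscale h w)) (at t)"
  using has_derivative_add[OF has_derivative_const
      bounded_linear_imp_has_derivative[OF bounded_linear_cscale]] by simp

lemma holomorphic_fun_open: "holomorphic_fun U f \<Longrightarrow> open U"
  by (simp add: holomorphic_fun_def)

lemma dir_deriv_eqI:
  assumes "(f has_derivative D) (at z)" "\<And>c. D (cscale c w) = c * D w"
  shows "dir_deriv w f z = D w"
proof -
  have "((\<lambda>t. z + cscale t w) has_derivative (\<lambda>h. cscale h w)) (at 0)"
    by (rule has_derivative_line)
  then have "((\<lambda>t. f (z + cscale t w)) has_derivative (\<lambda>h. D (cscale h w))) (at 0)"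
    by (rule has_derivative_compose) (simp add: assms(1))
  then have "((\<lambda>t. f (z + cscale t w)) has_field_derivative D w) (at 0)"
    by (simp add: has_field_derivative_def assms(2) mult_commute_abs)
  then show ?thesis by (simp add: dir_deriv_def DERIV_imp_deriv)
qed

lemma holomorphic_fun_has_derivative:
  assumes "holomorphic_fun U f" "z \<in> U"
  shows "(f has_derivative (\<lambda>w. dir_deriv w f z)) (at z)"
    and "dir_deriv (cscale c w) f z = c * dir_deriv w f z"
proof -
  obtain D where D: "(f has_derivative D) (at z)"
    and D0: "\<forall>c x u p. D (c *s x, c * u, c *s p) = c * D (x, u, p)"
    using assms unfolding holomorphic_fun_def by blast
  have D_cscale: "D (cscale c w) = c * D w" for c w
    using D0 by (cases w) simp
  have "dir_deriv w f z = D w" for w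
    using D D_cscale by (rule dir_deriv_eqI)
  then have eq: "(\<lambda>w. dir_deriv w f z) = D" by auto
  show "(f has_derivative (\<lambda>w. dir_deriv w f z)) (at z)" using D by (simp add: eq)
  show "dir_deriv (cscale c w) f z = c * dir_deriv w f z" using D_cscale by (metis eq)
qed

lemma holomorphic_fun_dir_deriv_linear: "holomorphic_fun U f \<Longrightarrow> z \<in> U \<Longrightarrow> linear (\<lambda>w. dir_deriv w f z)"
  by (rule has_derivative_linear, rule holomorphic_fun_has_derivative)

lemma has_field_derivative_along:
  assumes "holomorphic_fun U f" "\<gamma> t \<in> U" "(\<gamma> has_derivative (\<lambda>h. cscale h w)) (at t)"
  shows "((\<lambda>t. f (\<gamma> t)) has_field_derivative dir_deriv w f (\<gamma> t)) (at t)"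
proof -
  have "((\<lambda>t. f (\<gamma> t)) has_derivative (\<lambda>h. dir_deriv (cscale h w) f (\<gamma> t))) (at t)"
    using has_derivative_compose[OF assms(3) holomorphic_fun_has_derivative(1)[OF assms(1,2)]] .
  then show ?thesis
    by (simp add: has_field_derivative_def holomorphic_fun_has_derivative(2)[OF assms(1,2)]
        mult_commute_abs)
qed

lemma continuous_on_holomorphic_fun:
  assumes "holomorphic_fun U f"
  shows "continuous_on U f"
proof (rule continuous_at_imp_continuous_on, rule ballI)
  fix z assume "z \<in> U"
  then show "isCont f z"
    by (rule has_derivative_continuous[OF holomorphic_fun_has_derivative(1)[OF assms]])
qed

text \<open>
  Cauchy's formula on the circle \<open>\<gamma>\<close> in the complex line through \<open>z\<close> in direction \<open>w\<close>.  Only the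
  argument of \<open>f\<close> on the right depends on \<open>z\<close>, so continuity and differentiability in \<open>z\<close> can be
  carried from \<open>f\<close> over to its derivative.
\<close>

lemma Cauchy_dir_deriv:
  assumes "holomorphic_fun U f" "r > 0" "\<And>t. norm t \<le> r \<Longrightarrow> z + cscale t w \<in> U"
  defines "\<gamma> \<equiv> \<lambda>t::real. r * exp (2 * pi * \<i> * t)"
  shows "((\<lambda>t. f (z + cscale (\<gamma> t) w) / \<gamma> t) has_integral dir_deriv w f z) {0..1}"
proof -
  define g where "g = (\<lambda>t. f (z + cscale t w))"
  have der: "\<exists>D. (g has_field_derivative D) (at t)" if "norm t \<le> r" for t
    using has_field_derivative_along[OF assms(1) assms(3)[OF that] has_derivative_line]
    unfolding g_def by blast
  have "continuous_on (cball 0 r) g"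
    by (rule continuous_at_imp_continuous_on) (use der DERIV_isCont in force)
  moreover have "g holomorphic_on ball 0 r"
    using der by (subst holomorphic_on_open) force+
  ultimately have "((\<lambda>u. g u / (u - 0)^(Suc 1)) has_contour_integral
      ((2 * pi * \<i>) / fact 1 * (deriv ^^ 1) g 0)) (circlepath 0 r)"
    using \<open>r > 0\<close> by (intro Cauchy_has_contour_integral_higher_derivative_circlepath) auto
  then have "((\<lambda>t. g (circlepath 0 r t) / (circlepath 0 r t)\<^sup>2 * vector_derivative (circlepath 0 r)
      (at t))
      has_integral 2 * pi * \<i> * dir_deriv w f z) {0..1}"
    by (simp add: has_contour_integral dir_deriv_def g_def power2_eq_square)
  moreover have "g (circlepath 0 r t) / (circlepath 0 r t)\<^sup>2 * vector_derivative (circlepath 0 r) (at t)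
      = 2 * pi * \<i> * (g (\<gamma> t) / \<gamma> t)" for t
  proof -
    have "vector_derivative (circlepath 0 r) (at t) = 2 * pi * \<i> * \<gamma> t" "circlepath 0 r t = \<gamma> t"
      by (simp add: vector_derivative_circlepath \<gamma>_def, simp add: circlepath \<gamma>_def)
    moreover have "\<gamma> t \<noteq> 0" using \<open>r > 0\<close> by (simp add: \<gamma>_def)
    ultimately show ?thesis by (simp add: power2_eq_square)
  qed
  ultimately have "((\<lambda>t. 2 * pi * \<i> * (g (\<gamma> t) / \<gamma> t)) has_integral 2 * pi * \<i> * dir_deriv w f z)
      {0..1}"
    by simp
  from has_integral_mult_right[OF this, of "1 / (2 * pi * \<i>)"]
  show ?thesis by (simp add: g_def)
qed

text \<open>
  One radius serves all base points near \<open>z\<close>, as differentiation under the integral sign requires.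
\<close>

lemma Cauchy_dir_deriv_nhd:
  assumes "holomorphic_fun U f" "z \<in> U"
  obtains e r where "e > 0" "r > 0" "ball z e \<subseteq> U"
    "\<And>z' t. z' \<in> ball z e \<Longrightarrow> norm t \<le> r \<Longrightarrow> z' + cscale t w \<in> U"
proof -
  obtain e where e: "e > 0" "ball z e \<subseteq> U"
    using assms by (meson holomorphic_fun_open open_contains_ball)
  obtain K where K: "\<And>t. norm (cscale t w) \<le> norm t * K" "K > 0"
    using bounded_linear.pos_bounded[OF bounded_linear_cscale[of w]] by blast
  show ?thesis
  proof (rule that[of "e/2" "e/(2*K)"])
    fix z' and t :: complex assume *: "z' \<in> ball z (e/2)" "norm t \<le> e/(2*K)"
    have "norm (cscale t w) \<le> e/2"
      using K(1)[of t] mult_right_mono[OF *(2), of K] K(2) by simp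
    then have "dist z (z' + cscale t w) < e"
      using *(1) norm_triangle_ineq4[of "z - z'" "cscale t w"]
      by (simp add: dist_norm algebra_simps)
    then show "z' + cscale t w \<in> U" using e by auto
  qed (use e K in auto)
qed

text \<open>
  This makes \<open>f\<close> continuously differentiable, which is what the Leibniz rule asks of the integrand
  in Cauchy's formula.
\<close>

lemma continuous_on_dir_deriv:
  assumes "holomorphic_fun U f"
  shows "continuous_on U (dir_deriv w f)"
proof (rule continuous_at_imp_continuous_on, rule ballI)
  fix z assume "z \<in> U"
  from Cauchy_dir_deriv_nhd[OF assms this, of w]
  obtain e r where er: "e > 0" "r > 0" "ball z e \<subseteq> U"
    and U: "\<And>z' t. z' \<in> ball z e \<Longrightarrow> norm t \<le> r \<Longrightarrow> z' + cscale t w \<in> U" by metis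
  define \<gamma> where "\<gamma> = (\<lambda>t::real. r * exp (2 * pi * \<i> * t))"
  have \<gamma>: "norm (\<gamma> t) = r" "\<gamma> t \<noteq> 0" for t using er by (auto simp: \<gamma>_def norm_mult)
  have "dir_deriv w f z' = integral (cbox 0 1) (\<lambda>t. f (z' + cscale (\<gamma> t) w) / \<gamma> t)" if "z'
      \<in> ball z e" for z'
    using Cauchy_dir_deriv[OF assms er(2) U[OF that]] by (auto simp: \<gamma>_def integral_unique)
  moreover have "continuous_on (ball z e) (\<lambda>z'. integral (cbox 0 1) (\<lambda>t. f (z'
      + cscale (\<gamma> t) w) / \<gamma> t))"
  proof (rule integral_continuous_on_param)
    have "continuous_on (ball z e \<times> cbox 0 1) (\<lambda>s. fst s + cscale (\<gamma> (snd s)) w)"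
      unfolding \<gamma>_def by (intro continuous_intros)
    then have "continuous_on (ball z e \<times> cbox 0 1) (\<lambda>s. f (fst s + cscale (\<gamma> (snd s)) w))"
      by (rule continuous_on_compose2[OF continuous_on_holomorphic_fun[OF assms]]) (use U \<gamma> in auto)
    moreover have "continuous_on (ball z e \<times> cbox 0 1) (\<lambda>s. \<gamma> (snd s))"
      unfolding \<gamma>_def by (intro continuous_intros)
    ultimately have "continuous_on (ball z e \<times> cbox 0 1) (\<lambda>s. f (fst s
        + cscale (\<gamma> (snd s)) w) / \<gamma> (snd s))"
      by (rule continuous_on_divide) (use \<gamma> in auto)
    then show "continuous_on (ball z e \<times> cbox 0 1) (\<lambda>(z', t). f (z' + cscale (\<gamma> t) w) / \<gamma> t)"
      by (simp add: case_prod_unfold)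
  qed
  ultimately have "continuous_on (ball z e) (dir_deriv w f)"
      by (metis (no_types, lifting) continuous_on_eq)
  then show "isCont (dir_deriv w f) z" using er by (simp add: continuous_on_eq_continuous_at)
qed

text \<open>
  Differentiation under the integral sign in Cauchy's formula.  All further differentiations rest on
  this closure property, since the prolongation formula iterates partial derivatives.
\<close>

lemma holomorphic_fun_dir_deriv:
  assumes "holomorphic_fun U f"
  shows "holomorphic_fun U (dir_deriv w f)"
  unfolding holomorphic_fun_def
proof (intro conjI ballI)
  show "open U" using assms by (rule holomorphic_fun_open)
  fix z assume "z \<in> U"
  from Cauchy_dir_deriv_nhd[OF assms this, of w]
  obtain e r where er: "e > 0" "r > 0" "ball z e \<subseteq> U"
    and U: "\<And>z' t. z' \<in> ball z e \<Longrightarrow> norm t \<le> r \<Longrightarrow> z' + cscale t w \<in> U" by metis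
  define \<gamma> where "\<gamma> = (\<lambda>t::real. r * exp (2 * pi * \<i> * t))"
  have \<gamma>: "norm (\<gamma> t) = r" "\<gamma> t \<noteq> 0" for t using er by (auto simp: \<gamma>_def norm_mult)
  define F where "F = (\<lambda>z' t. f (z' + cscale (\<gamma> t) w) / \<gamma> t)"
  define F' where "F' = (\<lambda>z' t. Blinfun (\<lambda>v. dir_deriv v f (z' + cscale (\<gamma> t) w) / \<gamma> t))"
  have der: "((\<lambda>z'. F z' t) has_derivative (\<lambda>v. dir_deriv v f (z' + cscale (\<gamma> t) w) / \<gamma> t)) (at z')"
    if "z' \<in> ball z e" for z' t
  proof -
    have "((\<lambda>z'. z' + cscale (\<gamma> t) w) has_derivative (\<lambda>v. v)) (at z')"
      using has_derivative_add[OF has_derivative_ident has_derivative_const] by simp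
    then have "((\<lambda>z'. f (z' + cscale (\<gamma> t) w)) has_derivative (\<lambda>v. dir_deriv v f (z'
        + cscale (\<gamma> t) w))) (at z')"
      by (rule has_derivative_compose)
         (use \<gamma> in \<open>simp add: holomorphic_fun_has_derivative(1)[OF assms U[OF that]]\<close>)
    then show ?thesis unfolding F_def
      by (rule bounded_linear.has_derivative[OF bounded_linear_divide])
  qed
  have F': "blinfun_apply (F' z' t) = (\<lambda>v. dir_deriv v f (z' + cscale (\<gamma> t) w) / \<gamma> t)"
    if "z' \<in> ball z e" for z' t
    unfolding F'_def using has_derivative_bounded_linear[OF der[OF that]]
    by (rule bounded_linear_Blinfun_apply)
  have cont_F': "continuous_on (ball z e \<times> cbox 0 1) (\<lambda>(z', t). F' z' t)"
  proof (rule continuous_on_blinfun_componentwise)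
    fix b :: "'a jet1"
    have "continuous_on (ball z e \<times> cbox 0 1) (\<lambda>s. fst s + cscale (\<gamma> (snd s)) w)"
      unfolding \<gamma>_def by (intro continuous_intros)
    then have "continuous_on (ball z e \<times> cbox 0 1) (\<lambda>s. dir_deriv b f (fst s + cscale (\<gamma> (snd s)) w))"
      by (rule continuous_on_compose2[OF continuous_on_dir_deriv[OF assms]]) (use U \<gamma> in auto)
    moreover have "continuous_on (ball z e \<times> cbox 0 1) (\<lambda>s. \<gamma> (snd s))"
      unfolding \<gamma>_def by (intro continuous_intros)
    ultimately have "continuous_on (ball z e \<times> cbox 0 1) (\<lambda>s. dir_deriv b f (fst s
        + cscale (\<gamma> (snd s)) w) / \<gamma> (snd s))"
      by (rule continuous_on_divide) (use \<gamma> in auto)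
    then show "continuous_on (ball z e \<times> cbox 0 1) (\<lambda>s. blinfun_apply (case s of (z', t) \<Rightarrow> F' z' t) b)"
      by (rule continuous_on_eq) (auto simp: F')
  qed
  have int_F: "F z' integrable_on cbox 0 1" if "z' \<in> ball z e" for z'
    using Cauchy_dir_deriv[OF assms er(2) U[OF that]] by (auto simp: F_def \<gamma>_def integrable_on_def)
  have der_int: "((\<lambda>z'. integral (cbox 0 1) (F z'))
      has_derivative integral (cbox 0 1) (F' z)) (at z within ball z e)"
  proof (rule leibniz_rule[OF _ int_F cont_F'])
    fix z' and t :: real assume "z' \<in> ball z e"
    then show "((\<lambda>z'. F z' t) has_derivative blinfun_apply (F' z' t)) (at z' within ball z e)"
      using der[of z' t] by (simp add: F' has_derivative_at_withinI)
  qed (use er in simp_all)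
  have dir_deriv_int: "dir_deriv w f z' = integral (cbox 0 1) (F z')" if "z' \<in> ball z e" for z'
    using Cauchy_dir_deriv[OF assms er(2) U[OF that]] by (auto simp: F_def \<gamma>_def integral_unique)
  have "(dir_deriv w f has_derivative integral (cbox 0 1) (F' z)) (at z within ball z e)"
    by (rule has_derivative_transform[OF _ dir_deriv_int der_int]) (use er in simp_all)
  then have "(dir_deriv w f has_derivative integral (cbox 0 1) (F' z)) (at z)"
    using er by (simp add: at_within_open[of z "ball z e"])
  moreover have "integral (cbox 0 1) (F' z) (cscale c v) = c * integral (cbox 0 1) (F' z) v" for c v
  proof -
    have int: "F' z integrable_on cbox 0 1"
    proof (rule integrable_continuous)
      have "continuous_on (cbox 0 1) (\<lambda>t. case (z, t) of (z', t) \<Rightarrow> F' z' t)"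
        by (rule continuous_on_compose2[OF cont_F']) (use er in \<open>auto intro: continuous_on_Pair
            continuous_on_const continuous_on_id\<close>)
      then show "continuous_on (cbox 0 1) (F' z)" by simp
    qed
    have "blinfun_apply (F' z t) (cscale c v) = c * blinfun_apply (F' z t) v" for t
      using er U[of z "\<gamma> t"] \<gamma> holomorphic_fun_has_derivative(2)[OF assms] by (simp add: F')
    then have "integral (cbox 0 1) (\<lambda>t. blinfun_apply (F' z t) (cscale c v))
        = integral (cbox 0 1) (\<lambda>t. c * blinfun_apply (F' z t) v)" by simp
    then show ?thesis unfolding blinfun_apply_integral[OF int] by simp
  qed
  ultimately show "\<exists>D. (dir_deriv w f has_derivative D) (at z) \<and>
      (\<forall>c x u p. D (c *s x, c * u, c *s p) = c * D (x, u, p))"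
    by (intro exI[of _ "blinfun_apply (integral (cbox 0 1) (F' z))"]) (simp flip: cscale_Pair)
qed

lemma bounded_linear_coord:
  "bounded_linear (\<lambda>z::'n::finite jet1. fst z $ i)" "bounded_linear (\<lambda>z::'n::finite jet1. fst (snd z))"
  "bounded_linear (\<lambda>z::'n::finite jet1. snd (snd z) $ i)"
  by (intro bounded_linear_compose[OF bounded_linear_vec_nth] bounded_linear_fst
      bounded_linear_fst_comp bounded_linear_snd_comp bounded_linear_snd bounded_linear_ident)+

lemmas has_derivative_coord = bounded_linear_coord[THEN bounded_linear_imp_has_derivative]

lemma eventually_line_in:
  assumes "open V" "y + cscale t0 w \<in> V"
  shows "\<forall>\<^sub>F t in nhds t0. y + cscale t w \<in> V"
proof -
  have "((\<lambda>t. y + cscale t w) \<longlongrightarrow> y + cscale t0 w) (nhds t0)"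
    using has_derivative_continuous[OF has_derivative_line[of y w t0]]
    unfolding isCont_def tendsto_at_iff_tendsto_nhds[of "\<lambda>t. y + cscale t w" t0] .
  then show ?thesis using assms by (auto dest!: topological_tendstoD)
qed

lemma dir_deriv_cong:
  assumes "open U" "z \<in> U" "\<And>z. z \<in> U \<Longrightarrow> f z = g z"
  shows "dir_deriv w f z = dir_deriv w g z"
proof -
  have "\<forall>\<^sub>F t in nhds 0. z + cscale t w \<in> U"
    by (rule eventually_line_in) (use assms in simp_all)
  then have "\<forall>\<^sub>F t in nhds 0. f (z + cscale t w) = g (z + cscale t w)"
    by eventually_elim (rule assms(3))
  then show ?thesis unfolding dir_deriv_def by (rule deriv_cong_ev) simp
qed

lemma holomorphic_fun_cong:
  assumes "\<And>z. z \<in> U \<Longrightarrow> f z = g z"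
  shows "holomorphic_fun U f \<longleftrightarrow> holomorphic_fun U g"
proof -
  have *: "(f has_derivative D) (at z) \<longleftrightarrow> (g has_derivative D) (at z)" if "open U" "z \<in> U" for z D
    using has_derivative_transform_within_open[OF _ that] assms by metis
  show ?thesis unfolding holomorphic_fun_def by (auto simp: *)
qed

lemma holomorphic_funI:
  assumes "open U" "\<And>z. z \<in> U \<Longrightarrow> (f has_derivative D z) (at z)"
    "\<And>z a w. z \<in> U \<Longrightarrow> D z (cscale a w) = a * D z w"
  shows "holomorphic_fun U f"
  unfolding holomorphic_fun_def
proof (intro conjI ballI)
  fix z assume "z \<in> U"
  then show "\<exists>D. (f has_derivative D) (at z) \<and> (\<forall>a x u p. D (a *s x, a * u, a *s p) = a * D (x, u, p))"
    using assms(2,3)[of z] by (intro exI[of _ "D z"]) (simp flip: cscale_Pair)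
qed fact

context
  fixes U and f g :: "'n::finite jet1 \<Rightarrow> complex"
  assumes f: "holomorphic_fun U f" and g: "holomorphic_fun U g"
begin

lemma holomorphic_fun_add: "holomorphic_fun U (\<lambda>z. f z + g z)"
  by (rule holomorphic_funI[OF holomorphic_fun_open[OF f]
        has_derivative_add[OF holomorphic_fun_has_derivative(1)[OF f]
            holomorphic_fun_has_derivative(1)[OF g]]])
     (simp_all add: holomorphic_fun_has_derivative(2)[OF f] holomorphic_fun_has_derivative(2)[OF g]
         algebra_simps)

lemma holomorphic_fun_mult: "holomorphic_fun U (\<lambda>z. f z * g z)"
  by (rule holomorphic_funI[OF holomorphic_fun_open[OF f]
        has_derivative_mult[OF holomorphic_fun_has_derivative(1)[OF f]
            holomorphic_fun_has_derivative(1)[OF g]]])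
     (simp_all add: holomorphic_fun_has_derivative(2)[OF f] holomorphic_fun_has_derivative(2)[OF g]
         algebra_simps)

lemma dir_deriv_add: "z \<in> U \<Longrightarrow> dir_deriv w (\<lambda>z. f z + g z) z = dir_deriv w f z + dir_deriv w g z"
  by (rule dir_deriv_eqI[OF
      has_derivative_add[OF holomorphic_fun_has_derivative(1)[OF f]
          holomorphic_fun_has_derivative(1)[OF g]]])
     (simp_all add: holomorphic_fun_has_derivative(2)[OF f] holomorphic_fun_has_derivative(2)[OF g]
         algebra_simps)

end

lemma dir_deriv_cmult:
  assumes f: "holomorphic_fun U f" and z: "z \<in> U"
  shows "dir_deriv w (\<lambda>z. a * f z) z = a * dir_deriv w f z"
  by (rule dir_deriv_eqI[OF has_derivative_mult_right[OF holomorphic_fun_has_derivative(1)[OF f z]]])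
     (simp_all add: holomorphic_fun_has_derivative(2)[OF f z] algebra_simps)

lemma holomorphic_fun_const: "open U \<Longrightarrow> holomorphic_fun U (\<lambda>z. a)"
  by (rule holomorphic_funI[OF _ has_derivative_const]) simp_all

lemma holomorphic_fun_cmult: "holomorphic_fun U f \<Longrightarrow> holomorphic_fun U (\<lambda>z. a * f z)"
  by (intro holomorphic_fun_mult holomorphic_fun_const holomorphic_fun_open)

lemma holomorphic_fun_snd_snd: "open U \<Longrightarrow> holomorphic_fun U (\<lambda>z. snd (snd z) $ i)"
  by (rule holomorphic_funI[OF _ has_derivative_coord(3)]) (simp_all add: cscale_def case_prod_unfold)

lemma dir_deriv_const [simp]: "dir_deriv w (\<lambda>z. a) z = 0"
  by (simp add: dir_deriv_def)

lemma holomorphic_fun_sum: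
  "finite I \<Longrightarrow> open U \<Longrightarrow> (\<And>i. i \<in> I \<Longrightarrow> holomorphic_fun U (f i)) \<Longrightarrow> holomorphic_fun U (\<lambda>z. \<Sum>i\<in>I. f i z)"
  by (induction I rule: finite_induct) (simp_all add: holomorphic_fun_const holomorphic_fun_add)

lemma dir_deriv_sum:
  "finite I \<Longrightarrow> (\<And>i. i \<in> I \<Longrightarrow> holomorphic_fun U (f i)) \<Longrightarrow> open U \<Longrightarrow> z \<in> U \<Longrightarrow>
    dir_deriv w (\<lambda>z. \<Sum>i\<in>I. f i z) z = (\<Sum>i\<in>I. dir_deriv w (f i) z)"
  by (induction I rule: finite_induct) (simp_all add: dir_deriv_add[where U = U] holomorphic_fun_sum)

section \<open>Homogeneous coordinates and quadratic Hamiltonians\<close>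

text \<open>
  One of the \<open>n + 1\<close> indices of the Darboux basis, \<open>c\<close>, belongs to the coordinates \<open>1\<close> and \<open>s\<close>; the
  others carry \<open>x\<^sup>i\<close> and \<open>u\<^sub>i\<close>.  As the first index of a given ordering, \<open>c\<close> can be any element of
  \<open>'n option\<close>, and \<open>slot c\<close> enumerates the remaining ones by \<open>'n\<close>: it replaces \<open>c\<close> by \<open>None\<close>.
\<close>

definition slot :: "'n option \<Rightarrow> 'n \<Rightarrow> 'n option" where
  "slot c i = (if Some i = c then None else Some i)"

definition unslot :: "'n option \<Rightarrow> 'n option \<Rightarrow> 'n" where
  "unslot c a = (case a of None \<Rightarrow> the c | Some i \<Rightarrow> i)"

lemma slot_neq [simp]: "slot c i \<noteq> c" "c \<noteq> slot c i"
  by (auto simp: slot_def)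

lemma unslot_slot [simp]: "unslot c (slot c i) = i"
  by (auto simp: slot_def unslot_def)

lemma slot_eq_iff [simp]: "slot c i = slot c j \<longleftrightarrow> i = j"
  by (metis unslot_slot)

lemma slot_unslot: "a \<noteq> c \<Longrightarrow> slot c (unslot c a) = a"
  by (cases a; cases c) (auto simp: slot_def unslot_def)

lemma slot_cases: obtains "a = c" | i where "a = slot c i"
  by (metis slot_unslot)

lemma sum_slot: "(\<Sum>a\<in>UNIV. F a) = F c + (\<Sum>i\<in>UNIV. F (slot c i))" for c :: "'n::finite option"
proof -
  have "bij_betw (slot c) UNIV (UNIV - {c})"
    by (rule bij_betw_byWitness[where f' = "unslot c"]) (auto simp: slot_unslot)
  from sum.reindex_bij_betw[OF this, of F] show ?thesis
    by (subst sum.remove[of _ c]) auto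
qed

lemma slot_index_cases:
  obtains "k = Inl c" | i where "k = Inl (slot c i)" | i where "k = Inr (slot c i)" | "k = Inr c"
  by (cases k) (metis slot_cases)+

definition hvec :: "'n::finite option \<Rightarrow> complex \<Rightarrow> complex^'n \<Rightarrow> complex^'n \<Rightarrow> complex \<Rightarrow> 'n spvec" where
  "hvec c \<alpha> \<xi> \<eta> \<sigma> = (\<chi> k. case k of
     Inl a \<Rightarrow> if a = c then \<alpha> else \<xi> $ unslot c a
   | Inr a \<Rightarrow> if a = c then \<sigma> else \<eta> $ unslot c a)"

lemma hvec_nth [simp]:
  "hvec c \<alpha> \<xi> \<eta> \<sigma> $ Inl c = \<alpha>" "hvec c \<alpha> \<xi> \<eta> \<sigma> $ Inl (slot c i) = \<xi> $ i"
  "hvec c \<alpha> \<xi> \<eta> \<sigma> $ Inr (slot c i) = \<eta> $ i" "hvec c \<alpha> \<xi> \<eta> \<sigma> $ Inr c = \<sigma>"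
  by (simp_all add: hvec_def)

lemma spvec_eqI:
  assumes "v $ Inl c = w $ Inl c" "\<And>i. v $ Inl (slot c i) = w $ Inl (slot c i)"
    "\<And>i. v $ Inr (slot c i) = w $ Inr (slot c i)" "v $ Inr c = w $ Inr c"
  shows "v = w"
  unfolding vec_eq_iff by (metis slot_index_cases assms)

lemma symp_form_slot:
  "symp_form v w = v $ Inl c * w $ Inr c - v $ Inr c * w $ Inl c +
    (\<Sum>i\<in>UNIV. v $ Inl (slot c i) * w $ Inr (slot c i) - v $ Inr (slot c i) * w $ Inl (slot c i))"
  unfolding symp_form_def by (rule sum_slot)

lemma symp_form_linear [simp]:
  "symp_form (v + v') w = symp_form v w + symp_form v' w"
  "symp_form v (w + w') = symp_form v w + symp_form v w'"
  "symp_form (v - v') w = symp_form v w - symp_form v' w"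
  "symp_form v (w - w') = symp_form v w - symp_form v w'"
  "symp_form 0 w = 0" "symp_form v 0 = 0"
  by (simp_all add: symp_form_def algebra_simps flip: sum.distrib sum_subtractf)

lemma symp_form_scale [simp]:
  "symp_form (a *s v) w = a * symp_form v w" "symp_form v (a *s w) = a * symp_form v w"
  by (simp_all add: symp_form_def algebra_simps sum_distrib_left)

lemma symp_form_scaleR [simp]:
  "symp_form (r *\<^sub>R v) w = r *\<^sub>R symp_form v w" "symp_form v (r *\<^sub>R w) = r *\<^sub>R symp_form v w"
  by (simp_all add: symp_form_def algebra_simps scaleR_sum_right)

lemma symp_form_swap: "symp_form v w = - symp_form w v"
  by (simp add: symp_form_def algebra_simps flip: sum_negf)

lemma symp_form_self [simp]: "symp_form v v = 0"
  by (simp add: symp_form_def mult.commute)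

lemma symp_form_axis [simp]:
  "symp_form v (axis (Inr k) 1) = v $ Inl k" "symp_form v (axis (Inl k) 1) = - v $ Inr k"
  by (simp_all add: symp_form_def axis_def if_distrib[of "\<lambda>x. _ * x"] sum_negf cong: if_cong)

lemma bounded_bilinear_symp_form: "bounded_bilinear symp_form"
  unfolding bilinear_conv_bounded_bilinear[symmetric] bilinear_def
  by (auto intro!: linearI)

text \<open>
  Elements of the symplectic Lie algebra correspond to symmetric bilinear forms; this is the form in
  which their defining property is used throughout.
\<close>

lemma sp_symmetric: "A \<in> sp \<Longrightarrow> symp_form (A *v v) w = symp_form (A *v w) v"
  unfolding sp_def by (metis (mono_tags, lifting) add_eq_0_iff mem_Collect_eq symp_form_swap)

lemma spI: "(\<And>v w. symp_form (A *v v) w = symp_form (A *v w) v) \<Longrightarrow> A \<in> sp"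
  unfolding sp_def by (simp add: symp_form_swap[of _ "A *v _"])

lemma bounded_linear_matrix_vector_mul_complex: "bounded_linear ((*v) (A :: complex^'n^'m))"
proof -
  have "linear ((*v) A)"
    by (intro linearI) (auto simp: vec_eq_iff matrix_vector_mult_def algebra_simps sum.distrib
       simp flip: scaleR_sum_right)
  then show ?thesis by (simp add: linear_conv_bounded_linear)
qed

lemma has_derivative_vecI:
  fixes f :: "'a::real_normed_vector \<Rightarrow> complex^'m"
  assumes "\<And>j. ((\<lambda>z. f z $ j) has_derivative (\<lambda>h. f' h $ j)) (at a within S)"
  shows "(f has_derivative f') (at a within S)"
proof (subst has_derivative_componentwise_within, rule ballI)
  fix b :: "complex^'m" assume "b \<in> Basis"
  then obtain j d where b: "b = axis j d" by (auto simp: Basis_vec_def)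
  show "((\<lambda>x. f x \<bullet> b) has_derivative (\<lambda>x. f' x \<bullet> b)) (at a within S)"
    unfolding b inner_axis by (rule has_derivative_inner_left[OF assms])
qed

text \<open>
  The affine chart of the projective space.  The sign of the last coordinate, the negative of \<open>wgen\<close>,
  makes the contact form the symplectic pairing of \<open>y\<close> with \<open>dy\<close> up to a factor.
\<close>

definition hcoord :: "'n::finite option \<Rightarrow> 'n jet1 \<Rightarrow> 'n spvec" where
  "hcoord c = (\<lambda>(x, u, p). hvec c 1 x p (2 * u - (\<Sum>i\<in>UNIV. x $ i * p $ i)))"

definition dhcoord :: "'n::finite option \<Rightarrow> 'n jet1 \<Rightarrow> 'n jet1 \<Rightarrow> 'n spvec" where
  "dhcoord c = (\<lambda>(x, u, p) (\<xi>, \<upsilon>, \<eta>). hvec c 0 \<xi> \<eta> (2 * \<upsilon> - (\<Sum>i\<in>UNIV. x $ i * \<eta> $ i + \<xi> $ i * p $ i)))"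

lemma hcoord_nth [simp]:
  "hcoord c z $ Inl c = 1" "hcoord c (x, u, p) $ Inl (slot c i) = x $ i"
  "hcoord c (x, u, p) $ Inr (slot c i) = p $ i"
  "hcoord c (x, u, p) $ Inr c = 2 * u - (\<Sum>i\<in>UNIV. x $ i * p $ i)"
  by (simp_all add: hcoord_def split: prod.split)

lemma dhcoord_nth [simp]:
  "dhcoord c z w $ Inl c = 0" "dhcoord c z (\<xi>, \<upsilon>, \<eta>) $ Inl (slot c i) = \<xi> $ i"
  "dhcoord c z (\<xi>, \<upsilon>, \<eta>) $ Inr (slot c i) = \<eta> $ i"
  "dhcoord c (x, u, p) (\<xi>, \<upsilon>, \<eta>) $ Inr c = 2 * \<upsilon> - (\<Sum>i\<in>UNIV. x $ i * \<eta> $ i + \<xi> $ i * p $ i)"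
  by (simp_all add: dhcoord_def split: prod.split)

lemma dhcoord_cscale: "dhcoord c z (cscale a w) = a *s dhcoord c z w"
  by (cases w, cases z, rule spvec_eqI[where c = c]) (simp_all add: algebra_simps sum_distrib_left)

lemma has_derivative_hcoord: "(hcoord c has_derivative dhcoord c z) (at z)"
proof (rule has_derivative_vecI)
  fix j
  obtain x u p where z: "z = (x, u, p)" by (cases z)
  show "((\<lambda>z. hcoord c z $ j) has_derivative (\<lambda>h. dhcoord c z h $ j)) (at z)"
  proof (cases j rule: slot_index_cases[where c = c])
    case 1 then show ?thesis by simp
  next
    case (2 i)
    then show ?thesis using has_derivative_coord(1)[of i]
      by (simp add: hcoord_def dhcoord_def case_prod_unfold)
  next
    case (3 i)
    then show ?thesis using has_derivative_coord(3)[of i]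
      by (simp add: hcoord_def dhcoord_def case_prod_unfold)
  next
    case 4
    have "((\<lambda>z. fst z $ i * snd (snd z) $ i) has_derivative
        (\<lambda>h. fst z $ i * snd (snd h) $ i + fst h $ i * snd (snd z) $ i)) (at z)" for i
      by (rule has_derivative_mult[OF has_derivative_coord(1,3)])
    from has_derivative_diff[OF has_derivative_mult_right[OF has_derivative_coord(2)]
        has_derivative_sum[OF this]]
    have "((\<lambda>z. 2 * fst (snd z) - (\<Sum>i\<in>UNIV. fst z $ i * snd (snd z) $ i)) has_derivative
       (\<lambda>h. 2 * fst (snd h) - (\<Sum>i\<in>UNIV. fst z $ i * snd (snd h) $ i
           + fst h $ i * snd (snd z) $ i))) (at z)" .
    then show ?thesis by (simp add: 4 hcoord_def dhcoord_def case_prod_unfold)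
  qed
qed

text \<open>
  The generating function, up to sign, of the contact field induced by the linear vector field
  \<open>y \<mapsto> A y\<close>.
\<close>

definition ham :: "'n::finite option \<Rightarrow> 'n spmat \<Rightarrow> 'n jet1 \<Rightarrow> complex" where
  "ham c A z = symp_form (A *v hcoord c z) (hcoord c z) / 2"

lemma has_derivative_ham:
  assumes "A \<in> sp"
  shows "(ham c A has_derivative (\<lambda>w. symp_form (A *v hcoord c z) (dhcoord c z w))) (at z)"
proof -
  have "((\<lambda>z. A *v hcoord c z) has_derivative (\<lambda>w. A *v dhcoord c z w)) (at z)"
    by (rule bounded_linear.has_derivative[OF bounded_linear_matrix_vector_mul_complex
        has_derivative_hcoord])
  from bounded_linear.has_derivative[OF bounded_linear_divide[of 2]
      bounded_bilinear.FDERIV[OF bounded_bilinear_symp_form this has_derivative_hcoord[of c]]]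
  have "((\<lambda>z. symp_form (A *v hcoord c z) (hcoord c z) / 2) has_derivative
      (\<lambda>w. (symp_form (A *v hcoord c z) (dhcoord c z w)
          + symp_form (A *v dhcoord c z w) (hcoord c z)) / 2)) (at z)" .
  then show ?thesis
    by (simp add: ham_def[abs_def] sp_symmetric[OF assms, of "dhcoord _ _ _"])
qed

lemma dir_deriv_ham: "A \<in> sp \<Longrightarrow> dir_deriv w (ham c A) z = symp_form (A *v hcoord c z) (dhcoord c z w)"
  by (rule dir_deriv_eqI[OF has_derivative_ham]) (simp_all add: dhcoord_cscale)

lemma holomorphic_fun_ham: "A \<in> sp \<Longrightarrow> open U \<Longrightarrow> holomorphic_fun U (ham c A)"
  unfolding holomorphic_fun_def
proof (intro conjI ballI)
  fix z assume A: "A \<in> sp"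
  show "\<exists>D. (ham c A has_derivative D) (at z) \<and>
      (\<forall>a x u p. D (a *s x, a * u, a *s p) = a * D (x, u, p))"
    by (intro exI[of _ "\<lambda>w. symp_form (A *v hcoord c z) (dhcoord c z w)"] conjI
        has_derivative_ham[OF A])
       (simp add: dhcoord_cscale flip: cscale_Pair)
qed

lemma vec_eq_sum_axis: "(v :: complex^'n) = (\<Sum>l\<in>UNIV. v $ l *s axis l 1)"
  by (simp add: vec_eq_iff axis_def if_distrib[of "\<lambda>x. _ * x"] cong: if_cong)

text \<open>
  The matrix \<open>A\<close> with \<open>\<omega>(A v, w) = S v w\<close> for a symmetric bilinear form \<open>S\<close>.
\<close>

definition spmat_of_form :: "('n::finite spvec \<Rightarrow> 'n spvec \<Rightarrow> complex) \<Rightarrow> 'n spmat" where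
  "spmat_of_form S = (\<chi> k l. case k of
     Inl i \<Rightarrow> S (axis l 1) (axis (Inr i) 1) | Inr i \<Rightarrow> - S (axis l 1) (axis (Inl i) 1))"

locale symmetric_form =
  fixes S :: "'n::finite spvec \<Rightarrow> 'n spvec \<Rightarrow> complex"
  assumes sym: "S v w = S w v" and add: "S (v + v') w = S v w + S v' w"
    and scale: "S (a *s v) w = a * S v w"
begin

lemma sum_left: "finite I \<Longrightarrow> S (\<Sum>i\<in>I. a i *s v i) w = (\<Sum>i\<in>I. a i * S (v i) w)"
proof (induction I rule: finite_induct)
  case empty show ?case using scale[of 0 0 w] by simp
qed (simp add: add scale)

lemma expand_left: "S v w = (\<Sum>l\<in>UNIV. v $ l * S (axis l 1) w)"
  by (subst vec_eq_sum_axis) (simp add: sum_left)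

lemma symp_form_spmat_of_form: "symp_form (spmat_of_form S *v v) w = S v w"
proof -
  have *: "(spmat_of_form S *v v) $ Inl i = S v (axis (Inr i) 1)"
    "(spmat_of_form S *v v) $ Inr i = - S v (axis (Inl i) 1)" for i
    by (simp_all add: spmat_of_form_def matrix_vector_mult_def expand_left[of v] sum_negf mult.commute)
  have "symp_form (spmat_of_form S *v v) w
      = (\<Sum>i\<in>UNIV. w $ Inl i * S v (axis (Inl i) 1)) + (\<Sum>i\<in>UNIV. w $ Inr i * S v (axis (Inr i) 1))"
    by (simp add: symp_form_def * sum.distrib[symmetric] algebra_simps)
  also have "\<dots> = (\<Sum>l\<in>UNIV. w $ l * S v (axis l 1))"
    by (simp add: UNIV_Plus_UNIV[symmetric] sum.Plus del: UNIV_Plus_UNIV)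
  also have "\<dots> = S v w"
    by (simp add: sym[of v] flip: expand_left)
  finally show ?thesis .
qed

lemma spmat_of_form_in_sp: "spmat_of_form S \<in> sp"
  by (rule spI) (simp add: symp_form_spmat_of_form sym)

end

section \<open>Prolongation by total derivatives\<close>

lemma d_x_eq_dir_deriv: "d_x i f = dir_deriv (axis i 1, 0, 0) f"
  and d_u_eq_dir_deriv: "d_u f = dir_deriv (0, 1, 0) f"
  and d_p_eq_dir_deriv: "d_p i f = dir_deriv (0, 0, axis i 1) f"
  by (auto simp: fun_eq_iff d_x_def d_u_def d_p_def dir_deriv_def)

text \<open>
  The total derivative \<open>D\<^sub>i\<close> on functions of first jets, with the second derivatives frozen to \<open>q\<close>.
  Unlike \<open>D1\<close>, it can be iterated.
\<close>

definition total_deriv :: "complex^'n^'n \<Rightarrow> 'n \<Rightarrow> ('n::finite jet1 \<Rightarrow> complex) \<Rightarrow> 'n jet1 \<Rightarrow> complex" where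
  "total_deriv q i f = (\<lambda>z. dir_deriv (axis i 1, snd (snd z) $ i, q $ i) f z)"

lemma jet_eq_sum: "(\<xi>, \<upsilon>, \<eta>) = (\<Sum>l\<in>UNIV. cscale (\<xi> $ l) (axis l 1, 0, 0)) + cscale \<upsilon> (0, 1, 0)
    + (\<Sum>l\<in>UNIV. cscale (\<eta> $ l) (0, 0, axis l 1))"
proof -
  have "(\<Sum>l\<in>UNIV. cscale (\<xi> $ l) (axis l 1, 0, 0)) = (\<xi>, 0, 0)"
    unfolding prod_eq_iff fst_sum snd_sum cscale_Pair fst_conv snd_conv
    by (simp add: vec_eq_sum_axis[symmetric, of \<xi>])
  moreover have "(\<Sum>l\<in>UNIV. cscale (\<eta> $ l) (0, 0, axis l 1)) = (0, 0, \<eta>)"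
    unfolding prod_eq_iff fst_sum snd_sum cscale_Pair fst_conv snd_conv
    by (simp add: vec_eq_sum_axis[symmetric, of \<eta>])
  ultimately show ?thesis by simp
qed

lemma dir_deriv_Pair:
  assumes f: "holomorphic_fun U f" and z: "z \<in> U"
  shows "dir_deriv (\<xi>, \<upsilon>, \<eta>) f z = (\<Sum>l\<in>UNIV. \<xi> $ l * d_x l f z) + \<upsilon> * d_u f z
      + (\<Sum>l\<in>UNIV. \<eta> $ l * d_p l f z)"
proof -
  interpret linear "\<lambda>w. dir_deriv w f z" using f z by (rule holomorphic_fun_dir_deriv_linear)
  show ?thesis
    by (subst jet_eq_sum)
       (simp only: add sum holomorphic_fun_has_derivative(2)[OF f z] d_x_eq_dir_deriv
           d_u_eq_dir_deriv d_p_eq_dir_deriv)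
qed

lemma total_deriv_eq:
  assumes "holomorphic_fun U f" "z \<in> U"
  shows "total_deriv q i f z = ddx i f z + (\<Sum>l\<in>UNIV. q $ i $ l * d_p l f z)"
  unfolding total_deriv_def dir_deriv_Pair[OF assms]
  by (simp add: ddx_def axis_def if_distrib[of "\<lambda>x. x * _"] case_prod_unfold cong: if_cong)

lemma ddx_eq: "ddx i f = (\<lambda>z. dir_deriv (axis i 1, 0, 0) f z
    + snd (snd z) $ i * dir_deriv (0, 1, 0) f z)"
  by (simp add: ddx_def d_x_eq_dir_deriv d_u_eq_dir_deriv case_prod_unfold)

lemma holomorphic_fun_ddx: "holomorphic_fun U f \<Longrightarrow> holomorphic_fun U (ddx i f)"
  unfolding ddx_eq
  by (intro holomorphic_fun_add holomorphic_fun_mult holomorphic_fun_dir_deriv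
      holomorphic_fun_snd_snd holomorphic_fun_open)

lemma holomorphic_fun_d_p: "holomorphic_fun U f \<Longrightarrow> holomorphic_fun U (d_p i f)"
  unfolding d_p_eq_dir_deriv by (rule holomorphic_fun_dir_deriv)

lemma holomorphic_fun_total_deriv:
  assumes f: "holomorphic_fun U f"
  shows "holomorphic_fun U (total_deriv q i f)"
proof -
  have "holomorphic_fun U (\<lambda>z. ddx i f z + (\<Sum>l\<in>UNIV. q $ i $ l * d_p l f z))"
    by (rule holomorphic_fun_add[OF holomorphic_fun_ddx[OF f]
          holomorphic_fun_sum[OF finite holomorphic_fun_open[OF f]
            holomorphic_fun_cmult[OF holomorphic_fun_d_p[OF f]]]])
  then show ?thesis
    by (subst holomorphic_fun_cong[where g = "\<lambda>z. ddx i f z + (\<Sum>l\<in>UNIV. q $ i $ l * d_p l f z)"])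
       (simp_all add: total_deriv_eq[OF f])
qed

lemma total_deriv_cong:
  "open U \<Longrightarrow> z \<in> U \<Longrightarrow> (\<And>z. z \<in> U \<Longrightarrow> f z = g z) \<Longrightarrow> total_deriv q i f z = total_deriv q i g z"
  unfolding total_deriv_def by (rule dir_deriv_cong)

lemma D1_cong:
  assumes "open U" "(x, u, p) \<in> U" "\<And>z. z \<in> U \<Longrightarrow> f z = g z"
  shows "D1 i f (x, u, p, q) = D1 i g (x, u, p, q)"
  by (simp add: D1_def ddx_eq d_p_eq_dir_deriv dir_deriv_cong[OF assms])

lemma D1_eq_total_deriv:
  assumes "holomorphic_fun U f" "(x, u, p) \<in> U"
  shows "D1 i f (x, u, p, q) = total_deriv q i f (x, u, p)"
  by (simp add: D1_def total_deriv_eq[OF assms])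

text \<open>
  As \<open>S_p f i\<close> is \<open>ddx i f\<close> and \<open>S_x f l\<close> is \<open>- d_p l f\<close>, the prolongation formula is \<open>D\<^sub>j\<close> applied to
  \<open>ddx i f + \<Sum>\<^sub>l q\<^sub>i\<^sub>l d_p l f\<close> with constant \<open>q\<^sub>i\<^sub>l\<close>, that is, to \<open>D\<^sub>i f\<close>.
\<close>

lemma S_q_eq_total_deriv:
  assumes f: "holomorphic_fun U f" and z: "(x, u, p) \<in> U"
  shows "S_q f i j (x, u, p, q) = total_deriv q j (total_deriv q i f) (x, u, p)"
proof -
  note o = holomorphic_fun_open[OF f]
  have "total_deriv q j (total_deriv q i f) (x, u, p) = total_deriv q j (\<lambda>z. ddx i f z
      + (\<Sum>l\<in>UNIV. q $ i $ l * d_p l f z)) (x, u, p)"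
    by (rule total_deriv_cong[OF o z total_deriv_eq[OF f]])
  also have "\<dots> = total_deriv q j (ddx i f) (x, u, p)
      + (\<Sum>l\<in>UNIV. q $ i $ l * total_deriv q j (d_p l f) (x, u, p))"
    using z o f unfolding total_deriv_def
    by (simp add: dir_deriv_add[where U = U] dir_deriv_sum[where U = U] dir_deriv_cmult[where U = U]
        holomorphic_fun_ddx holomorphic_fun_sum holomorphic_fun_cmult holomorphic_fun_d_p)
  also have "\<dots> = S_q f i j (x, u, p, q)"
  proof -
    have "S_x f l = (\<lambda>z. - 1 * d_p l f z)" for l by (simp add: S_x_def)
    then have "D1 j (S_x f l) (x, u, p, q) = - total_deriv q j (d_p l f) (x, u, p)" for l
      using D1_eq_total_deriv[OF holomorphic_fun_cmult[OF holomorphic_fun_d_p[OF f]] z, of j "-1" l q]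
        dir_deriv_cmult[OF holomorphic_fun_d_p[OF f] z, of _ "-1" l]
      by (simp add: total_deriv_def)
    then show ?thesis
      by (simp add: S_q_def S_p_def D1_eq_total_deriv[OF holomorphic_fun_ddx[OF f] z] sum_negf)
  qed
  finally show ?thesis by simp
qed

text \<open>
  At \<open>u\<^sub>i\<^sub>j\<^sub>k = 0\<close> the total derivative \<open>D2\<close> does not differentiate in the second derivatives, which are
  therefore constants here as well.
\<close>

lemma S_r_eq_total_deriv:
  assumes f: "holomorphic_fun U f" and z: "(x, u, p) \<in> U"
  shows "S_r f i j k (x, u, p, q, 0) = total_deriv q k (total_deriv q j (total_deriv q i f)) (x, u, p)"
proof -
  note o = holomorphic_fun_open[OF f]
  have "map_matrix ((*) t) (0::complex^'a^'a) = 0" for t :: complex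
    by (simp add: vec_eq_iff map_matrix_def)
  then have "S_r f i j k (x, u, p, q, 0) = D1 k (\<lambda>(x, u, p). S_q f i j (x, u, p, q)) (x, u, p, q)"
    by (simp add: S_r_def D2_def)
  also have "\<dots> = D1 k (total_deriv q j (total_deriv q i f)) (x, u, p, q)"
    by (rule D1_cong[OF o z]) (auto simp: S_q_eq_total_deriv[OF f])
  also have "\<dots> = total_deriv q k (total_deriv q j (total_deriv q i f)) (x, u, p)"
    by (rule D1_eq_total_deriv[OF _ z]) (intro holomorphic_fun_total_deriv f)
  finally show ?thesis .
qed

text \<open>
  The tangency condition, reduced to an equation between functions of first jets for each \<open>q\<close>.
\<close>

lemma contact_symmetries_iff:
  "f \<in> contact_symmetries U \<longleftrightarrow> holomorphic_fun U f \<and> (\<forall>z. z \<notin> U \<longrightarrow> f z = 0) \<and>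
    (\<forall>z\<in>U. \<forall>q. symmetric2 q \<longrightarrow> (\<forall>i j k. total_deriv q k (total_deriv q j (total_deriv q i f)) z = 0))"
proof -
  have pde: "(x, u, p, q, r) \<in> pde \<longleftrightarrow> symmetric2 q \<and> r = 0" for x u p q and r :: "complex^'a^'a^'a"
    by (auto simp: pde_def J3_def vec_eq_iff symmetric3_def)
  have eq: "(case prolong3 f (x, u, p, q, 0) of (X, V, P, Q, R) \<Rightarrow> R = 0) \<longleftrightarrow>
      (\<forall>i j k. total_deriv q k (total_deriv q j (total_deriv q i f)) (x, u, p) = 0)"
    if "holomorphic_fun U f" "(x, u, p) \<in> U" for x u p q
    using S_r_eq_total_deriv[OF that] by (simp add: prolong3_def vec_eq_iff)
  show ?thesis
  proof
    assume "f \<in> contact_symmetries U"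
    then have f: "holomorphic_fun U f" and off: "\<forall>z. z \<notin> U \<longrightarrow> f z = 0"
      and tangent: "\<forall>x u p q r. (x, u, p) \<in> U \<and> (x, u, p, q, r) \<in> pde \<longrightarrow>
        (case prolong3 f (x, u, p, q, r) of (X, V, P, Q, R) \<Rightarrow> R = 0)"
      unfolding contact_symmetries_def mem_Collect_eq by - (elim conjE, assumption)+
    have "total_deriv q k (total_deriv q j (total_deriv q i f)) z = 0" if "z \<in> U" "symmetric2 q"
        for z q i j k
    proof -
      obtain x u p where z: "z = (x, u, p)" by (cases z)
      show ?thesis
        using tangent[rule_format, of x u p q 0] eq[OF f, of x u p q] that unfolding z by
            (simp only: pde simp_thms)
    qed
    with f off show "holomorphic_fun U f \<and> (\<forall>z. z \<notin> U \<longrightarrow> f z = 0) \<and>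
        (\<forall>z\<in>U. \<forall>q. symmetric2 q \<longrightarrow> (\<forall>i j k. total_deriv q k (total_deriv q j (total_deriv q i f)) z
            = 0))"
      by simp
  next
    assume *: "holomorphic_fun U f \<and> (\<forall>z. z \<notin> U \<longrightarrow> f z = 0) \<and>
        (\<forall>z\<in>U. \<forall>q. symmetric2 q \<longrightarrow> (\<forall>i j k. total_deriv q k (total_deriv q j (total_deriv q i f)) z
            = 0))"
    have "case prolong3 f (x, u, p, q, r) of (X, V, P, Q, R) \<Rightarrow> R = 0"
      if "(x, u, p) \<in> U \<and> (x, u, p, q, r) \<in> pde" for x u p q r
    proof -
      have "r = 0" "symmetric2 q" "(x, u, p) \<in> U" using that unfolding pde by simp_all
      then show ?thesis using * eq[of x u p q] by simp
    qed
    with * show "f \<in> contact_symmetries U" unfolding contact_symmetries_def by simp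
  qed
qed

lemma prolong2_eq_0_iff:
  assumes f: "holomorphic_fun U f" and z: "(x, u, p) \<in> U"
  shows "prolong2 f (x, u, p, q) = 0 \<longleftrightarrow> f (x, u, p) = 0 \<and> (\<forall>i. d_p i f (x, u, p) = 0) \<and>
    (\<forall>i. ddx i f (x, u, p) = 0) \<and> (\<forall>i j. total_deriv q j (total_deriv q i f) (x, u, p) = 0)"
  using S_q_eq_total_deriv[OF assms]
  by (auto simp: prolong2_def zero_prod_def vec_eq_iff S_x_def S_u_def S_p_def)

section \<open>Quadratic functions are contact symmetries\<close>

lemma sum_axis_mult [simp]:
  "(\<Sum>k\<in>UNIV. a k * axis i (1::complex) $ k) = a (i::'n::finite)"
  "(\<Sum>k\<in>UNIV. axis i (1::complex) $ k * a k) = a i"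
  by (simp_all add: axis_def if_distrib[of "\<lambda>x. _ * x"] if_distrib[of "\<lambda>x. x * _"] cong: if_cong)

lemma sum_axis_mult': "(\<Sum>k\<in>UNIV. a k * axis k (1::complex) $ i) = a (i::'n::finite)"
  by (simp add: axis_def if_distrib[of "\<lambda>x. _ * x"] cong: if_cong)

lemma symp_form_hvec:
  "symp_form v (hvec c \<alpha> \<xi> \<eta> \<sigma>) = v $ Inl c * \<sigma> - v $ Inr c * \<alpha> +
    (\<Sum>i\<in>UNIV. v $ Inl (slot c i) * \<eta> $ i - v $ Inr (slot c i) * \<xi> $ i)"
  by (simp add: symp_form_slot[of _ _ c])

text \<open>
  All first derivatives of a quadratic function are linear in \<open>a = A y\<close>, with coefficients from \<open>y\<close>;
  the bracket and the isotropy are computed from these formulas.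
\<close>

lemma d_ham:
  fixes c :: "'n::finite option"
  assumes "A \<in> sp"
  defines "a \<equiv> \<lambda>z. A *v hcoord c z"
  shows "d_u (ham c A) z = 2 * a z $ Inl c"
    and "d_p i (ham c A) z = a z $ Inl (slot c i) - fst z $ i * a z $ Inl c"
    and "ddx i (ham c A) z = snd (snd z) $ i * a z $ Inl c - a z $ Inr (slot c i)"
  unfolding d_u_eq_dir_deriv d_p_eq_dir_deriv ddx_eq dir_deriv_ham[OF assms(1)] a_def
  by (cases z; simp add: dhcoord_def symp_form_hvec sum_negf algebra_simps)+

lemma ham_commutator:
  assumes "A \<in> sp" "B \<in> sp"
  shows "ham c (commutator A B) z = symp_form (A *v hcoord c z) (B *v hcoord c z)"
proof -
  let ?y = "hcoord c z"
  have "commutator A B *v ?y = A *v (B *v ?y) - B *v (A *v ?y)"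
    by (simp add: commutator_def matrix_vector_mult_diff_rdistrib matrix_vector_mul_assoc)
  then have "ham c (commutator A B) z
      = (symp_form (A *v (B *v ?y)) ?y - symp_form (B *v (A *v ?y)) ?y) / 2"
    by (simp add: ham_def)
  also have "symp_form (A *v (B *v ?y)) ?y = symp_form (A *v ?y) (B *v ?y)"
    by (rule sp_symmetric[OF assms(1)])
  also have "symp_form (B *v (A *v ?y)) ?y = - symp_form (A *v ?y) (B *v ?y)"
    by (subst sp_symmetric[OF assms(2)]) (rule symp_form_swap)
  finally show ?thesis by simp
qed

text \<open>
  Both sides are \<open>\<omega>(A y, B y)\<close>: the bracket by expanding the formulas for the first derivatives, the
  right-hand side because \<open>A\<close> and \<open>B\<close> move across the symplectic form.
\<close>

lemma lagrange_bracket_ham: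
  assumes A: "A \<in> sp" and B: "B \<in> sp"
  shows "lagrange_bracket (ham c A) (ham c B) z = ham c (commutator A B) z"
proof -
  obtain x u p where z: "z = (x, u, p)" by (cases z)
  have h: "2 * ham c A z = a $ Inl c * (2 * u - (\<Sum>i\<in>UNIV. x $ i * p $ i)) - a $ Inr c
      + (\<Sum>i\<in>UNIV. a $ Inl (slot c i) * p $ i - a $ Inr (slot c i) * x $ i)"
    if "a = A *v hcoord c z" for a A
    by (simp add: ham_def symp_form_hvec that[unfolded z] z) (simp add: hcoord_def symp_form_hvec)
  define a b where "a = A *v hcoord c z" and "b = B *v hcoord c z"
  have "lagrange_bracket (ham c A) (ham c B) z
      = b $ Inl c * (2 * ham c A z) - a $ Inl c * (2 * ham c B z)
    + (\<Sum>i\<in>UNIV. (p $ i * a $ Inl c - a $ Inr (slot c i)) * (b $ Inl (slot c i) - x $ i * b $ Inl c)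
      - (p $ i * b $ Inl c - b $ Inr (slot c i)) * (a $ Inl (slot c i) - x $ i * a $ Inl c))"
    unfolding lagrange_bracket_def d_ham[OF A] d_ham[OF B] a_def b_def by (simp add: z mult_ac)
  also have "\<dots> = symp_form a b"
    unfolding h[OF a_def] h[OF b_def] symp_form_slot[of a b c]
    by (simp add: algebra_simps sum.distrib sum_subtractf sum_distrib_left)
  also have "\<dots> = ham c (commutator A B) z"
    by (simp add: ham_commutator[OF A B] a_def b_def)
  finally show ?thesis .
qed

text \<open>
  The vectors \<open>E\<^sub>i = D\<^sub>i y\<close>.  Together with \<open>y\<close> they span the Lagrangian subspace that corresponds to
  the second jet.
\<close>

definition frame :: "'n::finite option \<Rightarrow> complex^'n^'n \<Rightarrow> 'n \<Rightarrow> 'n jet1 \<Rightarrow> 'n spvec" where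
  "frame c q i = (\<lambda>(x, u, p). hvec c 0 (axis i 1) (q $ i) (p $ i - (\<Sum>k\<in>UNIV. x $ k * q $ i $ k)))"

lemma frame_nth [simp]:
  "frame c q i z $ Inl c = 0" "frame c q i z $ Inl (slot c j) = axis i 1 $ j"
  "frame c q i z $ Inr (slot c j) = q $ i $ j"
  "frame c q i (x, u, p) $ Inr c = p $ i - (\<Sum>k\<in>UNIV. x $ k * q $ i $ k)"
  by (simp_all add: frame_def split: prod.split)

lemma dhcoord_eq_frame: "dhcoord c z (axis i 1, snd (snd z) $ i, q $ i) = frame c q i z"
  by (cases z) (simp add: dhcoord_def frame_def sum.distrib)

lemma has_derivative_frame:
  "(frame c q i has_derivative (\<lambda>w. hvec c 0 0 0 (snd (snd w) $ i - (\<Sum>k\<in>UNIV. fst w $ k * q $ i $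
      k)))) (at z)"
proof (rule has_derivative_vecI)
  fix j
  show "((\<lambda>z. frame c q i z $ j) has_derivative
      (\<lambda>w. hvec c 0 0 0 (snd (snd w) $ i - (\<Sum>k\<in>UNIV. fst w $ k * q $ i $ k)) $ j)) (at z)"
  proof (cases j rule: slot_index_cases[where c = c])
    case 4
    from has_derivative_diff[OF has_derivative_coord(3)[of i] has_derivative_sum[OF
        has_derivative_mult_left[OF has_derivative_coord(1)]]]
    have "((\<lambda>z. snd (snd z) $ i - (\<Sum>k\<in>UNIV. fst z $ k * q $ i $ k)) has_derivative
        (\<lambda>w. snd (snd w) $ i - (\<Sum>k\<in>UNIV. fst w $ k * q $ i $ k))) (at z)" .
    then show ?thesis by (simp add: 4 frame_def case_prod_unfold)
  qed simp_all
qed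

lemma dir_deriv_symp_form:
  assumes f: "(f has_derivative f') (at z)" and g: "(g has_derivative g') (at z)"
    and "\<And>a. f' (cscale a w) = a *s f' w" "\<And>a. g' (cscale a w) = a *s g' w"
  shows "dir_deriv w (\<lambda>z. symp_form (A *v f z) (g z)) z = symp_form (A *v f z) (g' w)
      + symp_form (A *v f' w) (g z)"
proof -
  have "((\<lambda>z. A *v f z) has_derivative (\<lambda>w. A *v f' w)) (at z)"
    by (rule bounded_linear.has_derivative[OF bounded_linear_matrix_vector_mul_complex f])
  from dir_deriv_eqI[OF bounded_bilinear.FDERIV[OF bounded_bilinear_symp_form this g]]
  show ?thesis by (simp add: assms(3,4) algebra_simps vec.scale)
qed

lemma hvec_zero [simp]: "hvec c 0 0 0 0 = 0"
  by (rule spvec_eqI[where c = c]) simp_all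

lemma hvec_scale: "hvec c 0 0 0 (a * \<sigma>) = a *s hvec c 0 0 0 \<sigma>"
  by (rule spvec_eqI[where c = c]) simp_all

text \<open>
  A second factor \<open>E\<^sub>i\<close> behaves as a constant, because \<open>D\<^sub>j E\<^sub>i\<close> has the single component
  \<open>q\<^sub>j\<^sub>i - q\<^sub>i\<^sub>j\<close>.  This is where the symmetry of \<open>q\<close> enters.
\<close>

lemma total_deriv_symp_form_frame:
  assumes "symmetric2 q" and f: "(f has_derivative f') (at z)"
    and "\<And>a w. f' (cscale a w) = a *s f' w"
  shows "total_deriv q j (\<lambda>z. symp_form (A *v f z) (frame c q i z)) z =
    symp_form (A *v f' (axis j 1, snd (snd z) $ j, q $ j)) (frame c q i z)"
proof -
  let ?w = "(axis j 1, snd (snd z) $ j, q $ j)"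
  let ?g = "\<lambda>w. snd (snd w) $ i - (\<Sum>k\<in>UNIV. fst w $ k * q $ i $ k)"
  have "?g (cscale a w) = a * ?g w" for a w
    by (cases w) (simp add: algebra_simps sum_distrib_left)
  then have lin: "hvec c 0 0 0 (?g (cscale a w)) = a *s hvec c 0 0 0 (?g w)" for a w
    by (simp only: hvec_scale)
  have "?g ?w = 0"
    using assms(1) by (simp add: symmetric2_def)
  then have van: "hvec c 0 0 0 (?g ?w) = 0"
    by (simp only: hvec_zero)
  show ?thesis
    using dir_deriv_symp_form[OF f has_derivative_frame assms(3) lin, of ?w A] van
    by (simp only: total_deriv_def symp_form_linear add_0)
qed

lemma total_deriv_ham: "A \<in> sp \<Longrightarrow> total_deriv q i (ham c A)
    = (\<lambda>z. symp_form (A *v hcoord c z) (frame c q i z))"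
  by (simp add: total_deriv_def dir_deriv_ham dhcoord_eq_frame)

lemma total_deriv_total_deriv_ham:
  assumes "A \<in> sp" "symmetric2 q"
  shows "total_deriv q j (total_deriv q i (ham c A))
      = (\<lambda>z. symp_form (A *v frame c q j z) (frame c q i z))"
  by (simp add: fun_eq_iff total_deriv_ham[OF assms(1)] dhcoord_eq_frame
      total_deriv_symp_form_frame[OF assms(2) has_derivative_hcoord dhcoord_cscale])

lemma total_deriv_total_deriv_total_deriv_ham:
  assumes "A \<in> sp" "symmetric2 q"
  shows "total_deriv q k (total_deriv q j (total_deriv q i (ham c A))) z = 0"
proof -
  have s: "q $ k $ j = q $ j $ k" using assms(2) by (simp add: symmetric2_def)
  show ?thesis
    unfolding total_deriv_total_deriv_ham[OF assms]
    by (subst total_deriv_symp_form_frame[OF assms(2) has_derivative_frame])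
      (simp_all add: s hvec_scale algebra_simps sum_distrib_left cscale_def case_prod_unfold
        flip: hvec_scale)
qed

text \<open>
  Contact symmetries over \<open>U\<close> are represented by functions that vanish off \<open>U\<close>.
\<close>

definition ham_on :: "'n::finite jet1 set \<Rightarrow> 'n option \<Rightarrow> 'n spmat \<Rightarrow> 'n jet1 \<Rightarrow> complex" where
  "ham_on U c A = restrict0 U (ham c A)"

lemma ham_on_eq: "z \<in> U \<Longrightarrow> ham_on U c A z = ham c A z"
  by (simp add: ham_on_def restrict0_def)

lemma ham_on_outside: "z \<notin> U \<Longrightarrow> ham_on U c A z = 0"
  by (simp add: ham_on_def restrict0_def)

lemma holomorphic_fun_ham_on: "A \<in> sp \<Longrightarrow> open U \<Longrightarrow> holomorphic_fun U (ham_on U c A)"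
  by (subst holomorphic_fun_cong[OF ham_on_eq]) (simp_all add: holomorphic_fun_ham)

lemma total_deriv_total_deriv_ham_on:
  assumes "A \<in> sp" "open U" "z \<in> U" "symmetric2 q"
  shows "total_deriv q j (total_deriv q i (ham_on U c A)) z
      = symp_form (A *v frame c q j z) (frame c q i z)"
proof -
  have "total_deriv q i (ham_on U c A) z = total_deriv q i (ham c A) z" if "z \<in> U" for z
    using \<open>open U\<close> that ham_on_eq by (rule total_deriv_cong)
  then have "total_deriv q j (total_deriv q i (ham_on U c A)) z
      = total_deriv q j (total_deriv q i (ham c A)) z"
    by (rule total_deriv_cong[OF assms(2,3)])
  then show ?thesis by (simp add: total_deriv_total_deriv_ham[OF assms(1,4)])
qed

lemma ham_on_in_contact_symmetries:
  fixes c :: "'n::finite option"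
  assumes "A \<in> sp" "open U"
  shows "ham_on U c A \<in> contact_symmetries U"
  unfolding contact_symmetries_iff
proof (intro conjI allI impI ballI)
  fix z and q :: "complex^'n^'n" and i j k assume z: "z \<in> U" and q: "symmetric2 q"
  have "total_deriv q k (total_deriv q j (total_deriv q i (ham_on U c A))) z
      = total_deriv q k (\<lambda>z. symp_form (A *v frame c q j z) (frame c q i z)) z"
    by (intro total_deriv_cong[OF assms(2) z] total_deriv_total_deriv_ham_on assms q)
  also have "\<dots> = 0"
    using total_deriv_total_deriv_total_deriv_ham[OF assms(1) q] by
        (simp add: total_deriv_total_deriv_ham[OF assms(1) q])
  finally show "total_deriv q k (total_deriv q j (total_deriv q i (ham_on U c A))) z = 0" .
qed (simp_all add: holomorphic_fun_ham_on assms ham_on_outside)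

lemma lagrange_bracket_ham_on:
  assumes "A \<in> sp" "B \<in> sp" "open U"
  shows "restrict0 U (lagrange_bracket (ham_on U c A) (ham_on U c B)) = ham_on U c (commutator A B)"
proof -
  have "lagrange_bracket (ham_on U c A) (ham_on U c B) z = lagrange_bracket (ham c A) (ham c B) z"
      if "z \<in> U" for z
  proof -
    have "dir_deriv w (ham_on U c M) z = dir_deriv w (ham c M) z" for w M
      using \<open>open U\<close> that ham_on_eq by (rule dir_deriv_cong)
    then show ?thesis
      by (simp add: lagrange_bracket_def ddx_eq d_u_eq_dir_deriv d_p_eq_dir_deriv ham_on_eq[OF that])
  qed
  then show ?thesis
    by (auto simp: fun_eq_iff restrict0_def ham_on_def lagrange_bracket_ham[OF assms(1,2)])
qed

section \<open>Contact symmetries are quadratic\<close>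

lemma cscale_minus_one: "cscale (- 1) w = - w"
  by (cases w) (simp add: vec_eq_iff)

text \<open>
  The coordinates \<open>(x, s, p)\<close> with \<open>s = 2 u - x \<cdot> p\<close>, in which contact lines are straight.  They
  identify the jet space with a Heisenberg group, whose horizontal lines the contact lines are.
\<close>

definition from_heis :: "'n::finite jet1 \<Rightarrow> 'n jet1" where
  "from_heis = (\<lambda>(x, s, p). (x, (s + (\<Sum>i\<in>UNIV. x $ i * p $ i)) / 2, p))"

definition to_heis :: "'n::finite jet1 \<Rightarrow> 'n jet1" where
  "to_heis = (\<lambda>(x, u, p). (x, 2 * u - (\<Sum>i\<in>UNIV. x $ i * p $ i), p))"

lemma from_to_heis [simp]: "from_heis (to_heis z) = z"
  by (simp add: from_heis_def to_heis_def split: prod.split)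

lemma to_from_heis [simp]: "to_heis (from_heis y) = y"
  by (cases y) (simp add: from_heis_def to_heis_def field_simps)

definition d_from_heis :: "'n::finite jet1 \<Rightarrow> 'n jet1 \<Rightarrow> 'n jet1" where
  "d_from_heis = (\<lambda>(x, s, p) (\<xi>, \<sigma>, \<eta>).
     (\<xi>, (\<sigma> + (\<Sum>i\<in>UNIV. x $ i * \<eta> $ i + \<xi> $ i * p $ i)) / 2, \<eta>))"

lemma has_derivative_sum_coord:
  "((\<lambda>z. \<Sum>i\<in>UNIV. fst z $ i * snd (snd z) $ i) has_derivative
    (\<lambda>h. \<Sum>i\<in>UNIV. fst y $ i * snd (snd h) $ i
        + fst h $ i * snd (snd y) $ i)) (at (y :: 'n::finite jet1))"
  by (rule has_derivative_sum[OF has_derivative_mult[OF has_derivative_coord(1,3)]])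

lemma has_derivative_from_heis: "(from_heis has_derivative d_from_heis y) (at y)"
proof -
  have "((\<lambda>y. (fst y, (fst (snd y) + (\<Sum>i\<in>UNIV. fst y $ i * snd (snd y) $ i)) / 2, snd (snd y)))
      has_derivative
     (\<lambda>h. (fst h, (fst (snd h) + (\<Sum>i\<in>UNIV. fst y $ i * snd (snd h) $ i
         + fst h $ i * snd (snd y) $ i)) / 2, snd (snd h)))) (at y)"
    by (rule has_derivative_Pair[OF has_derivative_fst[OF has_derivative_ident]
          has_derivative_Pair[OF bounded_linear.has_derivative[OF bounded_linear_divide
              has_derivative_add[OF has_derivative_coord(2) has_derivative_sum_coord]]
            has_derivative_snd[OF has_derivative_snd[OF has_derivative_ident]]]])
  then show ?thesis
    by (simp add: from_heis_def d_from_heis_def case_prod_unfold)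
qed

lemma continuous_to_heis: "continuous_on UNIV to_heis" and continuous_from_heis:
    "continuous_on UNIV from_heis"
  unfolding from_heis_def to_heis_def case_prod_unfold by (intro continuous_intros; simp)+

lemma d_from_heis_cscale: "d_from_heis y (cscale a w) = cscale a (d_from_heis y w)"
  by (cases y; cases w) (simp add: d_from_heis_def algebra_simps sum_distrib_left sum.distrib)

lemma holomorphic_fun_compose_from_heis:
  assumes "holomorphic_fun U f"
  shows "holomorphic_fun (from_heis -` U) (\<lambda>y. f (from_heis y))"
proof (rule holomorphic_funI)
  show "open (from_heis -` U)"
    using open_vimage[OF holomorphic_fun_open[OF assms] continuous_from_heis] by simp
  show "((\<lambda>y. f (from_heis y)) has_derivative (\<lambda>w. dir_deriv (d_from_heis y w) f (from_heis y))) (at y)"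
    if "y \<in> from_heis -` U" for y
    using that by (intro has_derivative_compose[OF has_derivative_from_heis]
        holomorphic_fun_has_derivative[OF assms]) simp
qed (simp add: d_from_heis_cscale holomorphic_fun_has_derivative(2)[OF assms])

lemma dir_deriv_compose_from_heis:
  assumes "holomorphic_fun U f" "from_heis y \<in> U"
  shows "dir_deriv w (\<lambda>y. f (from_heis y)) y = dir_deriv (d_from_heis y w) f (from_heis y)"
  by (rule dir_deriv_eqI[OF has_derivative_compose[OF
      has_derivative_from_heis holomorphic_fun_has_derivative(1)[OF assms]]])
     (simp add: d_from_heis_cscale holomorphic_fun_has_derivative(2)[OF assms])

text \<open>
  The directions in the contact hyperplane at \<open>(x, s, p)\<close>.
\<close>

definition horizontal :: "'n::finite jet1 \<Rightarrow> 'n jet1 \<Rightarrow> bool" where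
  "horizontal = (\<lambda>(x, s, p) (\<xi>, \<sigma>, \<eta>). \<sigma> = (\<Sum>i\<in>UNIV. p $ i * \<xi> $ i - x $ i * \<eta> $ i))"

lemma horizontal_add: "horizontal y v \<Longrightarrow> horizontal y w \<Longrightarrow> horizontal y (v + w)"
  by (cases y; cases v; cases w)
     (simp add: horizontal_def ring_distribs add_diff_add sum.distrib)

lemma horizontal_cscale: "horizontal y w \<Longrightarrow> horizontal y (cscale a w)"
  by (cases y; cases w) (simp add: horizontal_def sum_distrib_left right_diff_distrib mult_ac)

lemma horizontal_line: "horizontal y w \<Longrightarrow> horizontal (y + cscale a w) w"
  by (cases y; cases w) (simp add: horizontal_def ring_distribs mult_ac)

text \<open>
  A straight horizontal line maps to a curve in jet space that is tangent to
  \<open>\<Sum>\<^sub>i \<xi>\<^sup>i (\<partial>\<^bsub>x\<^sup>i\<^esub> + u\<^sub>i \<partial>\<^sub>u) + \<Sum>\<^sub>i \<eta>\<^sub>i \<partial>\<^bsub>u\<^sub>i\<^esub>\<close> everywhere, with the same \<open>\<xi>\<close> and \<open>\<eta>\<close> along the line.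
\<close>

lemma d_from_heis_horizontal:
  assumes "horizontal y (\<xi>, \<sigma>, \<eta>)"
  shows "d_from_heis y (\<xi>, \<sigma>, \<eta>) = (\<xi>, (\<Sum>i\<in>UNIV. snd (snd (from_heis y)) $ i * \<xi> $ i), \<eta>)"
  using assms by (cases y)
      (simp add: horizontal_def d_from_heis_def from_heis_def sum_subtractf sum.distrib mult_ac)

definition horizontal_deriv ::
    "complex^'n \<Rightarrow> complex^'n \<Rightarrow> ('n::finite jet1 \<Rightarrow> complex) \<Rightarrow> 'n jet1 \<Rightarrow> complex" where
  "horizontal_deriv \<xi> \<eta> f = (\<lambda>z. dir_deriv (\<xi>, (\<Sum>i\<in>UNIV. snd (snd z) $ i * \<xi> $ i), \<eta>) f z)"

text \<open>
  If \<open>\<eta> = q \<xi>\<close>, the horizontal derivative is a combination of total derivatives with constant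
  coefficients, so that its powers are combinations of iterated total derivatives.
\<close>

lemma horizontal_deriv_eq:
  assumes f: "holomorphic_fun U f" and z: "z \<in> U" and \<eta>: "\<And>j. \<eta> $ j = (\<Sum>i\<in>UNIV. \<xi> $ i * q $ i $ j)"
  shows "horizontal_deriv \<xi> \<eta> f z = (\<Sum>i\<in>UNIV. \<xi> $ i * total_deriv q i f z)"
proof -
  interpret linear "\<lambda>w. dir_deriv w f z" using f z by (rule holomorphic_fun_dir_deriv_linear)
  have "(\<xi>, (\<Sum>i\<in>UNIV. snd (snd z) $ i * \<xi> $ i), \<eta>)
      = (\<Sum>i\<in>UNIV. cscale (\<xi> $ i) (axis i 1, snd (snd z) $ i, q $ i))"
    unfolding prod_eq_iff fst_sum snd_sum cscale_Pair fst_conv snd_conv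
    by (simp add: vec_eq_sum_axis[symmetric, of \<xi>] vec_eq_iff \<eta> mult.commute)
  then show ?thesis
    by (simp only: horizontal_deriv_def total_deriv_def sum holomorphic_fun_has_derivative(2)[OF f z])
qed

text \<open>
  The derivative in a constant direction only sees values along its line, and along a horizontal
  line this is the horizontal derivative in jet space.  Hence it suffices that \<open>G\<close> agrees with the
  pullback of \<open>g\<close> at those points where the direction is horizontal; this allows the lemma to be
  iterated.
\<close>

lemma dir_deriv_horizontal:
  assumes g: "holomorphic_fun U g"
    and G: "\<And>y. from_heis y \<in> U \<Longrightarrow> horizontal y (\<xi>, \<sigma>, \<eta>) \<Longrightarrow> G y = g (from_heis y)"
    and y: "from_heis y \<in> U" "horizontal y (\<xi>, \<sigma>, \<eta>)"
  shows "dir_deriv (\<xi>, \<sigma>, \<eta>) G y = horizontal_deriv \<xi> \<eta> g (from_heis y)"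
proof -
  let ?w = "(\<xi>, \<sigma>, \<eta>)"
  have "open (from_heis -` U)"
    using holomorphic_fun_open[OF holomorphic_fun_compose_from_heis[OF g]] .
  then have "\<forall>\<^sub>F t in nhds 0. y + cscale t ?w \<in> from_heis -` U"
    by (rule eventually_line_in) (use y in \<open>simp del: cscale_Pair\<close>)
  then have "\<forall>\<^sub>F t in nhds 0. G (y + cscale t ?w) = g (from_heis (y + cscale t ?w))"
    by eventually_elim (use y(2) in \<open>auto intro!: G horizontal_line simp del: cscale_Pair\<close>)
  then have "dir_deriv ?w G y = dir_deriv ?w (\<lambda>y. g (from_heis y)) y"
    unfolding dir_deriv_def by (rule deriv_cong_ev) simp
  also have "\<dots> = horizontal_deriv \<xi> \<eta> g (from_heis y)"
    by (simp add: dir_deriv_compose_from_heis[OF g y(1)] d_from_heis_horizontal[OF y(2)]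
        horizontal_deriv_def)
  finally show ?thesis .
qed

text \<open>
  Every contact direction with \<open>\<xi> \<noteq> 0\<close> is tangent to some second jet.
\<close>

lemma symmetric_matrix_through:
  assumes "\<xi> \<noteq> 0"
  obtains q :: "complex^'n::finite^'n" where "symmetric2 q" "\<And>j. \<eta> $ j = (\<Sum>i\<in>UNIV. \<xi> $ i * q $ i $ j)"
proof -
  obtain k where k: "\<xi> $ k \<noteq> 0" using assms by (auto simp: vec_eq_iff)
  define a where "a = (\<Sum>i\<in>UNIV. \<xi> $ i * \<eta> $ i)"
  define \<delta> where "\<delta> = (\<lambda>j. axis k (1::complex) $ j)"
  \<comment> \<open>\<open>\<eta> \<otimes> e\<^sub>k / \<xi>\<^sub>k\<close> maps \<open>\<xi>\<close> to \<open>\<eta>\<close>; its transpose is added for symmetry, and the surplus multiple of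
    \<open>e\<^sub>k\<close> that this produces is cancelled in the entry \<open>(k, k)\<close>.\<close>
  define q :: "complex^'n^'n" where
    "q = (\<chi> i j. (\<eta> $ i * \<delta> j + \<delta> i * \<eta> $ j) / \<xi> $ k - \<delta> i * \<delta> j * a / (\<xi> $ k)\<^sup>2)"
  have "(\<Sum>i\<in>UNIV. \<xi> $ i * q $ i $ j) = \<eta> $ j" for j
  proof -
    have "(\<Sum>i\<in>UNIV. \<xi> $ i * q $ i $ j) = (\<Sum>i\<in>UNIV. \<xi> $ i * \<eta> $ i) * (\<delta> j / \<xi> $ k)
        + (\<Sum>i\<in>UNIV. \<xi> $ i * \<delta> i) * (\<eta> $ j / \<xi> $ k - \<delta> j * a / (\<xi> $ k)\<^sup>2)"
      unfolding sum_distrib_right sum.distrib[symmetric]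
      by (rule sum.cong) (simp_all add: q_def add_divide_distrib algebra_simps)
    also have "\<dots> = a * (\<delta> j / \<xi> $ k) + \<xi> $ k * (\<eta> $ j / \<xi> $ k - \<delta> j * a / (\<xi> $ k)\<^sup>2)"
      by (simp add: a_def \<delta>_def)
    also have "\<dots> = \<eta> $ j" using k by (simp add: field_simps power2_eq_square)
    finally show ?thesis .
  qed
  moreover have "symmetric2 q" by (simp add: symmetric2_def q_def mult_ac add.commute)
  ultimately show ?thesis using that[of q] by simp
qed

text \<open>
  With \<open>q\<close> chosen such that \<open>\<eta> = q \<xi>\<close>, the cube of the horizontal derivative is
  \<open>\<Sum>\<^sub>i\<^sub>j\<^sub>k \<xi>\<^sup>i \<xi>\<^sup>j \<xi>\<^sup>k D\<^sub>k D\<^sub>j D\<^sub>i\<close>, which kills every symmetry.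
\<close>

lemma horizontal_deriv_cubed_eq_0:
  assumes f: "f \<in> contact_symmetries U" and z: "z \<in> U" and "\<xi> \<noteq> 0"
  shows "horizontal_deriv \<xi> \<eta> (horizontal_deriv \<xi> \<eta> (horizontal_deriv \<xi> \<eta> f)) z = 0"
    and "holomorphic_fun U (horizontal_deriv \<xi> \<eta> f)"
        "holomorphic_fun U (horizontal_deriv \<xi> \<eta> (horizontal_deriv \<xi> \<eta> f))"
proof -
  obtain q where q: "symmetric2 q" and \<eta>: "\<And>j. \<eta> $ j = (\<Sum>i\<in>UNIV. \<xi> $ i * q $ i $ j)"
    using symmetric_matrix_through[OF \<open>\<xi> \<noteq> 0\<close>, of \<eta>] by metis
  have h: "holomorphic_fun U f"
    and third: "\<And>z i j k. z \<in> U \<Longrightarrow> total_deriv q k (total_deriv q j (total_deriv q i f)) z = 0"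
    using f q unfolding contact_symmetries_iff by blast+
  have hol: "holomorphic_fun U (horizontal_deriv \<xi> \<eta> g)" if g: "holomorphic_fun U g" for g
  proof -
    have "holomorphic_fun U (\<lambda>z. \<Sum>i\<in>UNIV. \<xi> $ i * total_deriv q i g z)"
      by (rule holomorphic_fun_sum[OF finite holomorphic_fun_open[OF g]
            holomorphic_fun_cmult[OF holomorphic_fun_total_deriv[OF g]]])
    then show ?thesis
      by (subst holomorphic_fun_cong[where g = "\<lambda>z. \<Sum>i\<in>UNIV. \<xi> $ i * total_deriv q i g z"])
         (simp_all add: horizontal_deriv_eq[OF g _ \<eta>])
  qed
  show "holomorphic_fun U (horizontal_deriv \<xi> \<eta> f)"
      "holomorphic_fun U (horizontal_deriv \<xi> \<eta> (horizontal_deriv \<xi> \<eta> f))"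
    by (intro hol h)+
  have comm: "total_deriv q j (horizontal_deriv \<xi> \<eta> g) z
      = (\<Sum>i\<in>UNIV. \<xi> $ i * total_deriv q j (total_deriv q i g) z)"
    if g: "holomorphic_fun U g" and z: "z \<in> U" for g z j
  proof -
    have "total_deriv q j (horizontal_deriv \<xi> \<eta> g) z
        = total_deriv q j (\<lambda>z. \<Sum>i\<in>UNIV. \<xi> $ i * total_deriv q i g z) z"
      by (rule total_deriv_cong[OF holomorphic_fun_open[OF g] z]) (rule horizontal_deriv_eq[OF g _ \<eta>])
    also have "\<dots> = (\<Sum>i\<in>UNIV. total_deriv q j (\<lambda>z. \<xi> $ i * total_deriv q i g z) z)"
      unfolding total_deriv_def[of q j]
      by (rule dir_deriv_sum[OF finite _ holomorphic_fun_open[OF g] z])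
         (rule holomorphic_fun_cmult[OF holomorphic_fun_total_deriv[OF g]])
    also have "\<dots> = (\<Sum>i\<in>UNIV. \<xi> $ i * total_deriv q j (total_deriv q i g) z)"
      unfolding total_deriv_def[of q j]
      by (simp only: dir_deriv_cmult[OF holomorphic_fun_total_deriv[OF g] z])
    finally show ?thesis .
  qed
  have "total_deriv q k (horizontal_deriv \<xi> \<eta> (horizontal_deriv \<xi> \<eta> f)) z = 0" for k
  proof -
    have "total_deriv q k (total_deriv q j (horizontal_deriv \<xi> \<eta> f)) z = 0" for j
    proof -
      have "total_deriv q k (total_deriv q j (horizontal_deriv \<xi> \<eta> f)) z
          = total_deriv q k (\<lambda>z. \<Sum>i\<in>UNIV. \<xi> $ i * total_deriv q j (total_deriv q i f) z) z"
        by (rule total_deriv_cong[OF holomorphic_fun_open[OF h] z]) (rule comm[OF h])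
      also have "\<dots> = (\<Sum>i\<in>UNIV. total_deriv q k (\<lambda>z. \<xi> $ i * total_deriv q j (total_deriv q i f) z) z)"
        unfolding total_deriv_def[of q k]
        by (rule dir_deriv_sum[OF finite _ holomorphic_fun_open[OF h] z])
           (rule holomorphic_fun_cmult[OF holomorphic_fun_total_deriv[OF
               holomorphic_fun_total_deriv[OF h]]])
      also have "\<dots> = (\<Sum>i\<in>UNIV. \<xi> $ i * total_deriv q k (total_deriv q j (total_deriv q i f)) z)"
        unfolding total_deriv_def[of q k]
        by (simp only: dir_deriv_cmult[OF holomorphic_fun_total_deriv[OF
            holomorphic_fun_total_deriv[OF h]] z])
      also have "\<dots> = 0" by (simp add: third[OF z])
      finally show ?thesis .
    qed
    then show ?thesis by (simp add: comm[OF hol[OF h] z])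
  qed
  then show "horizontal_deriv \<xi> \<eta> (horizontal_deriv \<xi> \<eta> (horizontal_deriv \<xi> \<eta> f)) z = 0"
    by (simp add: horizontal_deriv_eq[OF hol[OF hol[OF h]] z \<eta>])
qed

lemma dir_deriv_cubed_horizontal_eq_0:
  assumes f: "f \<in> contact_symmetries U" and "\<xi> \<noteq> 0" and y: "from_heis y \<in> U" "horizontal y (\<xi>, \<sigma>, \<eta>)"
  shows "dir_deriv (\<xi>, \<sigma>, \<eta>) (dir_deriv (\<xi>, \<sigma>, \<eta>) (dir_deriv (\<xi>, \<sigma>, \<eta>) (\<lambda>y. f (from_heis y)))) y = 0"
proof -
  have h: "holomorphic_fun U f" using f by (simp add: contact_symmetries_iff)
  note h2 = horizontal_deriv_cubed_eq_0(2,3)[OF f y(1) \<open>\<xi> \<noteq> 0\<close>]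
  show ?thesis
    by (subst dir_deriv_horizontal[OF h2(2) _ y], rule dir_deriv_horizontal[OF h2(1)], rule
        dir_deriv_horizontal[OF h])
       (use horizontal_deriv_cubed_eq_0(1)[OF f y(1) \<open>\<xi> \<noteq> 0\<close>] in simp_all)
qed

lemma Taylor2_along_line:
  assumes G: "holomorphic_fun V G" and "convex B" "open B" "B \<subseteq> V" and y: "y \<in> B" "y + h \<in> B"
    and third: "\<And>t. y + cscale t h \<in> B \<Longrightarrow> dir_deriv h (dir_deriv h (dir_deriv h G)) (y + cscale t h) = 0"
  shows "G (y + h) = G y + dir_deriv h G y + dir_deriv h (dir_deriv h G) y / 2"
proof -
  define S where "S = {t. y + cscale t h \<in> B}"
  have "convex S"
  proof (rule convexI)
    fix s t :: complex and a b :: real assume st: "s \<in> S" "t \<in> S" and ab: "0 \<le> a" "0 \<le> b" "a + b = 1"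
    have e1: "cscale (a *\<^sub>R s + b *\<^sub>R t) h = a *\<^sub>R cscale s h + b *\<^sub>R cscale t h"
      by (simp add: linear_cmul[OF bounded_linear.linear[OF bounded_linear_cscale[of h]]])
    have e2: "a *\<^sub>R y + b *\<^sub>R y = y"
      using ab by (simp flip: scaleR_add_left)
    have "y + cscale (a *\<^sub>R s + b *\<^sub>R t) h = (a *\<^sub>R y + b *\<^sub>R y) + (a *\<^sub>R cscale s h
        + b *\<^sub>R cscale t h)"
      by (simp only: e1 e2)
    also have "\<dots> = a *\<^sub>R (y + cscale s h) + b *\<^sub>R (y + cscale t h)"
      by (simp add: scaleR_add_right)
    finally have "y + cscale (a *\<^sub>R s + b *\<^sub>R t) h = a *\<^sub>R (y + cscale s h) + b *\<^sub>R (y + cscale t h)" .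
    with convexD[OF \<open>convex B\<close>] st ab show "a *\<^sub>R s + b *\<^sub>R t \<in> S" by (simp add: S_def)
  qed
  have 01: "0 \<in> S" "1 \<in> S" using y by (simp_all add: S_def)
  have der: "((\<lambda>t. K (y + cscale t h)) has_field_derivative dir_deriv h K (y
      + cscale t h)) (at t within S)"
    if "holomorphic_fun V K" "t \<in> S" for K t
    using has_field_derivative_along[OF that(1) _ has_derivative_line, of y t h] that(2) \<open>B \<subseteq> V\<close>
    by (auto simp: S_def intro: has_field_derivative_at_within)
  note G1 = holomorphic_fun_dir_deriv[OF G, of h] and G2
      = holomorphic_fun_dir_deriv[OF holomorphic_fun_dir_deriv[OF G, of h], of h]
  define a b where "a = dir_deriv h G y" and "b = dir_deriv h (dir_deriv h G) y"
  have "((\<lambda>t. dir_deriv h (dir_deriv h G) (y + cscale t h)) has_field_derivative 0) (at t within S)"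
      if "t \<in> S" for t
    using der[OF G2 that] third[of t] that by (simp add: S_def)
  from has_field_derivative_zero_constant[OF \<open>convex S\<close> this]
  have b: "dir_deriv h (dir_deriv h G) (y + cscale t h) = b" if "t \<in> S" for t
    using that 01 by (metis cscale_simps(1) add_0_right b_def)
  have "((\<lambda>t. dir_deriv h G (y + cscale t h) - t * b) has_field_derivative 0) (at t within S)" if "t
      \<in> S" for t
    using der[OF G1 that] by (auto intro!: derivative_eq_intros simp: b[OF that])
  from has_field_derivative_zero_constant[OF \<open>convex S\<close> this]
  obtain k where k: "\<And>t. t \<in> S \<Longrightarrow> dir_deriv h G (y + cscale t h) - t * b = k" by blast
  have a: "dir_deriv h G (y + cscale t h) = a + t * b" if "t \<in> S" for t
    using k[OF that] k[OF 01(1)] by (simp add: a_def algebra_simps)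
  have "((\<lambda>t. G (y + cscale t h) - t * a - t\<^sup>2 * (b / 2)) has_field_derivative 0) (at t within S)"
      if "t \<in> S" for t
    using der[OF G that] by (auto intro!: derivative_eq_intros simp: a[OF that])
  from has_field_derivative_zero_constant[OF \<open>convex S\<close> this]
  obtain k' where k': "\<And>t. t \<in> S \<Longrightarrow> G (y + cscale t h) - t * a - t\<^sup>2 * (b / 2) = k'" by blast
  show ?thesis
    using k'[OF 01(1)] k'[OF 01(2)] by (simp add: a_def b_def algebra_simps)
qed

lemma dir_deriv_eventually:
  assumes G: "holomorphic_fun V G" and y: "y \<in> V"
    and "\<forall>\<^sub>F t in nhds 0. G (y + cscale t w) = \<phi> t" and "\<And>t. (\<phi> has_field_derivative \<phi>' t) (at t)"
  shows "\<forall>\<^sub>F t in nhds 0. dir_deriv w G (y + cscale t w) = \<phi>' t"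
proof -
  have "\<forall>\<^sub>F t in nhds 0. y + cscale t w \<in> V"
    by (rule eventually_line_in[OF holomorphic_fun_open[OF G]]) (simp add: y)
  moreover have "\<forall>\<^sub>F t in nhds 0. \<forall>\<^sub>F s in nhds t. G (y + cscale s w) = \<phi> s"
    using assms(3) by (simp add: eventually_eventually)
  ultimately show ?thesis
  proof eventually_elim
    case (elim t)
    have "((\<lambda>t. G (y + cscale t w)) has_field_derivative dir_deriv w G (y + cscale t w)) (at t)"
      by (rule has_field_derivative_along[OF G elim(1) has_derivative_line])
    then have "(\<phi> has_field_derivative dir_deriv w G (y + cscale t w)) (at t)"
      using DERIV_cong_ev[OF refl elim(2) refl] by blast
    then show ?case using assms(4) DERIV_unique by blast
  qed
qed

lemma dir_deriv_cubed_eq_0: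
  assumes G: "holomorphic_fun V G" and y: "y \<in> V"
    and ev: "\<forall>\<^sub>F t in nhds 0. G (y + cscale t w) = a + t * b + t\<^sup>2 * c"
  shows "dir_deriv w (dir_deriv w (dir_deriv w G)) y = 0"
proof -
  have "\<forall>\<^sub>F t in nhds 0. dir_deriv w G (y + cscale t w) = b + 2 * t * c"
    by (rule dir_deriv_eventually[OF G y ev]) (auto intro!: derivative_eq_intros)
  then have "\<forall>\<^sub>F t in nhds 0. dir_deriv w (dir_deriv w G) (y + cscale t w) = 2 * c"
    by (rule dir_deriv_eventually[OF holomorphic_fun_dir_deriv[OF G] y])
        (auto intro!: derivative_eq_intros)
  then have "\<forall>\<^sub>F t in nhds 0. dir_deriv w (dir_deriv w (dir_deriv w G)) (y + cscale t w) = 0"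
    by (rule dir_deriv_eventually[OF holomorphic_fun_dir_deriv[OF holomorphic_fun_dir_deriv[OF G]]
        y]) (auto intro!: derivative_eq_intros)
  then show ?thesis using eventually_nhds_x_imp_x by fastforce
qed

lemma dir_deriv_combination:
  assumes F: "holomorphic_fun V F" and y: "y \<in> V"
  shows "dir_deriv (v + cscale t w) F y = dir_deriv v F y + t * dir_deriv w F y"
  using linear_add[OF holomorphic_fun_dir_deriv_linear[OF F y]] holomorphic_fun_has_derivative(2)[OF
      F y] by simp

lemma dir_deriv_dir_deriv_combination:
  assumes F: "holomorphic_fun V F" and y: "y \<in> V"
  shows "dir_deriv h (dir_deriv (v + cscale t w) F) y = dir_deriv h (dir_deriv v F) y
      + t * dir_deriv h (dir_deriv w F) y"
proof -
  have "dir_deriv h (dir_deriv (v + cscale t w) F) y = dir_deriv h (\<lambda>y. dir_deriv v F y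
      + t * dir_deriv w F y) y"
    by (rule dir_deriv_cong[OF holomorphic_fun_open[OF F] y]) (rule dir_deriv_combination[OF F])
  then show ?thesis
    by (simp add: dir_deriv_add[OF holomorphic_fun_dir_deriv[OF F] holomorphic_fun_cmult[OF
        holomorphic_fun_dir_deriv[OF F]] y]
        dir_deriv_cmult[OF holomorphic_fun_dir_deriv[OF F] y])
qed

lemma dir_deriv_dir_deriv_dir_deriv_combination:
  assumes F: "holomorphic_fun V F" and y: "y \<in> V"
  shows "dir_deriv g (dir_deriv h (dir_deriv (v + cscale t w) F)) y
      = dir_deriv g (dir_deriv h (dir_deriv v F)) y + t * dir_deriv g (dir_deriv h (dir_deriv w F)) y"
proof -
  have "dir_deriv g (dir_deriv h (dir_deriv (v + cscale t w) F)) y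
      = dir_deriv g (\<lambda>y. dir_deriv h (dir_deriv v F) y + t * dir_deriv h (dir_deriv w F) y) y"
    by (rule dir_deriv_cong[OF holomorphic_fun_open[OF F] y]) (rule
        dir_deriv_dir_deriv_combination[OF F])
  then show ?thesis
    by (simp add: dir_deriv_add[OF holomorphic_fun_dir_deriv[OF holomorphic_fun_dir_deriv[OF F]]
          holomorphic_fun_cmult[OF holomorphic_fun_dir_deriv[OF holomorphic_fun_dir_deriv[OF F]]] y]
        dir_deriv_cmult[OF holomorphic_fun_dir_deriv[OF holomorphic_fun_dir_deriv[OF F]] y])
qed

lemma cubic_leading_coeff_eq_0:
  fixes c0 c1 c2 c3 :: complex
  assumes "\<forall>\<^sub>F t in at 0. c0 + t * c1 + t\<^sup>2 * c2 + t ^ 3 * c3 = 0"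
  shows "c3 = 0"
proof -
  obtain d where d: "d > 0" "\<And>t. t \<noteq> 0 \<Longrightarrow> norm t < d \<Longrightarrow> c0 + t * c1 + t\<^sup>2 * c2 + t ^ 3 * c3 = 0"
    using assms unfolding eventually_at by (auto simp: dist_norm)
  define r :: complex where "r = of_real (d / 3)"
  have r: "r \<noteq> 0" "norm r < d" "norm (2 * r) < d" using d(1) by (auto simp: r_def norm_mult)
  from d(2)[of r] d(2)[of "-r"] d(2)[of "2 * r"] d(2)[of "- (2 * r)"] r
  have "c0 + r * c1 + r\<^sup>2 * c2 + r ^ 3 * c3 = 0" "c0 - r * c1 + r\<^sup>2 * c2 - r ^ 3 * c3 = 0"
    "c0 + 2 * r * c1 + 4 * r\<^sup>2 * c2 + 8 * r ^ 3 * c3 = 0" "c0 - 2 * r * c1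
        + 4 * r\<^sup>2 * c2 - 8 * r ^ 3 * c3 = 0"
    by (simp_all add: power_mult_distrib)
  then have "12 * (r ^ 3 * c3) = 0" by algebra
  then show ?thesis using r by simp
qed

text \<open>
  Within \<open>B\<close>, the function \<open>F\<close> equals its second Taylor polynomial at \<open>y\<close> on the horizontal lines
  through \<open>y\<close> that are tangent to second jets; these sweep out a hyperplane.  So \<open>F\<close> is quadratic
  along the line through \<open>y + h0\<close> in direction \<open>w\<close>, which lies in this hyperplane although it is in
  general not horizontal at \<open>y + h0\<close>.  The condition on \<open>fst h0\<close> keeps the directions \<open>h0 + t w\<close>
  tangent to second jets for small \<open>t\<close>.
\<close>

lemma dir_deriv_cubed_in_horizontal_plane:
  assumes f: "f \<in> contact_symmetries U" and B: "convex B" "open B" "B \<subseteq> from_heis -` U"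
    and y: "y \<in> B" "y + h0 \<in> B" and hor: "horizontal y h0" "horizontal y w" and "fst h0 \<noteq> 0"
  defines "F \<equiv> \<lambda>y. f (from_heis y)"
  shows "dir_deriv w (dir_deriv w (dir_deriv w F)) (y + h0) = 0"
proof -
  have F: "holomorphic_fun (from_heis -` U) F"
    unfolding F_def using f
    by (intro holomorphic_fun_compose_from_heis) (simp add: contact_symmetries_iff)
  have yU: "y \<in> from_heis -` U" "y + h0 \<in> from_heis -` U" using y B(3) by auto
  obtain k where k: "fst h0 $ k \<noteq> 0" using \<open>fst h0 \<noteq> 0\<close> by (auto simp: vec_eq_iff)
  have "\<forall>\<^sub>F t in nhds 0. y + h0 + cscale t w \<in> B"
    by (rule eventually_line_in[OF B(2)]) (use y in simp)
  moreover have "\<forall>\<^sub>F t in nhds 0. fst h0 $ k + t * fst w $ k \<noteq> 0"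
  proof -
    have "((\<lambda>t. fst h0 $ k + t * fst w $ k) \<longlongrightarrow> fst h0 $ k + 0 * fst w $ k) (nhds 0)"
      by (intro tendsto_intros filterlim_ident)
    then show ?thesis by (rule tendsto_imp_eventually_ne) (use k in simp)
  qed
  ultimately have "\<forall>\<^sub>F t in nhds 0. F (y + h0 + cscale t w) =
      (F y + dir_deriv h0 F y + dir_deriv h0 (dir_deriv h0 F) y / 2)
    + t * (dir_deriv w F y + (dir_deriv h0 (dir_deriv w F) y + dir_deriv w (dir_deriv h0 F) y) / 2)
    + t\<^sup>2 * (dir_deriv w (dir_deriv w F) y / 2)"
  proof eventually_elim
    case (elim t)
    define h where "h = h0 + cscale t w"
    have h_hor: "horizontal y h"
      unfolding h_def by (intro horizontal_add horizontal_cscale hor)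
    have "fst h $ k = fst h0 $ k + t * fst w $ k"
      by (cases w) (simp add: h_def)
    then have "fst h $ k \<noteq> 0" using elim(2) by simp
    then have nz: "fst h \<noteq> 0" by auto
    have "F (y + h) = F y + dir_deriv h F y + dir_deriv h (dir_deriv h F) y / 2"
    proof (rule Taylor2_along_line[OF F B y(1)])
      show "y + h \<in> B" using elim(1) by (simp add: h_def algebra_simps)
      fix s assume "y + cscale s h \<in> B"
      then have "from_heis (y + cscale s h) \<in> U" using B(3) by auto
      from dir_deriv_cubed_horizontal_eq_0[OF f nz this, of "fst (snd h)" "snd (snd h)"]
      show "dir_deriv h (dir_deriv h (dir_deriv h F)) (y + cscale s h) = 0"
        using horizontal_line[OF h_hor, of s] by (simp add: F_def)
    qed
    also have "y + h = y + h0 + cscale t w" by (simp add: h_def)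
    also have "dir_deriv h F y = dir_deriv h0 F y + t * dir_deriv w F y"
      unfolding h_def by (rule dir_deriv_combination[OF F yU(1)])
    also have "dir_deriv h (dir_deriv h F) y = dir_deriv h0 (dir_deriv h0 F) y
        + t * (dir_deriv h0 (dir_deriv w F) y + dir_deriv w (dir_deriv h0 F) y)
        + t\<^sup>2 * dir_deriv w (dir_deriv w F) y"
      unfolding h_def dir_deriv_dir_deriv_combination[OF F yU(1)]
        dir_deriv_combination[OF holomorphic_fun_dir_deriv[OF F] yU(1)]
      by (simp add: algebra_simps power2_eq_square)
    finally show ?case by (simp add: algebra_simps add_divide_distrib)
  qed
  then show ?thesis by (rule dir_deriv_cubed_eq_0[OF F yU(2)])
qed

text \<open>
  With \<open>v1\<close> a horizontal direction at \<open>y\<close>, there is for each small \<open>\<tau> \<noteq> 0\<close> a point \<open>y'\<close> near \<open>y\<close> whose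
  horizontal hyperplane contains both \<open>y\<close> and the direction \<open>v1 + \<tau> v\<close>.  So the third derivative at
  \<open>y\<close> in this direction vanishes; as a polynomial in \<open>\<tau>\<close>, it has the third derivative in direction
  \<open>v\<close> as its leading coefficient.
\<close>

lemma dir_deriv_cubed_heis_eq_0:
  fixes U :: "'n::finite jet1 set"
  assumes f: "f \<in> contact_symmetries U" and y: "from_heis y \<in> U"
  defines "F \<equiv> \<lambda>y. f (from_heis y)"
  shows "dir_deriv v (dir_deriv v (dir_deriv v F)) y = 0"
proof -
  define V where "V = from_heis -` U"
  have F: "holomorphic_fun V F"
    unfolding F_def V_def using f
    by (intro holomorphic_fun_compose_from_heis) (simp add: contact_symmetries_iff)
  have "y \<in> V" using y by (simp add: V_def)
  obtain e where e: "e > 0" "ball y e \<subseteq> V"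
    using \<open>y \<in> V\<close> holomorphic_fun_open[OF F] open_contains_ball by blast
  define B where "B = ball y e"
  have B: "convex B" "open B" "B \<subseteq> from_heis -` U" using e by (simp_all add: B_def V_def)
  obtain k :: 'n where "k \<in> UNIV" by simp
  obtain x s p where y_eq: "y = (x, s, p)" by (cases y)
  obtain \<xi>' \<sigma>' \<eta>' where v_eq: "v = (\<xi>', \<sigma>', \<eta>')" by (cases v)
  define v1 :: "'n jet1" where "v1 = (axis k 1, p $ k, 0)"
  have "\<forall>\<^sub>F \<tau> in at 0.
    dir_deriv (v1 + cscale \<tau> v) (dir_deriv (v1 + cscale \<tau> v) (dir_deriv (v1 + cscale \<tau> v) F)) y = 0"
  proof -
    \<comment> \<open>\<open>\<epsilon>\<close> measures how far \<open>v\<close> is from being horizontal at \<open>y\<close>.  The base point is moved to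
      \<open>y - h0 \<tau>\<close>, where \<open>h0 \<tau>\<close> is horizontal with \<open>\<partial>\<^sub>x\<close>-part \<open>\<tau>\<close> and \<open>\<partial>\<^sub>p\<close>-part \<open>\<beta> \<tau>\<close> in direction \<open>k\<close>;
      \<open>\<beta> \<tau>\<close> is the solution of the linear equation that makes \<open>v1 + \<tau> v\<close> horizontal there.\<close>
    define \<epsilon> where "\<epsilon> = \<sigma>' - (\<Sum>i\<in>UNIV. p $ i * \<xi>' $ i - x $ i * \<eta>' $ i)"
    define \<beta> where "\<beta> = (\<lambda>\<tau>. \<tau> * (\<tau> * \<eta>' $ k - \<epsilon>) / (1 + \<tau> * \<xi>' $ k))"
    define h0 :: "complex \<Rightarrow> 'n jet1" where
      "h0 = (\<lambda>\<tau>. cscale \<tau> (axis k 1, p $ k, 0) + cscale (\<beta> \<tau>) (0, - x $ k, axis k 1))"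
    have "isCont \<beta> 0" unfolding \<beta>_def by (intro continuous_intros) simp
    then have "isCont (\<lambda>\<tau>. y - h0 \<tau>) 0"
      unfolding h0_def
      by (intro continuous_diff continuous_add continuous_const continuous_ident
          bounded_linear.isCont[OF bounded_linear_cscale])
    moreover have "h0 0 = 0" by (simp add: h0_def \<beta>_def zero_prod_def)
    ultimately have "(\<lambda>\<tau>. y - h0 \<tau>) \<midarrow>0\<rightarrow> y" by (simp add: isCont_def)
    then have "\<forall>\<^sub>F \<tau> in at 0. y - h0 \<tau> \<in> B"
      by (rule topological_tendstoD) (use e in \<open>simp_all add: B_def\<close>)
    moreover have "\<forall>\<^sub>F \<tau> in at 0. 1 + \<tau> * \<xi>' $ k \<noteq> 0"
    proof -
      have "(\<lambda>\<tau>. 1 + \<tau> * \<xi>' $ k) \<midarrow>0\<rightarrow> 1 + 0 * \<xi>' $ k" by (intro tendsto_intros)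
      then show ?thesis by (rule tendsto_imp_eventually_ne) simp
    qed
    moreover have "\<forall>\<^sub>F \<tau>::complex in at 0. \<tau> \<noteq> 0" by (simp add: eventually_at_filter)
    ultimately show ?thesis
    proof eventually_elim
      case (elim \<tau>)
      define w where "w = v1 + cscale \<tau> v"
      define y' where "y' = y - h0 \<tau>"
      have "horizontal y (axis k 1, p $ k, 0)" "horizontal y (0, - x $ k, axis k 1)"
        by (simp_all add: horizontal_def y_eq sum_negf)
      then have "horizontal y (h0 \<tau>)"
        unfolding h0_def by (intro horizontal_add horizontal_cscale)
      moreover have "y' = y + cscale (- 1) (h0 \<tau>)"
        by (simp add: y'_def cscale_minus_one)
      ultimately have h0_hor: "horizontal y' (h0 \<tau>)"
        using horizontal_line by metis
      have w_hor: "horizontal y' w"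
      proof -
        let ?d = "\<lambda>i. axis k (1::complex) $ i"
        have "(\<Sum>i\<in>UNIV. (p $ i - \<beta> \<tau> * ?d i) * (?d i + \<tau> * \<xi>' $ i) - (x $ i - \<tau> * ?d i) * (\<tau> * \<eta>' $ i))
          = (\<Sum>i\<in>UNIV. p $ i * ?d i) + \<tau> * (\<Sum>i\<in>UNIV. p $ i * \<xi>' $ i - x $ i * \<eta>' $ i)
            - \<beta> \<tau> * (\<Sum>i\<in>UNIV. ?d i * (?d i + \<tau> * \<xi>' $ i)) + \<tau> * (\<Sum>i\<in>UNIV. ?d i * (\<tau> * \<eta>' $ i))"
          unfolding sum_distrib_left sum.distrib[symmetric] sum_subtractf[symmetric]
          by (rule sum.cong) (simp_all add: algebra_simps)
        also have "\<dots> = p $ k + \<tau> * (\<sigma>' - \<epsilon>) - \<beta> \<tau> * (1 + \<tau> * \<xi>' $ k) + \<tau> * (\<tau> * \<eta>' $ k)"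
          by (simp add: \<epsilon>_def)
        also have "\<beta> \<tau> * (1 + \<tau> * \<xi>' $ k) = \<tau> * (\<tau> * \<eta>' $ k - \<epsilon>)"
          using elim(2) by (simp add: \<beta>_def)
        finally show ?thesis
          by (simp add: horizontal_def y'_def h0_def w_def v1_def v_eq y_eq algebra_simps)
      qed
      have "fst (h0 \<tau>) $ k \<noteq> 0" using elim(3) by (simp add: h0_def)
      then have "fst (h0 \<tau>) \<noteq> 0" by auto
      then have "dir_deriv w (dir_deriv w (dir_deriv w F)) (y' + h0 \<tau>) = 0"
        unfolding F_def
        by (intro dir_deriv_cubed_in_horizontal_plane[OF f B _ _ h0_hor w_hor])
           (use elim(1) e in \<open>simp_all add: y'_def B_def\<close>)
      then show ?case by (simp add: y'_def w_def)
    qed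
  qed
  moreover define D where "D = (\<lambda>a b c. dir_deriv a (dir_deriv b (dir_deriv c F)) y)"
  have "dir_deriv (v1 + cscale \<tau> v) (dir_deriv (v1 + cscale \<tau> v) (dir_deriv (v1 + cscale \<tau> v) F)) y =
    D v1 v1 v1 + \<tau> * (D v v1 v1 + D v1 v v1 + D v1 v1 v)
    + \<tau>\<^sup>2 * (D v v v1 + D v v1 v + D v1 v v) + \<tau> ^ 3 * D v v v" for \<tau>
    unfolding dir_deriv_dir_deriv_dir_deriv_combination[OF F \<open>y \<in> V\<close>]
      dir_deriv_dir_deriv_combination[OF holomorphic_fun_dir_deriv[OF F] \<open>y \<in> V\<close>]
      dir_deriv_combination[OF holomorphic_fun_dir_deriv[OF holomorphic_fun_dir_deriv[OF F]] \<open>y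
          \<in> V\<close>] D_def
    by (simp add: algebra_simps power2_eq_square power3_eq_cube)
  ultimately show ?thesis
    using cubic_leading_coeff_eq_0[of "D v1 v1 v1" _ _ "D v v v"] by (simp add: D_def)
qed

lemma dir_deriv_quadratic_heis:
  assumes f: "f \<in> contact_symmetries U" and y: "from_heis y \<in> U"
  defines "F \<equiv> \<lambda>y. f (from_heis y)"
  shows "\<exists>W. open W \<and> from_heis y \<in> W \<and> W \<subseteq> U \<and>
    (\<forall>z\<in>W. f z = F y + dir_deriv (to_heis z - y) F y
        + dir_deriv (to_heis z - y) (dir_deriv (to_heis z - y) F) y / 2)"
proof -
  define V where "V = from_heis -` U"
  have F: "holomorphic_fun V F"
    unfolding F_def V_def using f by (intro holomorphic_fun_compose_from_heis)
        (simp add: contact_symmetries_iff)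
  have "y \<in> V" using y by (simp add: V_def)
  obtain e where e: "e > 0" "ball y e \<subseteq> V"
    using \<open>y \<in> V\<close> holomorphic_fun_open[OF F] open_contains_ball by blast
  have third: "dir_deriv v (dir_deriv v (dir_deriv v F)) y' = 0" if "y' \<in> ball y e" for v y'
    unfolding F_def by (rule dir_deriv_cubed_heis_eq_0[OF f]) (use that e V_def in auto)
  show ?thesis
  proof (intro exI[of _ "to_heis -` ball y e"] conjI ballI subsetI)
    show "open (to_heis -` ball y e)"
      using open_vimage[OF open_ball continuous_to_heis] .
    show "from_heis y \<in> to_heis -` ball y e" using e by simp
    fix z assume z: "z \<in> to_heis -` ball y e"
    then have "from_heis (to_heis z) \<in> U" using e by (auto simp: V_def simp del: from_to_heis)
    then show "z \<in> U" by simp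
    have "F (y + (to_heis z - y)) = F y + dir_deriv (to_heis z - y) F y
        + dir_deriv (to_heis z - y) (dir_deriv (to_heis z - y) F) y / 2"
      by (rule Taylor2_along_line[OF F convex_ball open_ball e(2)]) (use z e third in simp_all)
    then show "f z = F y + dir_deriv (to_heis z - y) F y
        + dir_deriv (to_heis z - y) (dir_deriv (to_heis z - y) F) y / 2"
      by (simp add: F_def)
  qed
qed

text \<open>
  A linear map on the symplectic space that inverts the affine chart; it is used to homogenize
  quadratic polynomials.
\<close>

definition heis_vec :: "'n::finite option \<Rightarrow> 'n spvec \<Rightarrow> 'n jet1" where
  "heis_vec c v = (\<chi> i. v $ Inl (slot c i), v $ Inr c, \<chi> i. v $ Inr (slot c i))"

lemma heis_vec_hcoord: "heis_vec c (hcoord c z) = to_heis z"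
  by (cases z) (simp add: heis_vec_def to_heis_def)

lemma heis_vec_linear: "heis_vec c (v + w) = heis_vec c v + heis_vec c w" "heis_vec c (a *s v)
    = cscale a (heis_vec c v)"
  by (simp_all add: heis_vec_def vec_eq_iff)

text \<open>
  The second Taylor polynomial at \<open>y\<close> is homogenized: \<open>h v\<close> is linear in \<open>v\<close> and equals the
  displacement from \<open>y\<close> when \<open>v\<close> is a vector of homogeneous coordinates.
\<close>

lemma contact_symmetry_locally_ham:
  assumes f: "f \<in> contact_symmetries U" and z0: "z0 \<in> U"
  shows "\<exists>A\<in>sp. \<exists>W. open W \<and> z0 \<in> W \<and> W \<subseteq> U \<and> (\<forall>z\<in>W. f z = ham c A z)"
proof -
  define y where "y = to_heis z0"
  define F where "F = (\<lambda>y. f (from_heis y))"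
  define V where "V = from_heis -` U"
  have F: "holomorphic_fun V F"
    unfolding F_def V_def using f by (intro holomorphic_fun_compose_from_heis)
        (simp add: contact_symmetries_iff)
  have y: "y \<in> V" using z0 by (simp add: V_def y_def)
  obtain W where W: "open W" "z0 \<in> W" "W \<subseteq> U"
    "\<And>z. z \<in> W \<Longrightarrow> f z = F y + dir_deriv (to_heis z - y) F y
        + dir_deriv (to_heis z - y) (dir_deriv (to_heis z - y) F) y / 2"
    using dir_deriv_quadratic_heis[OF f, of y] z0 unfolding y_def F_def by auto
  define h where "h = (\<lambda>v. heis_vec c v + cscale (- (v $ Inl c)) y)"
  have h: "h (v + w) = h v + h w" "h (a *s v) = cscale a (h v)" for v w a
  proof -
    show "h (v + w) = h v + h w"
      by (simp add: h_def heis_vec_linear) (simp flip: cscale_simps(3))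
    show "h (a *s v) = cscale a (h v)"
      by (simp add: h_def heis_vec_linear)
  qed
  have dir_deriv1: "dir_deriv (h (v + w)) G y = dir_deriv (h v) G y + dir_deriv (h w) G y"
      "dir_deriv (h (a *s v)) G y = a * dir_deriv (h v) G y"
    if "holomorphic_fun V G" for v w a G
    using linear_add[OF holomorphic_fun_dir_deriv_linear[OF that y]]
        holomorphic_fun_has_derivative(2)[OF that y]
    by (simp_all add: h)
  have dir_deriv2: "dir_deriv g (dir_deriv (h (v + w)) F) y = dir_deriv g (dir_deriv (h v) F) y
      + dir_deriv g (dir_deriv (h w) F) y"
    "dir_deriv g (dir_deriv (h (a *s v)) F) y = a * dir_deriv g (dir_deriv (h v) F) y" for v w a g
    using dir_deriv_dir_deriv_combination[OF F y, of g "h v" 1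
        "h w"] dir_deriv_dir_deriv_combination[OF F y, of g 0 a "h v"]
      dir_deriv_dir_deriv_combination[OF F y, of g 0 1 0]
    by (simp_all add: h)
  define S where "S = (\<lambda>v w. 2 * (v $ Inl c) * (w $ Inl c) * F y + v $ Inl c * dir_deriv (h w) F y
      + w $ Inl c * dir_deriv (h v) F y
    + (dir_deriv (h v) (dir_deriv (h w) F) y + dir_deriv (h w) (dir_deriv (h v) F) y) / 2)"
  interpret symmetric_form S
    by unfold_locales (simp_all add: S_def dir_deriv1[OF F] dir_deriv1[OF
        holomorphic_fun_dir_deriv[OF F]] dir_deriv2 field_simps)
  have "f z = ham c (spmat_of_form S) z" if "z \<in> W" for z
  proof -
    have "h (hcoord c z) = to_heis z - y" by (simp add: h_def heis_vec_hcoord cscale_minus_one)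
    moreover have "ham c (spmat_of_form S) z = S (hcoord c z) (hcoord c z) / 2"
      by (simp only: ham_def symp_form_spmat_of_form)
    ultimately show ?thesis
      using W(4)[OF that] by (simp add: S_def add_divide_distrib)
  qed
  then show ?thesis using spmat_of_form_in_sp W(1-3) by blast
qed

lemma sp_diff: "A \<in> sp \<Longrightarrow> B \<in> sp \<Longrightarrow> A - B \<in> sp"
  by (rule spI) (simp add: matrix_vector_mult_diff_rdistrib sp_symmetric[of _ _ _])

lemma ham_diff: "ham c (A - B) z = ham c A z - ham c B z"
  by (simp add: ham_def matrix_vector_mult_diff_rdistrib diff_divide_distrib)

text \<open>
  If the function vanishes near \<open>z0\<close>, then so do its first derivatives, whence \<open>A y = 0\<close> near \<open>z0\<close>.
  Differentiating once more, \<open>A\<close> kills \<open>y\<close> and all derivatives of \<open>y\<close> at \<open>z0\<close>, and these span.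
\<close>

lemma ham_eq_0_imp:
  fixes c :: "'n::finite option"
  assumes A: "A \<in> sp" and W: "open W" "z0 \<in> W" and 0: "\<And>z. z \<in> W \<Longrightarrow> ham c A z = 0"
  shows "A = 0"
proof -
  have vanish: "A *v hcoord c z = 0" if "z \<in> W" for z
  proof -
    have "dir_deriv w (ham c A) z = 0" for w
      using dir_deriv_cong[OF W(1) that, of "ham c A" "\<lambda>z. 0"] 0 by simp
    then have d: "d_u (ham c A) z = 0" "d_p i (ham c A) z = 0" "ddx i (ham c A) z = 0" for i
      by (simp_all add: d_u_eq_dir_deriv d_p_eq_dir_deriv ddx_eq)
    let ?a = "A *v hcoord c z"
    have a: "?a $ Inl c = 0" using d(1) d_ham(1)[OF A] by simp
    have l: "?a $ Inl (slot c i) = 0" for i using d(2) d_ham(2)[OF A] a by simp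
    have r: "?a $ Inr (slot c i) = 0" for i using d(3) d_ham(3)[OF A] a by simp
    have "ham c A z = - ?a $ Inr c / 2"
      unfolding ham_def symp_form_slot[of _ _ c] by (simp add: a l r)
    then have "?a $ Inr c = 0" using 0[OF that] by simp
    then show ?thesis by (intro spvec_eqI[where c = c]) (simp_all add: a l r)
  qed
  have "A *v dhcoord c z0 w = 0" for w
  proof -
    have "((\<lambda>z. A *v hcoord c z) has_derivative (\<lambda>w. A *v dhcoord c z0 w)) (at z0)"
      by (rule bounded_linear.has_derivative[OF bounded_linear_matrix_vector_mul_complex
          has_derivative_hcoord])
    then have "((\<lambda>z. 0) has_derivative (\<lambda>w. A *v dhcoord c z0 w)) (at z0)"
      by (rule has_derivative_transform_within_open[OF _ W]) (simp add: vanish)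
    from has_derivative_unique[OF this has_derivative_const] show ?thesis by (metis (no_types))
  qed
  moreover have "\<exists>w. v = v $ Inl c *s hcoord c z0 + dhcoord c z0 w" for v
  proof -
    obtain x u p where z0: "z0 = (x, u, p)" by (cases z0)
    define \<xi> where "\<xi> = (\<chi> i. v $ Inl (slot c i) - v $ Inl c * x $ i)"
    define \<eta> where "\<eta> = (\<chi> i. v $ Inr (slot c i) - v $ Inl c * p $ i)"
    define \<upsilon> where "\<upsilon> = (v $ Inr c - v $ Inl c * hcoord c z0 $ Inr c + (\<Sum>i\<in>UNIV. x $ i * \<eta> $ i
        + \<xi> $ i * p $ i)) / 2"
    have "v = v $ Inl c *s hcoord c z0 + dhcoord c z0 (\<xi>, \<upsilon>, \<eta>)"
      by (rule spvec_eqI[where c = c])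
          (simp_all add: z0 \<xi>_def \<eta>_def, simp add: \<upsilon>_def z0 \<xi>_def \<eta>_def field_simps)
    then show ?thesis by blast
  qed
  ultimately have "A *v v = 0" for v
    using vanish[OF W(2)]
        by (metis (no_types, lifting) add_0 matrix_vector_right_distrib vec.scale vec.scale_zero_right)
  then show ?thesis by (metis matrix_eq matrix_vector_mult_0)
qed

lemma ham_on_inj_on:
  assumes "open U" "U \<noteq> {}"
  shows "inj_on (ham_on U c) sp"
proof (rule inj_onI)
  fix A B assume AB: "A \<in> sp" "B \<in> sp" "ham_on U c A = ham_on U c B"
  obtain z0 where z0: "z0 \<in> U" using \<open>U \<noteq> {}\<close> by blast
  have "ham c (A - B) z = 0" if "z \<in> U" for z
    using fun_cong[OF AB(3), of z] that by (simp add: ham_diff ham_on_eq)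
  from ham_eq_0_imp[OF sp_diff[OF AB(1,2)] \<open>open U\<close> z0 this] show "A = B" by simp
qed

text \<open>
  By uniqueness, the matrix that represents \<open>f\<close> near a point is locally constant.
\<close>

theorem contact_symmetries_eq:
  assumes "open U" "connected U" "U \<noteq> {}"
  shows "contact_symmetries U = ham_on U c ` sp"
proof
  show "ham_on U c ` sp \<subseteq> contact_symmetries U"
    using ham_on_in_contact_symmetries[OF _ \<open>open U\<close>] by blast
  show "contact_symmetries U \<subseteq> ham_on U c ` sp"
  proof
    fix f assume f: "f \<in> contact_symmetries U"
    obtain z0 where z0: "z0 \<in> U" using \<open>U \<noteq> {}\<close> by blast
    obtain A W0 where A: "A \<in> sp" and W0: "open W0" "z0 \<in> W0" "W0 \<subseteq> U" "\<forall>z\<in>W0. f z = ham c A z"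
      using contact_symmetry_locally_ham[OF f z0, of c] by blast
    define P where "P = \<Union>{W. open W \<and> W \<subseteq> U \<and> (\<forall>z\<in>W. f z = ham c A z)}"
    define N where "N = \<Union>{W. open W \<and> W \<subseteq> U \<and> (\<exists>B\<in>sp. B \<noteq> A \<and> (\<forall>z\<in>W. f z = ham c B z))}"
    have "open P" "open N" by (auto simp: P_def N_def)
    moreover have "P \<inter> N = {}"
    proof (rule ccontr)
      assume "P \<inter> N \<noteq> {}"
      then obtain z W W' B where "z \<in> W" "z \<in> W'" "open W" "open W'" "B \<in> sp" "B \<noteq> A"
        "\<forall>z\<in>W. f z = ham c A z" "\<forall>z\<in>W'. f z = ham c B z"
        unfolding P_def N_def by blast
      then have "A - B = 0"
        by (intro ham_eq_0_imp[OF sp_diff[OF A \<open>B \<in> sp\<close>], of "W \<inter> W'" z c]) (auto simp: ham_diff)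
      with \<open>B \<noteq> A\<close> show False by simp
    qed
    moreover have "U \<subseteq> P \<union> N"
    proof
      fix z assume "z \<in> U"
      then obtain B W where "B \<in> sp" "open W" "z \<in> W" "W \<subseteq> U" "\<forall>z\<in>W. f z = ham c B z"
        using contact_symmetry_locally_ham[OF f, of z c] by blast
      then show "z \<in> P \<union> N" unfolding P_def N_def by (cases "B = A") blast+
    qed
    moreover have "z0 \<in> P \<inter> U" using W0 z0 unfolding P_def by blast
    ultimately have "N \<inter> U = {}"
      using connectedD[OF \<open>connected U\<close>, of P N] by blast
    then have "f z = ham c A z" if "z \<in> U" for z
      using \<open>U \<subseteq> P \<union> N\<close> that unfolding P_def by blast
    moreover have "f z = 0" if "z \<notin> U" for z
      using f that unfolding contact_symmetries_iff by blast
    ultimately have "f = ham_on U c A" by (auto simp: ham_on_def restrict0_def)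
    then show "f \<in> ham_on U c ` sp" using A by blast
  qed
qed

section \<open>Isotropy of second jets\<close>

definition jet_line :: "'n::finite option \<Rightarrow> 'n jet1 \<Rightarrow> 'n spvec set" where
  "jet_line c z = vec.span {hcoord c z}"

definition jet_lagrangian :: "'n::finite option \<Rightarrow> 'n jet1 \<Rightarrow> complex^'n^'n \<Rightarrow> 'n spvec set" where
  "jet_lagrangian c z q = vec.span (insert (hcoord c z) (range (\<lambda>i. frame c q i z)))"

lemma symp_form_hcoord_frame: "symp_form (hcoord c z) (frame c q i z) = 0"
  by (cases z) (simp add: symp_form_slot[of _ _ c] sum_subtractf)

lemma symp_form_frame_frame: "symmetric2 q \<Longrightarrow> symp_form (frame c q i z) (frame c q j z) = 0"
  by (simp add: symp_form_slot[of _ _ c] sum_subtractf symmetric2_def)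

lemma symp_form_span_eq_0:
  assumes "\<And>v w. v \<in> B \<Longrightarrow> w \<in> B \<Longrightarrow> symp_form v w = 0" and v: "v \<in> vec.span B" and w: "w \<in> vec.span B"
  shows "symp_form v w = 0"
proof (rule vec.span_induct[OF v])
  show "vec.subspace {v. symp_form v w = 0}" by (simp add: vec.subspace_def)
  fix v assume "v \<in> B"
  then show "symp_form v w = 0"
    by (intro vec.span_induct[OF w, of "\<lambda>w. symp_form v w = 0"]) (auto simp: vec.subspace_def assms(1))
qed

lemma jet_lagrangian_isotropic:
  assumes "symmetric2 q" "v \<in> jet_lagrangian c z q" "w \<in> jet_lagrangian c z q"
  shows "symp_form v w = 0"
proof (rule symp_form_span_eq_0[OF _ assms(2,3)[unfolded jet_lagrangian_def]])
  fix v w assume "v \<in> insert (hcoord c z) (range (\<lambda>i. frame c q i z))"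
    "w \<in> insert (hcoord c z) (range (\<lambda>i. frame c q i z))"
  then show "symp_form v w = 0"
    using symp_form_hcoord_frame[of c z q] symp_form_frame_frame[OF assms(1), of c _ z]
      symp_form_swap[of _ "hcoord c z"] by auto
qed

lemma hcoord_in_jet_lagrangian: "hcoord c z \<in> jet_lagrangian c z q"
  and frame_in_jet_lagrangian: "frame c q i z \<in> jet_lagrangian c z q"
  unfolding jet_lagrangian_def by (rule vec.span_base; simp)+

text \<open>
  The vector \<open>w\<close> of the proof is the element of the subspace with the same \<open>Inl\<close>-coordinates as \<open>v\<close>;
  the symplectic conditions then fix the other coordinates.
\<close>

lemma jet_lagrangian_maximal:
  assumes q: "symmetric2 q" and 0: "symp_form v (hcoord c z) = 0" "\<And>i. symp_form v (frame c q i z) = 0"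
  shows "v \<in> jet_lagrangian c z q"
proof -
  define w where "w = v $ Inl c *s hcoord c z
    + (\<Sum>i\<in>UNIV. (v $ Inl (slot c i) - v $ Inl c * fst z $ i) *s frame c q i z)"
  have w: "w \<in> jet_lagrangian c z q"
    unfolding w_def jet_lagrangian_def
    by (intro vec.span_add vec.span_scale vec.span_sum vec.span_base) auto
  define d where "d = v - w"
  have d0: "symp_form d (hcoord c z) = 0" "symp_form d (frame c q i z) = 0" for i
    by (simp_all add: d_def 0 jet_lagrangian_isotropic[OF q w] hcoord_in_jet_lagrangian
        frame_in_jet_lagrangian)
  obtain x u p where z: "z = (x, u, p)" by (cases z)
  have l: "d $ Inl c = 0" "d $ Inl (slot c i) = 0" for i
    by (simp_all add: d_def w_def z sum_axis_mult' sum_subtractf)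
  have r: "d $ Inr (slot c i) = 0" for i
    using d0(2)[of i] by (simp add: symp_form_slot[of _ _ c] l sum_negf)
  have "d $ Inr c = 0"
    using d0(1) by (simp add: symp_form_slot[of _ _ c] l r)
  then have "d = 0" by (intro spvec_eqI[where c = c]) (simp_all add: l r)
  with w show ?thesis by (simp add: d_def)
qed

lemma dim_jet_line: "vec.dim (jet_line c z) = 1"
proof -
  have "hcoord c z \<noteq> 0" using hcoord_nth(1)[of c z] by (metis zero_index zero_neq_one)
  then have "vec.independent {hcoord c z}" by (simp add: vec.dependent_single)
  then show ?thesis unfolding jet_line_def by (simp add: vec.dim_span vec.dim_eq_card_independent)
qed

lemma dim_jet_lagrangian: "vec.dim (jet_lagrangian c z q) = CARD('n) + 1" for c :: "'n::finite option"
proof -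
  let ?E = "\<lambda>i. frame c q i z"
  let ?B = "insert (hcoord c z) (range ?E)"
  have inj: "inj ?E"
  proof (rule injI)
    fix i j assume "?E i = ?E j"
    then have "axis i (1::complex) $ i = axis j 1 $ i" by (metis frame_nth(2))
    then show "i = j" by (auto simp: axis_def split: if_splits)
  qed
  have notin: "hcoord c z \<notin> range ?E"
    using hcoord_nth(1)[of c z] frame_nth(1)[of c q _ z] by force
  have "vec.independent ?B"
  proof (rule vec.independent_if_scalars_zero)
    fix f v assume sum: "(\<Sum>v\<in>?B. f v *s v) = 0" and v: "v \<in> ?B"
    have s: "f (hcoord c z) *s hcoord c z + (\<Sum>i\<in>UNIV. f (?E i) *s ?E i) = 0"
      using sum notin by (simp add: sum.reindex[OF inj])
    have y: "f (hcoord c z) = 0"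
      using arg_cong[OF s, of "\<lambda>v. v $ Inl c"] by simp
    have "f (?E i) = 0" for i
      using arg_cong[OF s, of "\<lambda>v. v $ Inl (slot c i)"]
      by (simp add: y axis_def if_distrib[of "\<lambda>x. _ * x"] cong: if_cong)
    with y v show "f v = 0" by auto
  qed simp
  moreover have "card ?B = CARD('n) + 1" using notin by (simp add: card_image[OF inj])
  ultimately show ?thesis
    unfolding jet_lagrangian_def by (metis vec.dim_span vec.dim_eq_card_independent)
qed

lemma jet_flag: "symmetric2 q \<Longrightarrow> line_lagrangian_flag (jet_line c z) (jet_lagrangian c z q)"
  unfolding line_lagrangian_flag_def lagrangian_def
  by (auto simp: dim_jet_line dim_jet_lagrangian jet_lagrangian_isotropic)
     (auto simp: jet_line_def jet_lagrangian_def intro: subsetD[OF vec.span_mono, rotated])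

lemma matrix_preserves_span:
  fixes A :: "complex^'m^'m"
  assumes "\<And>b. b \<in> B \<Longrightarrow> A *v b \<in> vec.span B" "v \<in> vec.span B"
  shows "A *v v \<in> vec.span B"
  by (rule vec.span_induct[OF assms(2)])
     (auto simp: vec.subspace_def assms(1) matrix_vector_right_distrib vec.scale
       intro: vec.span_add vec.span_scale vec.span_zero)

text \<open>
  The second condition expresses that \<open>A\<close> preserves the Lagrangian subspace, which is its own
  symplectic complement; pairings with \<open>y\<close> vanish already by the first condition.
\<close>

lemma flag_stabilizer_iff:
  assumes A: "A \<in> sp" and q: "symmetric2 q"
  shows "A \<in> flag_stabilizer (jet_line c z) (jet_lagrangian c z q) \<longleftrightarrow>
    (\<exists>k. A *v hcoord c z = k *s hcoord c z) \<and> (\<forall>i j. symp_form (A *v frame c q j z) (frame c q i z)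
        = 0)"
proof
  assume "A \<in> flag_stabilizer (jet_line c z) (jet_lagrangian c z q)"
  then have l: "\<And>v. v \<in> jet_line c z \<Longrightarrow> A *v v \<in> jet_line c z"
    and L: "\<And>v. v \<in> jet_lagrangian c z q \<Longrightarrow> A *v v \<in> jet_lagrangian c z q"
    by (auto simp: flag_stabilizer_def)
  have "A *v hcoord c z \<in> vec.span {hcoord c z}"
    using l[of "hcoord c z"] by (simp add: jet_line_def vec.span_base)
  then have "\<exists>k. A *v hcoord c z = k *s hcoord c z" by (auto simp: vec.span_singleton)
  then show "(\<exists>k. A *v hcoord c z = k *s hcoord c z)
      \<and> (\<forall>i j. symp_form (A *v frame c q j z) (frame c q i z) = 0)"
    using jet_lagrangian_isotropic[OF q L[OF frame_in_jet_lagrangian] frame_in_jet_lagrangian] by blast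
next
  assume "(\<exists>k. A *v hcoord c z = k *s hcoord c z)
      \<and> (\<forall>i j. symp_form (A *v frame c q j z) (frame c q i z) = 0)"
  then obtain k where k: "A *v hcoord c z = k *s hcoord c z"
    and EE: "\<And>i j. symp_form (A *v frame c q j z) (frame c q i z) = 0" by blast
  have E: "A *v frame c q j z \<in> jet_lagrangian c z q" for j
  proof (rule jet_lagrangian_maximal[OF q _ EE])
    show "symp_form (A *v frame c q j z) (hcoord c z) = 0"
      by (subst sp_symmetric[OF A]) (simp add: k symp_form_hcoord_frame)
  qed
  have l: "A *v hcoord c z \<in> jet_line c z"
    unfolding k jet_line_def by (intro vec.span_scale vec.span_base) simp
  have Y: "A *v hcoord c z \<in> jet_lagrangian c z q"
    unfolding k by (simp add: jet_lagrangian_def vec.span_scale vec.span_base)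
  have gens: "A *v b \<in> vec.span {hcoord c z}" if "b \<in> {hcoord c z}" for b
    using that l by (simp add: jet_line_def)
  have "A *v v \<in> jet_line c z" if "v \<in> jet_line c z" for v
    using that unfolding jet_line_def by (rule matrix_preserves_span[rotated]) (rule gens)
  moreover have "A *v v \<in> jet_lagrangian c z q" if "v \<in> jet_lagrangian c z q" for v
    using that unfolding jet_lagrangian_def
    by (rule matrix_preserves_span[rotated])
       (use E Y in \<open>auto simp: jet_lagrangian_def\<close>)
  ultimately show "A \<in> flag_stabilizer (jet_line c z) (jet_lagrangian c z q)"
    using A by (simp add: flag_stabilizer_def)
qed

text \<open>
  Vanishing of the components along \<open>x\<close>, \<open>u\<close>, \<open>p\<close> means that \<open>A y\<close> is a multiple of \<open>y\<close>; the components
  along \<open>u\<^sub>i\<^sub>j\<close> are \<open>\<omega>(A E\<^sub>j, E\<^sub>i)\<close>.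
\<close>

lemma prolong2_ham_on_eq_0_iff:
  assumes A: "A \<in> sp" and U: "open U" "(x, u, p) \<in> U" and q: "symmetric2 q"
  shows "prolong2 (ham_on U c A) (x, u, p, q) = 0 \<longleftrightarrow>
    A \<in> flag_stabilizer (jet_line c (x, u, p)) (jet_lagrangian c (x, u, p) q)"
proof -
  let ?z = "(x, u, p)"
  let ?y = "hcoord c ?z"
  let ?a = "A *v ?y"
  have "dir_deriv w (ham_on U c A) ?z = dir_deriv w (ham c A) ?z" for w
    using U ham_on_eq by (rule dir_deriv_cong)
  then have d: "d_p i (ham_on U c A) ?z = ?a $ Inl (slot c i) - x $ i * ?a $ Inl c"
    "ddx i (ham_on U c A) ?z = p $ i * ?a $ Inl c - ?a $ Inr (slot c i)" for i
    using d_ham(2,3)[OF A, of i c ?z] by (simp_all add: ddx_eq d_p_eq_dir_deriv)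
  have "(ham_on U c A ?z = 0 \<and> (\<forall>i. d_p i (ham_on U c A) ?z = 0) \<and> (\<forall>i. ddx i (ham_on U c A) ?z = 0)) \<longleftrightarrow>
      (\<exists>k. ?a = k *s ?y)" (is "?L \<longleftrightarrow> ?R")
  proof
    assume L: ?L
    have l: "?a $ Inl (slot c i) = x $ i * ?a $ Inl c" and r: "?a $ Inr (slot c i)
        = p $ i * ?a $ Inl c" for i
      using L d by simp_all
    have "0 = symp_form ?a ?y" using L by (simp add: ham_on_eq[OF U(2)] ham_def)
    also have "\<dots> = ?a $ Inl c * ?y $ Inr c - ?a $ Inr c"
      unfolding symp_form_slot[of _ _ c] by (simp add: l r)
    finally have "?a = ?a $ Inl c *s ?y"
      by (intro spvec_eqI[where c = c]) (simp_all add: l r)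
    then show ?R by blast
  next
    assume ?R
    then obtain k where k: "?a = k *s ?y" by blast
    show ?L unfolding d by (simp add: ham_on_eq[OF U(2)] ham_def k)
  qed
  then show ?thesis
    unfolding prolong2_eq_0_iff[OF holomorphic_fun_ham_on[OF A U(1)] U(2)] flag_stabilizer_iff[OF A q]
      total_deriv_total_deriv_ham_on[OF A U q]
    by blast
qed

lemma isotropy_eq:
  assumes U: "open U" "connected U" "(x, u, p) \<in> U" and q: "symmetric2 q"
  shows "isotropy U (x, u, p, q)
      = ham_on U c ` flag_stabilizer (jet_line c (x, u, p)) (jet_lagrangian c (x, u, p) q)"
proof -
  have "flag_stabilizer (jet_line c (x, u, p)) (jet_lagrangian c (x, u, p) q) \<subseteq> sp"
    by (auto simp: flag_stabilizer_def)
  moreover have ne: "U \<noteq> {}" using U(3) by blast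
  ultimately show ?thesis
    using prolong2_ham_on_eq_0_iff[OF _ U(1,3) q, of _ c] U(3)
    unfolding isotropy_def contact_symmetries_eq[OF U(1,2) ne, of c] by blast
qed

lemma hcoord_0: "hcoord c 0 = axis (Inl c) 1"
  by (rule spvec_eqI[where c = c]) (simp_all add: zero_prod_def, simp_all add: axis_def)

lemma frame_0: "frame c 0 i 0 = axis (Inl (slot c i)) 1"
  by (rule spvec_eqI[where c = c]) (simp_all add: zero_prod_def, simp_all add: axis_def)

lemma jet_flag_0:
  fixes e :: "nat \<Rightarrow> 'n::finite option"
  shows "jet_line (e 1) 0 = std_line e" and "jet_lagrangian c 0 0 = (std_lagrangian :: 'n spvec set)"
proof -
  show "jet_line (e 1) 0 = std_line e" by (simp add: jet_line_def std_line_def hcoord_0)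
  have "insert (axis (Inl c) 1 :: 'n spvec) (range (\<lambda>i. axis (Inl (slot c i)) 1))
      = range (\<lambda>a. axis (Inl a) 1)"
  proof -
    have "a \<in> insert c (range (slot c))" for a
      by (cases a rule: slot_cases[where c = c]) simp_all
    then have UNIV_eq: "UNIV = insert c (range (slot c))" by blast
    show ?thesis by (subst UNIV_eq) (simp add: image_image)
  qed
  then show "jet_lagrangian c 0 0 = (std_lagrangian :: 'n spvec set)"
    by (simp add: jet_lagrangian_def std_lagrangian_def hcoord_0 frame_0)
qed

section \<open>The grading\<close>

text \<open>
  Twice the eigenvalue of the grading element on a basis vector: the crosses at nodes \<open>1\<close> and \<open>n + 1\<close>
  give \<open>\<epsilon>\<^sub>1\<close> the value \<open>3/2\<close> and all other \<open>\<epsilon>\<^sub>k\<close> the value \<open>1/2\<close>.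
\<close>

definition weight :: "'n option \<Rightarrow> 'n option + 'n option \<Rightarrow> int" where
  "weight c k = (case k of Inl a \<Rightarrow> if a = c then 3 else 1 | Inr a \<Rightarrow> if a = c then - 3 else - 1)"

lemma weight_simps [simp]: "weight c (Inl c) = 3" "weight c (Inl (slot c i)) = 1" "weight c (Inr a)
    = - weight c (Inl a)"
  by (simp_all add: weight_def)

definition sp_degrees :: "'n::finite option \<Rightarrow> int set \<Rightarrow> 'n spmat set" where
  "sp_degrees c K = {A \<in> sp. \<forall>a b. A $ a $ b \<noteq> 0 \<longrightarrow> (\<exists>k\<in>K. weight c a - weight c b = 2 * k)}"

lemma map_matrix_mult_vector: "map_matrix ((*) k) A *v v = k *s (A *v v)" for A :: "complex^'n^'m"
  by (simp add: vec_eq_iff matrix_vector_mult_def map_matrix_def sum_distrib_left mult_ac)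

lemma map_matrix_nth: "map_matrix f A $ i $ j = f (A $ i $ j)"
  by (simp add: map_matrix_def)

lemma sp_add: "A \<in> sp \<Longrightarrow> B \<in> sp \<Longrightarrow> A + B \<in> sp"
  by (rule spI) (simp add: matrix_vector_mult_add_rdistrib sp_symmetric[of _ _ _])

lemma sp_scale: "A \<in> sp \<Longrightarrow> map_matrix ((*) k) A \<in> sp"
  by (rule spI) (simp add: map_matrix_mult_vector sp_symmetric[of _ _ _])

lemma sp_commutator:
  assumes "A \<in> sp" "B \<in> sp"
  shows "commutator A B \<in> sp"
proof (rule spI)
  fix v w
  have c: "commutator A B *v v = A *v (B *v v) - B *v (A *v v)" for v
    by (simp add: commutator_def matrix_vector_mult_diff_rdistrib matrix_vector_mul_assoc)
  have "symp_form (A *v (B *v v)) w = - symp_form (B *v v) (A *v w)" if "A \<in> sp" for A B and v w ::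
      "'a spvec"
    using sp_symmetric[OF that, of "B *v v" w] symp_form_swap[of "A *v w" "B *v v"] by simp
  note m = this
  have "symp_form (commutator A B *v v) w = symp_form (A *v v) (B *v w) - symp_form (B *v v) (A *v w)"
    by (simp add: c m[OF assms(1)] m[OF assms(2)])
  also have "\<dots> = symp_form (commutator A B *v w) v"
    using symp_form_swap[of "A *v v" "B *v w"] symp_form_swap[of "B *v v" "A *v w"]
    by (simp add: c m[OF assms(1)] m[OF assms(2)])
  finally show "symp_form (commutator A B *v v) w = symp_form (commutator A B *v w) v" .
qed

lemma zero_in_sp: "0 \<in> sp"
  by (simp add: sp_def)

lemma sp_degrees_closed:
  shows "0 \<in> sp_degrees c K" "A \<in> sp_degrees c K \<Longrightarrow> B \<in> sp_degrees c K \<Longrightarrow> A + B \<in> sp_degrees c K"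
    "A \<in> sp_degrees c K \<Longrightarrow> map_matrix ((*) k) A \<in> sp_degrees c K"
proof -
  show "A + B \<in> sp_degrees c K" if "A \<in> sp_degrees c K" "B \<in> sp_degrees c K"
  proof -
    have "A $ a $ b \<noteq> 0 \<or> B $ a $ b \<noteq> 0" if "(A + B) $ a $ b \<noteq> 0" for a b using that by auto
    then show ?thesis using that sp_add unfolding sp_degrees_def by blast
  qed
qed (auto simp: sp_degrees_def zero_in_sp sp_scale map_matrix_nth)

lemma sp_degrees_mono: "K \<subseteq> K' \<Longrightarrow> sp_degrees c K \<subseteq> sp_degrees c K'"
  unfolding sp_degrees_def by blast

lemma sp_degrees_all: "sp_degrees c {-3..3} = sp"
proof -
  have "\<exists>k\<in>{-3..3}. weight c a - weight c b = 2 * k" for a b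
    by (rule bexI[of _ "(weight c a - weight c b) div 2"]) (auto simp: weight_def split: sum.split)
  then show ?thesis unfolding sp_degrees_def by blast
qed

lemma ham_add: "ham c (A + B) z = ham c A z + ham c B z"
  by (simp add: ham_def matrix_vector_mult_add_rdistrib add_divide_distrib)

lemma ham_scale: "ham c (map_matrix ((*) k) A) z = k * ham c A z"
  by (simp add: ham_def map_matrix_mult_vector)

lemma ham_zero: "ham c 0 z = 0"
  by (simp add: ham_def)

definition ham_degrees :: "'n::finite option \<Rightarrow> int set \<Rightarrow> ('n jet1 \<Rightarrow> complex) set" where
  "ham_degrees c K = ham c ` sp_degrees c K"

lemma ham_degrees_add: "f \<in> ham_degrees c K \<Longrightarrow> g \<in> ham_degrees c K \<Longrightarrow> (\<lambda>z. f z + g z) \<in> ham_degrees c K"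
proof -
  assume "f \<in> ham_degrees c K" "g \<in> ham_degrees c K"
  then obtain A B where AB: "A \<in> sp_degrees c K" "B \<in> sp_degrees c K" "f = ham c A" "g = ham c B"
    by (auto simp: ham_degrees_def)
  then show "(\<lambda>z. f z + g z) \<in> ham_degrees c K"
    unfolding ham_degrees_def
    by (intro image_eqI[of _ _ "A + B"]) (simp_all add: fun_eq_iff ham_add sp_degrees_closed(2))
qed

lemma ham_degrees_scale: "f \<in> ham_degrees c K \<Longrightarrow> (\<lambda>z. k * f z) \<in> ham_degrees c K"
proof -
  assume "f \<in> ham_degrees c K"
  then obtain A where A: "A \<in> sp_degrees c K" "f = ham c A" by (auto simp: ham_degrees_def)
  then show "(\<lambda>z. k * f z) \<in> ham_degrees c K"
    unfolding ham_degrees_def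
    by (intro image_eqI[of _ _ "map_matrix ((*) k) A"])
        (simp_all add: fun_eq_iff ham_scale sp_degrees_closed(3))
qed

lemma ham_degrees_zero: "(\<lambda>z. 0) \<in> ham_degrees c K"
  unfolding ham_degrees_def by (rule image_eqI[of _ _ 0])
      (simp_all add: fun_eq_iff ham_zero sp_degrees_closed)

lemma ham_degrees_sum:
  "finite I \<Longrightarrow> (\<And>i. i \<in> I \<Longrightarrow> f i \<in> ham_degrees c K) \<Longrightarrow> (\<lambda>z. \<Sum>i\<in>I. f i z) \<in> ham_degrees c K"
  by (induction I rule: finite_induct) (simp_all add: ham_degrees_zero ham_degrees_add)

lemma ham_degrees_mono: "K \<subseteq> K' \<Longrightarrow> ham_degrees c K \<subseteq> ham_degrees c K'"
  unfolding ham_degrees_def by (intro image_mono sp_degrees_mono)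

definition quad_mon :: "'n::finite option \<Rightarrow> 'n option + 'n option \<Rightarrow> 'n option
    + 'n option \<Rightarrow> 'n jet1 \<Rightarrow> complex" where
  "quad_mon c a b = (\<lambda>z. hcoord c z $ a * hcoord c z $ b)"

text \<open>
  The coordinate functions have the weights of the dual basis, hence the sign.
\<close>

lemma quad_mon_in_ham_degrees:
  assumes "weight c a + weight c b = - 2 * k"
  shows "quad_mon c a b \<in> ham_degrees c {k}"
proof -
  define S where "S = (\<lambda>v w :: 'a spvec. v $ a * w $ b + w $ a * v $ b)"
  interpret symmetric_form S
    by unfold_locales (simp_all add: S_def algebra_simps)
  have S_axis: "S (axis l 1) (axis m 1) \<noteq> 0 \<Longrightarrow> (l = a \<and> m = b) \<or> (l = b \<and> m = a)" for l m
    by (auto simp: S_def axis_def split: if_splits)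
  have "weight c k' - weight c l = 2 * k" if "spmat_of_form S $ k' $ l \<noteq> 0" for k' l
  proof (cases k')
    case (Inl i)
    then have "S (axis l 1) (axis (Inr i) 1) \<noteq> 0" using that by (simp add: spmat_of_form_def)
    from S_axis[OF this] show ?thesis using assms Inl by auto
  next
    case (Inr i)
    then have "S (axis l 1) (axis (Inl i) 1) \<noteq> 0" using that by (simp add: spmat_of_form_def)
    from S_axis[OF this] show ?thesis using assms Inr by auto
  qed
  then have "spmat_of_form S \<in> sp_degrees c {k}"
    by (simp add: sp_degrees_def spmat_of_form_in_sp)
  moreover have "quad_mon c a b = ham c (spmat_of_form S)"
    unfolding fun_eq_iff ham_def symp_form_spmat_of_form by (simp add: quad_mon_def S_def)
  ultimately show ?thesis by (auto simp: ham_degrees_def)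
qed

lemma quad_mon_eq:
  "quad_mon c (Inl c) (Inl c) = (\<lambda>(x, u, p). 1)"
  "quad_mon c (Inl c) (Inl (slot c i)) = (\<lambda>(x, u, p). x $ i)"
  "quad_mon c (Inl c) (Inr (slot c i)) = (\<lambda>(x, u, p). p $ i)"
  "quad_mon c (Inl (slot c i)) (Inl (slot c j)) = (\<lambda>(x, u, p). x $ i * x $ j)"
  "quad_mon c (Inl (slot c i)) (Inr (slot c j)) = (\<lambda>(x, u, p). x $ i * p $ j)"
  "quad_mon c (Inr (slot c i)) (Inr (slot c j)) = (\<lambda>(x, u, p). p $ i * p $ j)"
  "quad_mon c (Inl c) (Inr c) = (\<lambda>z. - 1 * wgen z)"
  "quad_mon c (Inl (slot c i)) (Inr c) = (\<lambda>z. - 1 * (\<lambda>(x, u, p). x $ i * wgen (x, u, p)) z)"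
  "quad_mon c (Inr (slot c i)) (Inr c) = (\<lambda>z. - 1 * (\<lambda>(x, u, p). p $ i * wgen (x, u, p)) z)"
  "quad_mon c (Inr c) (Inr c) = (\<lambda>(x, u, p). (wgen (x, u, p))\<^sup>2)"
  by (auto simp: fun_eq_iff quad_mon_def wgen_def power2_eq_square algebra_simps)

lemma generators_subset_ham_degrees:
  fixes c :: "'n::finite option"
  shows "generators k \<subseteq> ham_degrees c {k}"
proof
  fix g :: "'n jet1 \<Rightarrow> complex" assume g: "g \<in> generators k"
  let ?h = "ham_degrees c {k}"
  have neg: "(\<lambda>z. - 1 * f z) \<in> ?h \<Longrightarrow> f \<in> ?h" for f
    using ham_degrees_scale[of "\<lambda>z. - 1 * f z" c "{k}" "- 1"] by simp
  have u: "(\<lambda>(x, u, p). u) \<in> ?h" if "k = 0"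
  proof -
    have "quad_mon c (Inl c) (Inr c) \<in> ?h" "quad_mon c (Inl (slot c i)) (Inr (slot c i)) \<in> ?h" for i
      by (rule quad_mon_in_ham_degrees; simp add: that)+
    then have "(\<lambda>z. (1 / 2) * (quad_mon c (Inl c) (Inr c) z
        + (\<Sum>i\<in>UNIV. quad_mon c (Inl (slot c i)) (Inr (slot c i)) z))) \<in> ?h"
      by (intro ham_degrees_scale ham_degrees_add ham_degrees_sum finite)
    also have "(\<lambda>z. (1 / 2) * (quad_mon c (Inl c) (Inr c) z
        + (\<Sum>i\<in>UNIV. quad_mon c (Inl (slot c i)) (Inr (slot c i)) z))) = (\<lambda>(x, u, p). u)"
      by (simp add: fun_eq_iff quad_mon_def)
    finally show ?thesis .
  qed
  consider "k = -3" | "k = -2" | "k = -1" | "k = 0" | "k = 1" | "k = 2" | "k = 3"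
    using g by (auto simp: generators_def split: if_splits)
  then show "g \<in> ?h"
  proof cases
    case 1
    then have "g = quad_mon c (Inl c) (Inl c)" using g by (simp add: generators_def quad_mon_eq)
    then show ?thesis using 1 by (simp add: quad_mon_in_ham_degrees)
  next
    case 2
    then obtain i where "g = quad_mon c (Inl c) (Inl (slot c i))" using g by
        (auto simp: generators_def quad_mon_eq)
    then show ?thesis using 2 by (simp add: quad_mon_in_ham_degrees)
  next
    case 3
    then consider i where "g = quad_mon c (Inl c) (Inr (slot c i))"
      | i j where "g = quad_mon c (Inl (slot c i)) (Inl (slot c j))"
      using g by (auto simp: generators_def quad_mon_eq)
    then show ?thesis using 3 by cases (simp_all add: quad_mon_in_ham_degrees)
  next
    case 4
    then consider "g = (\<lambda>(x, u, p). u)" | i j where "g = quad_mon c (Inl (slot c i)) (Inr (slot c j))"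
      using g by (auto simp: generators_def quad_mon_eq)
    then show ?thesis using 4 u by cases (simp_all add: quad_mon_in_ham_degrees)
  next
    case 5
    then consider i where "(\<lambda>z. - 1 * g z) = quad_mon c (Inl (slot c i)) (Inr c)"
      | i j where "g = quad_mon c (Inr (slot c i)) (Inr (slot c j))"
      using g unfolding quad_mon_eq by (auto simp: generators_def)
    then show ?thesis
    proof cases
      case (1 i)
      have "quad_mon c (Inl (slot c i)) (Inr c) \<in> ?h"
        by (rule quad_mon_in_ham_degrees) (use 5 in simp)
      then have "(\<lambda>z. - 1 * g z) \<in> ?h" by (simp only: 1)
      then show ?thesis by (rule neg)
    qed (use 5 in \<open>simp add: quad_mon_in_ham_degrees\<close>)
  next
    case 6
    then obtain i where i: "(\<lambda>z. - 1 * g z) = quad_mon c (Inr (slot c i)) (Inr c)"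
      using g unfolding quad_mon_eq by (auto simp: generators_def)
    have "quad_mon c (Inr (slot c i)) (Inr c) \<in> ?h"
      by (rule quad_mon_in_ham_degrees) (use 6 in simp)
    then have "(\<lambda>z. - 1 * g z) \<in> ?h" by (simp only: i)
    then show ?thesis by (rule neg)
  next
    case 7
    then have "g = quad_mon c (Inr c) (Inr c)" using g by (simp add: generators_def quad_mon_eq)
    then show ?thesis using 7 by (simp add: quad_mon_in_ham_degrees)
  qed
qed

definition fun_span :: "('a \<Rightarrow> complex) set \<Rightarrow> ('a \<Rightarrow> complex) set" where
  "fun_span G = {\<lambda>z. \<Sum>g\<in>T. a g * g z | T a. finite T \<and> T \<subseteq> G}"

lemma gen_span_eq: "gen_span U G = restrict0 U ` fun_span G"
  unfolding gen_span_def fun_span_def by blast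

lemma fun_span_base: "g \<in> G \<Longrightarrow> g \<in> fun_span G"
  unfolding fun_span_def by (rule CollectI, rule exI[of _ "{g}"], rule exI[of _ "\<lambda>_. 1"]) simp

lemma fun_span_zero: "(\<lambda>z. 0) \<in> fun_span G"
  unfolding fun_span_def by (rule CollectI, rule exI[of _ "{}"]) simp

lemma fun_span_scale:
  assumes "f \<in> fun_span G"
  shows "(\<lambda>z. k * f z) \<in> fun_span G"
proof -
  obtain T a where "finite T" "T \<subseteq> G" "f = (\<lambda>z. \<Sum>g\<in>T. a g * g z)"
    using assms unfolding fun_span_def by blast
  then show ?thesis unfolding fun_span_def
    by (intro CollectI exI[of _ T] exI[of _ "\<lambda>g. k * a g"]) (simp add: sum_distrib_left mult.assoc)
qed

lemma fun_span_add:
  assumes "f \<in> fun_span G" "f' \<in> fun_span G"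
  shows "(\<lambda>z. f z + f' z) \<in> fun_span G"
proof -
  obtain T a where T: "finite T" "T \<subseteq> G" "f = (\<lambda>z. \<Sum>g\<in>T. a g * g z)"
    using assms(1) unfolding fun_span_def by blast
  obtain T' a' where T': "finite T'" "T' \<subseteq> G" "f' = (\<lambda>z. \<Sum>g\<in>T'. a' g * g z)"
    using assms(2) unfolding fun_span_def by blast
  let ?b = "\<lambda>g. (if g \<in> T then a g else 0) + (if g \<in> T' then a' g else 0)"
  have "f z + f' z = (\<Sum>g\<in>T \<union> T'. ?b g * g z)" for z
  proof -
    have "(\<Sum>g\<in>T. a g * g z) = (\<Sum>g\<in>T \<union> T'. (if g \<in> T then a g else 0) * g z)"
      by (rule sum.mono_neutral_cong_left) (use T(1) T'(1) in auto)
    moreover have "(\<Sum>g\<in>T'. a' g * g z) = (\<Sum>g\<in>T \<union> T'. (if g \<in> T' then a' g else 0) * g z)"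
      by (rule sum.mono_neutral_cong_left) (use T(1) T'(1) in auto)
    ultimately show ?thesis by (simp add: T(3) T'(3) distrib_right sum.distrib)
  qed
  then show ?thesis unfolding fun_span_def
    using T(1,2) T'(1,2) by (intro CollectI exI[of _ "T \<union> T'"] exI[of _ ?b]) auto
qed

lemma fun_span_sum: "finite I \<Longrightarrow> (\<And>i. i \<in> I \<Longrightarrow> f i \<in> fun_span G) \<Longrightarrow> (\<lambda>z. \<Sum>i\<in>I. f i z) \<in> fun_span G"
  by (induction I rule: finite_induct) (simp_all add: fun_span_zero fun_span_add)

lemma fun_span_mono: "G \<subseteq> G' \<Longrightarrow> fun_span G \<subseteq> fun_span G'"
  unfolding fun_span_def by blast

lemma quad_mon_in_fun_span:
  assumes "weight c a + weight c b = - 2 * k"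
  shows "quad_mon c a b \<in> fun_span (generators k)"
proof -
  have sym: "quad_mon c a b = quad_mon c b a" for a b by (simp add: quad_mon_def mult.commute)
  have 1: "quad_mon c (Inl c) (Inl c) \<in> fun_span (generators (-3))"
    and 2: "quad_mon c (Inl c) (Inl (slot c i)) \<in> fun_span (generators (-2))"
    and 3: "quad_mon c (Inl c) (Inr (slot c i)) \<in> fun_span (generators (-1))"
    and 4: "quad_mon c (Inl (slot c i)) (Inl (slot c j)) \<in> fun_span (generators (-1))"
    and 5: "quad_mon c (Inl (slot c i)) (Inr (slot c j)) \<in> fun_span (generators 0)"
    and 6: "quad_mon c (Inr (slot c i)) (Inr (slot c j)) \<in> fun_span (generators 1)"
    and 7: "quad_mon c (Inr c) (Inr c) \<in> fun_span (generators 3)" for i j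
    unfolding quad_mon_eq by (rule fun_span_base; auto simp: generators_def)+
  have 8: "quad_mon c (Inl (slot c i)) (Inr c) \<in> fun_span (generators 1)"
    and 9: "quad_mon c (Inr (slot c i)) (Inr c) \<in> fun_span (generators 2)" for i
    unfolding quad_mon_eq by (rule fun_span_scale, rule fun_span_base; auto simp: generators_def)+
  have "(\<lambda>(x, u, p). u) \<in> fun_span (generators 0)"
    by (rule fun_span_base) (simp add: generators_def)
  then have "(\<lambda>z. 2 * (\<lambda>(x, u, p). u) z
      + (\<Sum>i\<in>UNIV. - 1 * quad_mon c (Inl (slot c i)) (Inr (slot c i)) z)) \<in> fun_span (generators 0)"
    by (intro fun_span_add fun_span_scale fun_span_sum finite 5)
  also have "(\<lambda>z. 2 * (\<lambda>(x, u, p). u) z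
      + (\<Sum>i\<in>UNIV. - 1 * quad_mon c (Inl (slot c i)) (Inr (slot c i)) z)) = quad_mon c (Inl c) (Inr c)"
    by (simp add: fun_eq_iff quad_mon_def sum_negf)
  finally have 10: "quad_mon c (Inl c) (Inr c) \<in> fun_span (generators 0)" .
  define P where "P = (\<lambda>a b. \<exists>k. weight c a + weight c b = - 2 * k \<and> quad_mon c a b
      \<in> fun_span (generators k))"
  have swap: "P a b \<Longrightarrow> P b a" for a b
    by (simp add: P_def sym[of a b] add.commute[of "weight c a"])
  have Ps: "P (Inl c) (Inl c)" "P (Inl c) (Inl (slot c i))" "P (Inl c) (Inr (slot c i))"
    "P (Inl (slot c i)) (Inl (slot c j))" "P (Inl (slot c i)) (Inr (slot c j))"
    "P (Inr (slot c i)) (Inr (slot c j))" "P (Inr c) (Inr c)" "P (Inl (slot c i)) (Inr c)"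
    "P (Inr (slot c i)) (Inr c)" "P (Inl c) (Inr c)" for i j
    unfolding P_def
    using 1 2[of i] 3[of i] 4[of i j] 5[of i j] 6[of i j] 7 8[of i] 9[of i] 10
    by - (rule exI, rule conjI[rotated], assumption, simp)+
  have "P a b"
    by (cases a rule: slot_index_cases[where c = c]; cases b rule: slot_index_cases[where c = c])
       (simp_all only: Ps swap[OF Ps(2)] swap[OF Ps(3)] swap[OF Ps(5)] swap[OF Ps(8)]
          swap[OF Ps(9)] swap[OF Ps(10)])
  then show ?thesis using assms by (auto simp: P_def)
qed

lemma ham_in_fun_span:
  assumes "A \<in> sp_degrees c K"
  shows "ham c A \<in> fun_span (\<Union>k\<in>K. generators k)"
proof -
  let ?G = "\<Union>k\<in>K. generators k"
  have summand: "(\<lambda>z. (A $ a $ b * r) * quad_mon c b b' z) \<in> fun_span ?G" if "weight c b'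
      = - weight c a" for a b b' r
  proof (cases "A $ a $ b = 0")
    case True
    then show ?thesis by (simp add: fun_span_zero)
  next
    case False
    then obtain k where k: "k \<in> K" "weight c a - weight c b = 2 * k"
      using assms unfolding sp_degrees_def by blast
    then have "quad_mon c b b' \<in> fun_span (generators k)"
      by (intro quad_mon_in_fun_span) (simp add: that)
    then have "quad_mon c b b' \<in> fun_span ?G"
      using fun_span_mono[of "generators k" ?G] k(1) by blast
    then show ?thesis by (rule fun_span_scale)
  qed
  have "ham c A = (\<lambda>z. \<Sum>i\<in>UNIV. \<Sum>b\<in>UNIV. (A $ Inl i $ b * (1 / 2)) * quad_mon c b (Inr i) z
      + (A $ Inr i $ b * (- 1 / 2)) * quad_mon c b (Inl i) z)"
    by (simp add: fun_eq_iff ham_def symp_form_def matrix_vector_mult_def quad_mon_def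
        sum_divide_distrib
        sum_distrib_left sum_distrib_right sum_subtractf sum.distrib sum_negf diff_divide_distrib
            mult_ac)
  also have "\<dots> \<in> fun_span ?G"
    by (intro fun_span_sum finite fun_span_add summand) simp_all
  finally show ?thesis .
qed

lemma gen_span_eq_ham_on: "gen_span U (\<Union>k\<in>K. generators k) = ham_on U c ` sp_degrees c K"
proof -
  have "fun_span (\<Union>k\<in>K. generators k) = ham_degrees c K"
  proof
    show "ham_degrees c K \<subseteq> fun_span (\<Union>k\<in>K. generators k)"
      using ham_in_fun_span unfolding ham_degrees_def by blast
    have "generators k \<subseteq> ham_degrees c K" if "k \<in> K" for k
      using generators_subset_ham_degrees[of k c] ham_degrees_mono[of "{k}" K c] that by blast
    then have "T \<subseteq> ham_degrees c K" if "T \<subseteq> (\<Union>k\<in>K. generators k)" for T using that by blast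
    then show "fun_span (\<Union>k\<in>K. generators k) \<subseteq> ham_degrees c K"
      unfolding fun_span_def by (auto intro!: ham_degrees_sum ham_degrees_scale)
  qed
  then show ?thesis
    unfolding gen_span_eq ham_degrees_def by (simp add: image_image ham_on_def)
qed

lemma commutator_cartan:
  "commutator (cartan h) A $ a $ b =
    ((case a of Inl i \<Rightarrow> h i | Inr i \<Rightarrow> - h i) - (case b of Inl i \<Rightarrow> h i | Inr i \<Rightarrow> - h i)) * A $ a $ b"
proof -
  have d: "(if x = y then z else 0) * w = (if x = y then z * w else 0)"
    "w * (if x = y then z else 0) = (if x = y then w * z else 0)" for x y :: "'a option + 'a option"
        and z w :: complex
    by simp_all
  show ?thesis
    by (simp add: commutator_def cartan_def matrix_matrix_mult_def d algebra_simps)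
qed

text \<open>
  The simple roots are a basis, so the grading element \<open>h0\<close> is unique, and its adjoint action
  multiplies each matrix entry by a difference of weights.
\<close>

lemma sp_grading_eq:
  fixes e :: "nat \<Rightarrow> 'n::finite option"
  assumes e: "bij_betw e {1..CARD('n) + 1} UNIV"
  shows "sp_grading e {1, CARD('n) + 1} k = sp_degrees (e 1) {k}"
proof -
  let ?n = "CARD('n)"
  have n: "?n \<ge> 1" by (simp add: Suc_le_eq)
  define h0 :: "'n option \<Rightarrow> complex" where "h0 = (\<lambda>a. if a = e 1 then 3 / 2 else 1 / 2)"
  let ?root = "\<lambda>h. \<forall>k\<in>{1..?n + 1}. simple_root e k h = (if k \<in> {1, ?n + 1} then 1 else 0)"
  have e1: "e j \<noteq> e 1" if "2 \<le> j" "j \<le> ?n + 1" for j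
    using bij_betw_imp_inj_on[OF e] that by (auto dest: inj_onD)
  have h0: "?root h0"
    using n e1 by (auto simp: simple_root_def h0_def)
  have unique: "h = h0" if h: "?root h" for h
  proof
    fix a
    have last: "h (e (?n + 1)) = 1 / 2"
      using h[rule_format, of "?n + 1"] by (simp add: simple_root_def field_simps)
    have half: "h (e j) = 1 / 2" if "2 \<le> j" "j \<le> ?n + 1" for j
      using that(2,1)
    proof (induction j rule: inc_induct)
      case base show ?case by (rule last)
    next
      case (step j)
      then show ?case using h[rule_format, of j] by (simp add: simple_root_def)
    qed
    have first: "h (e 1) = 3 / 2"
    proof -
      have "h (e 1) - h (e 2) = 1"
        using h[rule_format, of 1] n by (simp add: simple_root_def numeral_2_eq_2)
      then have "h (e 1) = 1 + h (e 2)" by (simp only: diff_eq_eq)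
      then show ?thesis using half[of 2] n by simp
    qed
    obtain j where j: "1 \<le> j" "j \<le> ?n + 1" "a = e j"
    proof -
      have "a \<in> e ` {1..?n + 1}" using e by (simp only: bij_betw_def UNIV_I)
      then show ?thesis using that by auto
    qed
    show "h a = h0 a"
    proof (cases "j = 1")
      case True then show ?thesis using first j by (simp add: h0_def)
    next
      case False
      then show ?thesis using j half[of j] e1[of j] by (simp add: h0_def)
    qed
  qed
  have weight: "(case a of Inl i \<Rightarrow> h0 i | Inr i \<Rightarrow> - h0 i) = of_int (weight (e 1) a) / 2" for a
    by (simp add: h0_def weight_def split: sum.split)
  have "commutator (cartan h0) A = map_matrix ((*) (of_int k)) A \<longleftrightarrow>
      (\<forall>a b. A $ a $ b \<noteq> 0 \<longrightarrow> weight (e 1) a - weight (e 1) b = 2 * k)" for A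
  proof -
    have "commutator (cartan h0) A $ a $ b = map_matrix ((*) (of_int k)) A $ a $ b \<longleftrightarrow>
        (A $ a $ b \<noteq> 0 \<longrightarrow> weight (e 1) a - weight (e 1) b = 2 * k)" for a b
    proof -
      have "commutator (cartan h0) A $ a $ b = of_int (weight (e 1) a - weight (e 1) b) / 2 * A $ a $ b"
        by (simp add: commutator_cartan weight diff_divide_distrib)
      moreover have "of_int (weight (e 1) a - weight (e 1) b) / 2 = (of_int k :: complex)
          \<longleftrightarrow> weight (e 1) a - weight (e 1) b = 2 * k"
      proof -
        have "of_int (weight (e 1) a - weight (e 1) b) / 2 = (of_int k :: complex)
            \<longleftrightarrow> of_int (weight (e 1) a - weight (e 1) b) = (of_int (2 * k) :: complex)"
          by (simp add: field_simps)
        then show ?thesis by (simp only: of_int_eq_iff)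
      qed
      ultimately show ?thesis by (auto simp: map_matrix_def)
    qed
    then show ?thesis by (simp add: vec_eq_iff)
  qed
  then have degrees: "sp_degrees (e 1) {k} = {A \<in> sp. commutator (cartan h0) A
      = map_matrix ((*) (of_int k)) A}"
    by (simp add: sp_degrees_def)
  define R where "R = (\<lambda>h. ?root h)"
  have "R h0" unfolding R_def by (rule h0)
  moreover have "h = h0" if "R h" for h using that unfolding R_def by (rule unique)
  ultimately have "(\<exists>h. R h \<and> Q h) \<longleftrightarrow> Q h0" for Q by blast
  moreover have "sp_grading e {1, ?n + 1} k =
      {A \<in> sp. \<exists>h. R h \<and> commutator (cartan h) A = map_matrix ((*) (of_int k)) A}"
    by (simp only: sp_grading_def R_def)
  ultimately show ?thesis by (simp only: degrees)
qed

text \<open>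
  At the origin \<open>y\<close> and the \<open>E\<^sub>i\<close> are the basis vectors of positive weight.  The conditions of
  \<open>flag_stabilizer_iff\<close> concern entries in their columns; the remaining entries of negative degree lie
  in the row \<open>Inr (e 1)\<close> and vanish then by the symmetry of symplectic matrices.
\<close>

lemma flag_stabilizer_std:
  fixes e :: "nat \<Rightarrow> 'n::finite option"
  shows "flag_stabilizer (std_line e) std_lagrangian = sp_degrees (e 1) {0..3}"
proof -
  let ?c = "e 1"
  have nth: "(A *v axis l 1) $ k = A $ k $ l" for A :: "'n spmat" and k l
    by (simp add: matrix_vector_mult_def)
  have "A \<in> flag_stabilizer (std_line e) std_lagrangian \<longleftrightarrow> A \<in> sp_degrees ?c {0..3}" if A: "A \<in> sp" for A
  proof -
    have "A \<in> flag_stabilizer (std_line e) std_lagrangian \<longleftrightarrow>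
      (\<exists>k. A *v axis (Inl ?c) 1 = k *s axis (Inl ?c) 1)
          \<and> (\<forall>i j. A $ Inr (slot ?c i) $ Inl (slot ?c j) = 0)"
      using flag_stabilizer_iff[OF A, of 0 ?c 0] jet_flag_0(1)[of e] jet_flag_0(2)[of ?c]
      by (simp add: hcoord_0 frame_0 nth symmetric2_def del: One_nat_def)
    also have "(\<exists>k. A *v axis (Inl ?c) 1 = k *s axis (Inl ?c) 1) \<longleftrightarrow> (\<forall>a. a \<noteq> Inl ?c \<longrightarrow> A $ a $ Inl ?c
        = 0)"
      unfolding vec_eq_iff vector_smult_component nth by (auto simp: axis_def)
    also have "(\<forall>a. a \<noteq> Inl ?c \<longrightarrow> A $ a $ Inl ?c = 0) \<and> (\<forall>i j. A $ Inr (slot ?c i) $ Inl (slot ?c j)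
        = 0) \<longleftrightarrow>
        A \<in> sp_degrees ?c {0..3}" (is "?L \<longleftrightarrow> ?R")
    proof
      assume L: ?L
      have s: "A $ Inr a $ Inl b = A $ Inr b $ Inl a" "A $ Inr a $ Inr b = - A $ Inl b $ Inl a" for a b
        using sp_symmetric[OF A, of "axis (Inl b) 1" "axis (Inl a) 1"]
          sp_symmetric[OF A, of "axis (Inr b) 1" "axis (Inl a) 1"] by
              (simp_all add: nth minus_equation_iff[of "A $ Inr a $ Inr b"] eq_commute[of
                  "A $ Inl b $ Inl a"])
      have "weight ?c a - weight ?c b \<ge> 0" if nz: "A $ a $ b \<noteq> 0" for a b
      proof (rule ccontr)
        assume neg: "\<not> weight ?c a - weight ?c b \<ge> 0"
        show False
          using neg nz L s[of ?c]
          by (cases a rule: slot_index_cases[where c = ?c]; cases b rule: slot_index_cases[where c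
              = ?c]) auto
      qed
      then show ?R using A sp_degrees_all[of ?c] unfolding sp_degrees_def by fastforce
    next
      assume R: ?R
      have "A $ a $ b = 0" if "weight ?c a < weight ?c b" for a b
        using R that unfolding sp_degrees_def by force
      moreover have "weight ?c a < weight ?c (Inl ?c)" if "a \<noteq> Inl ?c" for a
        using that by (auto simp: weight_def split: sum.split)
      moreover have "weight ?c (Inr (slot ?c i)) < weight ?c (Inl (slot ?c j))" for i j by simp
      ultimately show ?L by blast
    qed
    finally show ?thesis .
  qed
  then show ?thesis unfolding flag_stabilizer_def sp_degrees_def by blast
qed

section \<open>The symmetry algebra\<close>

theorem proposition3p16:
  fixes U :: "'n::finite jet1 set"
    and e :: "nat \<Rightarrow> 'n option"
  assumes "open U" "connected U" "U \<noteq> {}"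
    and "bij_betw e {1..CARD('n) + 1} UNIV"
  shows "contact_symmetries U = gen_span U (\<Union>k\<in>{-3..3}. generators k) \<and>
    (\<exists>\<phi>. lie_isomorphism U \<phi> \<and>
      (\<forall>k. \<phi> ` gen_span U (generators k) = sp_grading e {1, CARD('n) + 1} k) \<and>
      (\<forall>x u p q. (x, u, p) \<in> U \<and> (x, u, p, q) \<in> J2 \<longrightarrow>
        (\<exists>l L. line_lagrangian_flag l L \<and>
          \<phi> ` isotropy U (x, u, p, q) = flag_stabilizer l L)) \<and>
      (0 \<in> U \<longrightarrow>
        isotropy U 0 = gen_span U (\<Union>k\<in>{0..3}. generators k) \<and>
        \<phi> ` isotropy U 0 = flag_stabilizer (std_line e) std_lagrangian))"
proof -
  define c where "c = e 1"
  define \<phi> where "\<phi> = the_inv_into sp (ham_on U c)"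
  note inj = ham_on_inj_on[OF assms(1,3), of c]
  note sym = contact_symmetries_eq[OF assms(1-3), of c]
  have \<phi>: "\<phi> (ham_on U c A) = A" if "A \<in> sp" for A
    unfolding \<phi>_def by (rule the_inv_into_f_f[OF inj that])
  have \<phi>_image: "\<phi> ` ham_on U c ` M = M" if "M \<subseteq> sp" for M
    using \<phi> that by (force simp: image_image)
  have sp_deg: "sp_degrees c K \<subseteq> sp" and flag: "flag_stabilizer l L \<subseteq> sp" for K l L
    by (auto simp: sp_degrees_def flag_stabilizer_def)
  have iso: "lie_isomorphism U \<phi>"
    unfolding lie_isomorphism_def sym
  proof (intro conjI ballI allI)
    show "bij_betw \<phi> (ham_on U c ` sp) sp"
      unfolding \<phi>_def by (intro bij_betw_the_inv_into inj_on_imp_bij_betw inj)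
    fix f assume "f \<in> ham_on U c ` sp"
    then obtain A where A: "A \<in> sp" "f = ham_on U c A" by blast
    have scale: "(\<lambda>z. k * f z) = ham_on U c (map_matrix ((*) k) A)" for k
      by (auto simp: fun_eq_iff A(2) ham_on_def restrict0_def ham_scale)
    show "(\<lambda>z. k * f z) \<in> ham_on U c ` sp" "\<phi> (\<lambda>z. k * f z) = map_matrix ((*) k) (\<phi> f)" for k
      unfolding scale using sp_scale[OF A(1), of k] by (auto simp: \<phi> A)
    fix g assume "g \<in> ham_on U c ` sp"
    then obtain B where B: "B \<in> sp" "g = ham_on U c B" by blast
    have add: "(\<lambda>z. f z + g z) = ham_on U c (A + B)"
      by (auto simp: fun_eq_iff A(2) B(2) ham_on_def restrict0_def ham_add)
    show "(\<lambda>z. f z + g z) \<in> ham_on U c ` sp" "\<phi> (\<lambda>z. f z + g z) = \<phi> f + \<phi> g"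
      unfolding add using sp_add[OF A(1) B(1)] by (auto simp: \<phi> A B)
    have bracket: "restrict0 U (lagrange_bracket f g) = ham_on U c (commutator A B)"
      unfolding A(2) B(2) by (rule lagrange_bracket_ham_on[OF A(1) B(1) assms(1)])
    show "restrict0 U (lagrange_bracket f g) \<in> ham_on U c ` sp"
      "\<phi> (restrict0 U (lagrange_bracket f g)) = commutator (\<phi> f) (\<phi> g)"
      unfolding bracket using sp_commutator[OF A(1) B(1)] by (auto simp: \<phi> A B)
  qed
  have grading: "\<phi> ` gen_span U (generators k) = sp_grading e {1, CARD('n) + 1} k" for k
  proof -
    have "gen_span U (generators k) = ham_on U c ` sp_degrees c {k}"
      using gen_span_eq_ham_on[of U "{k}" c] by simp
    then show ?thesis
      by (simp only: \<phi>_image[OF sp_deg] sp_grading_eq[OF assms(4)]) (simp only: c_def)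
  qed
  have flags: "\<exists>l L. line_lagrangian_flag l L \<and> \<phi> ` isotropy U (x, u, p, q) = flag_stabilizer l L"
    if "(x, u, p) \<in> U" "(x, u, p, q) \<in> J2" for x u p q
  proof -
    have q: "symmetric2 q" using that(2) by (simp add: J2_def)
    show ?thesis
      using jet_flag[OF q] isotropy_eq[OF assms(1,2) that(1) q, of c] \<phi>_image[OF flag] by metis
  qed
  have origin: "isotropy U 0 = gen_span U (\<Union>k\<in>{0..3}. generators k)"
    "\<phi> ` isotropy U 0 = flag_stabilizer (std_line e) std_lagrangian" if "0 \<in> U"
  proof -
    have isotropy_0: "isotropy U 0 = ham_on U c ` flag_stabilizer (std_line e) std_lagrangian"
      using isotropy_eq[OF assms(1,2), of 0 0 0 0 c] that jet_flag_0(1)[of e] jet_flag_0(2)[of c]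
      by (simp add: zero_prod_def symmetric2_def c_def)
    show "isotropy U 0 = gen_span U (\<Union>k\<in>{0..3}. generators k)"
      unfolding isotropy_0 flag_stabilizer_std gen_span_eq_ham_on[of U _ c] by (simp only: c_def)
    show "\<phi> ` isotropy U 0 = flag_stabilizer (std_line e) std_lagrangian"
      unfolding isotropy_0 by (rule \<phi>_image[OF flag])
  qed
  have "contact_symmetries U = gen_span U (\<Union>k\<in>{-3..3}. generators k)"
    unfolding sym gen_span_eq_ham_on[of U _ c] sp_degrees_all by simp
  then show ?thesis
    by (intro conjI exI[of _ \<phi>] allI impI iso grading flags origin) simp_all
qed

end
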